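(* Consider the coagulation equation with constant kernel $K(x,y)\equiv2$ on $(0,\infty)^2$. There exists a unique solution $f$ to the constant kernel coagulation equation with a flux from zero with initial data $f_0=0$. This solution converges, as $t\to\infty$, to the stationary solution of the flux equation: $$f_t(\mathrm{d}x)\to\frac{1}{2\sqrt{\pi}}\,x^{-\frac32}\,\mathrm{d}x,\qquad t\to\infty,$$ weakly as measures on $(0,\infty)$, i.e. when tested against functions in $C_c((0,\infty))$.
   Context: Notation: $\mathbb{R}_*=(0,\infty)$, $\mathbb{R}_+=[0,\infty)$. $\mathcal{M}_+(\mathbb{R}_* )$ denotes positive Radon measures on $\mathbb{R}_*$ and $\mathcal{M}_{+,b}(\mathbb{R}_* )$ the bounded ones; $xf$ denotes the measure $x f(\mathrm{d}x)$. Continuity in time of measure-valued maps is in the weak* sense (i.e. $t\mapsto\int\phi\,\mathrm{d}\mu_t$ is continuous for each $\phi\in C_c(\mathbb{R}_* )$). Definition. A time-dependent measure $f\in C([0,\infty),\mathcal{M}_+(\mathbb{R}_* ))$ satisfies the constant kernel coagulation equation with a flux from zero (with zero initial data) if $xf\in C([0,\infty),\mathcal{M}_{+,b}(\mathbb{R}_* ))$ and for all $\phi\in C^1_c(\mathbb{R}_+)$ and all $t>0$ $$\int_{\mathbb{R}_*}\phi(x)\,x f_t(\mathrm{d}x)=\int_0^t\int_{\mathbb{R}_*}\int_{\mathbb{R}_*}\big((x+y)\phi(x+y)-x\phi(x)-y\phi(y)\big)f_s(\mathrm{d}x)f_s(\mathrm{d}y)\,\mathrm{d}s+t\,\phi(0).$$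 *)

theory Defs
  imports "HOL-Analysis.Analysis"
begin

(* A Radon measure on S carries the trace Borel sigma-algebra of S (so two of them are equal as HOL
   measures iff they agree on all Borel subsets of S).  For S = {0<..} every Borel measure that is
   finite on compact sets is automatically inner and outer regular. *)
definition radon_measure_on :: "real set \<Rightarrow> real measure \<Rightarrow> bool" where
  "radon_measure_on S \<mu> \<longleftrightarrow>
     sets \<mu> = sets (restrict_space borel S) \<and>
     (\<forall>K. compact K \<and> K \<subseteq> S \<longrightarrow> emeasure \<mu> K < \<infinity>)"

(* Test functions on S are represented by functions on all of \<real>; their values outside S
   are arbitrary and never matter. *)
definition compact_support_on :: "real set \<Rightarrow> (real \<Rightarrow> real) \<Rightarrow> bool" where
  "compact_support_on S \<phi> \<longleftrightarrow> (\<exists>K. compact K \<and> K \<subseteq> S \<and> (\<forall>x\<in>S - K. \<phi> x = 0))"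

definition Cc :: "real set \<Rightarrow> (real \<Rightarrow> real) set" where
  "Cc S = {\<phi>. continuous_on S \<phi> \<and> compact_support_on S \<phi>}"

(* For S = {0..} the derivative at 0 is one-sided, and \<phi> 0 need not vanish. *)
definition C1c :: "real set \<Rightarrow> (real \<Rightarrow> real) set" where
  "C1c S = {\<phi>. (\<exists>\<phi>'. (\<forall>x\<in>S. (\<phi> has_real_derivative \<phi>' x) (at x within S)) \<and> continuous_on S \<phi>')
               \<and> compact_support_on S \<phi>}"

definition weak_star_continuous_on :: "real set \<Rightarrow> real set \<Rightarrow> (real \<Rightarrow> real measure) \<Rightarrow> bool" where
  "weak_star_continuous_on S T \<mu> \<longleftrightarrow>
     (\<forall>\<phi>\<in>Cc S. continuous_on T (\<lambda>t. \<integral>x. \<phi> x \<partial>\<mu> t))"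

definition weak_star_tendsto ::
    "real set \<Rightarrow> (real \<Rightarrow> real measure) \<Rightarrow> real measure \<Rightarrow> real filter \<Rightarrow> bool" where
  "weak_star_tendsto S \<mu> \<nu> F \<longleftrightarrow>
     (\<forall>\<phi>\<in>Cc S. ((\<lambda>t. \<integral>x. \<phi> x \<partial>\<mu> t) \<longlongrightarrow> (\<integral>x. \<phi> x \<partial>\<nu>)) F)"

(* The measure x \<mu>(dx). *)
definition mass_measure :: "real measure \<Rightarrow> real measure" where
  "mass_measure \<mu> = density \<mu> (\<lambda>x. ennreal x)"

definition coag_increment :: "(real \<Rightarrow> real) \<Rightarrow> real \<Rightarrow> real \<Rightarrow> real" where
  "coag_increment \<phi> x y = (x + y) * \<phi> (x + y) - x * \<phi> x - y * \<phi> y"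

(* The weak coagulation operator for the kernel K = 2: the usual prefactor K / 2 equals 1. *)
definition coag_form :: "(real \<Rightarrow> real) \<Rightarrow> real measure \<Rightarrow> real" where
  "coag_form \<phi> \<mu> = (\<integral>x. (\<integral>y. coag_increment \<phi> x y \<partial>\<mu>) \<partial>\<mu>)"

(* Only the restriction of f to {0..} is meaningful.
   Since \<bar>coag_increment \<phi> x y\<bar> \<le> 2 * sup \<bar>\<phi>'\<bar> * x * y and mass_measure (f s) is
   finite, the integrals over space converge absolutely.  That the time integral
   exists is part of the equation and has to be said, because the Bochner integral of a
   non-integrable function is 0 by convention. *)
definition flux_solution :: "(real \<Rightarrow> real measure) \<Rightarrow> bool" where
  "flux_solution f \<longleftrightarrow>
     (\<forall>t\<ge>0. radon_measure_on {0<..} (f t)) \<and>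
     weak_star_continuous_on {0<..} {0..} f \<and>
     (\<forall>t\<ge>0. radon_measure_on {0<..} (mass_measure (f t)) \<and> finite_measure (mass_measure (f t))) \<and>
     weak_star_continuous_on {0<..} {0..} (\<lambda>t. mass_measure (f t)) \<and>
     f 0 = null_measure (restrict_space borel {0<..}) \<and>
     (\<forall>\<phi>\<in>C1c {0..}. \<forall>t>0.
        set_integrable lborel {0..t} (\<lambda>s. coag_form \<phi> (f s)) \<and>
        (\<integral>x. \<phi> x * x \<partial>f t) = (LINT s:{0..t}|lborel. coag_form \<phi> (f s)) + t * \<phi> 0)"

(* Time-independent form of the equation.  The mass of a stationary solution need not be
   finite (it is infinite for flux_profile), so absolute convergence is required explicitly. *)
definition stationary_flux_solution :: "real measure \<Rightarrow> bool" where
  "stationary_flux_solution \<mu> \<longleftrightarrow>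
     radon_measure_on {0<..} \<mu> \<and>
     (\<forall>\<phi>\<in>C1c {0..}.
        integrable (\<mu> \<Otimes>\<^sub>M \<mu>) (\<lambda>(x, y). coag_increment \<phi> x y) \<and>
        coag_form \<phi> \<mu> + \<phi> 0 = 0)"

definition flux_profile :: "real measure" where
  "flux_profile = density (restrict_space lborel {0<..})
     (\<lambda>x. ennreal (1 / (2 * sqrt pi) * x powr (- 3 / 2)))"

end

theory Submission
  imports Defs
begin

text \<open>
  Put \<open>U\<^sub>t(l) = \<integral> (1 - e\<^bsup>-lx\<^esup>) f\<^sub>t(dx)\<close>. The test function \<open>(1 - e\<^bsup>-lx\<^esup>) / x\<close> turns the equation into the
  Riccati equation \<open>U' = l - U\<^sup>2\<close>, \<open>U\<^sub>0 = 0\<close>, so \<open>U\<^sub>t(l) = \<surd>l tanh (t \<surd>l)\<close>. This determines \<open>f\<^sub>t\<close>,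
  because polynomials in \<open>e\<^bsup>-x\<^esup>\<close> are uniformly dense. The partial fractions of tanh exhibit
  \<open>U\<^sub>t\<close> as the transform of the positive density \<open>(2/t) \<Sum>\<^sub>k b\<^sub>k e\<^bsup>-b\<^sub>k x\<^esup>\<close> with \<open>b\<^sub>k = ((k + 1/2) \<pi> / t)\<^sup>2\<close>.
  For the test function \<open>e\<^bsup>-lx\<^esup>\<close> the equation is the derivative of the Riccati equation in \<open>l\<close>, and
  every \<open>C\<^sup>1\<close> test function is a limit of combinations of these. Finally \<open>U\<^sub>t(l) \<rightarrow> \<surd>l\<close>, which is the
  transform of \<open>x\<^bsup>-3/2\<^esup> / (2 \<surd>\<pi>)\<close>; convergence of the transforms gives weak convergence.
\<close>

section \<open>Partial fractions of the hyperbolic tangent\<close>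

text \<open>The profile has infinite mass, and both it and \<open>explicit_solution t\<close> for t
  > 0 have infinite total measure near 0. Every estimate is therefore made relative to the weight 1
  - exp (- x): approximation errors carry this factor, and after integration they become multiples
  of U(1) or of its square. The two families of test functions serve different ends. For existence,
  the increment is controlled through the derivative of the test function, and exponential sums can
  be fitted to that derivative. For uniqueness, (1 - exp (- (l * x))) / x yields a closed scalar
  equation for U, whereas exp (- (l * x)) yields one that couples U with its l-derivative. Since (1
  - exp (- (l * x))) / x is not compactly supported, it is reached through cutoffs, and the passage
  to the limit needs a bound on the mass, which is first extracted from the equation itself. The
  partial fractions of tanh are there for positivity: the formula for U alone does not show that U
  is the transform of a measure.\<close>

text \<open>Euler's product for the sine at the imaginary point i * y, brought back to the reals so
  that logarithms can be taken.\<close>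

lemma sinh_product_formula_real:
  fixes y :: real
  shows "(\<lambda>n. pi * y * (\<Prod>k=1..n. 1 + y\<^sup>2 / (real k)\<^sup>2)) \<longlonglongrightarrow> sinh (pi * y)"
proof -
  have "(\<lambda>n. of_real pi * (\<i> * of_real y) * (\<Prod>k=1..n. 1 - (\<i> * of_real y)^2 / of_nat k^2))
      \<longlonglongrightarrow> sin (of_real pi * (\<i> * complex_of_real y))"
    by (rule sin_product_formula_complex)
  also have "sin (of_real pi * (\<i> * complex_of_real y)) = \<i> * sinh (of_real (pi * y))"
    by (simp add: sinh_conv_sin mult_ac)
  finally have "(\<lambda>n. - \<i> * (of_real pi * (\<i> * of_real y) * (\<Prod>k=1..n. 1 - (\<i> * of_real y)^2 / of_nat k^2)))
      \<longlonglongrightarrow> - \<i> * (\<i> * sinh (complex_of_real (pi * y)))"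
    by (rule tendsto_mult[OF tendsto_const])
  also have "- \<i> * (\<i> * sinh (complex_of_real (pi * y))) = of_real (sinh (pi * y))"
    by (simp only: sinh_field_def exp_of_real flip: of_real_minus) simp
  also have "(\<lambda>n. - \<i> * (of_real pi * (\<i> * of_real y) * (\<Prod>k=1..n. 1 - (\<i> * of_real y)^2 / of_nat k^2)))
      = (\<lambda>n. complex_of_real (pi * y * (\<Prod>k=1..n. 1 + y\<^sup>2 / (real k)\<^sup>2)))"
  proof
    fix n
    have "- \<i> * (a * (\<i> * b) * c) = a * b * c" for a b c
      using complex_i_mult_minus[of "a * b * c"] by (simp add: mult_ac)
    then show "- \<i> * (of_real pi * (\<i> * of_real y) * (\<Prod>k=1..n. 1 - (\<i> * of_real y)^2 / of_nat k^2))
        = complex_of_real (pi * y * (\<Prod>k=1..n. 1 + y\<^sup>2 / (real k)\<^sup>2))"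
      by (simp add: power_mult_distrib)
  qed
  finally show ?thesis
    by (simp only: tendsto_of_real_iff)
qed

text \<open>The logarithm turns the product into a series, which can be differentiated
  termwise.\<close>

lemma sums_ln_sinh:
  fixes y :: real
  assumes "y > 0"
  shows "(\<lambda>n. ln (1 + y\<^sup>2 / (real (Suc n))\<^sup>2)) sums (ln (sinh (pi * y)) - ln (pi * y))"
proof -
  have "(\<lambda>n. ln (pi * y * (\<Prod>k=1..n. 1 + y\<^sup>2 / (real k)\<^sup>2))) \<longlonglongrightarrow> ln (sinh (pi * y))"
    using assms by (intro tendsto_ln sinh_product_formula_real) auto
  also have "(\<lambda>n. ln (pi * y * (\<Prod>k=1..n. 1 + y\<^sup>2 / (real k)\<^sup>2)))
      = (\<lambda>n. ln (pi * y) + (\<Sum>k<n. ln (1 + y\<^sup>2 / (real (Suc k))\<^sup>2)))"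
  proof
    fix n
    have pos: "1 + y\<^sup>2 / (real k)\<^sup>2 > 0" for k
      by (intro add_pos_nonneg) auto
    have "ln (pi * y * (\<Prod>k=1..n. 1 + y\<^sup>2 / (real k)\<^sup>2))
        = ln (pi * y) + ln (\<Prod>k=1..n. 1 + y\<^sup>2 / (real k)\<^sup>2)"
      using assms pos by (intro ln_mult_pos) (auto intro: prod_pos)
    also have "ln (\<Prod>k=1..n. 1 + y\<^sup>2 / (real k)\<^sup>2) = (\<Sum>k=1..n. ln (1 + y\<^sup>2 / (real k)\<^sup>2))"
      using pos by (intro ln_prod) (auto simp: less_imp_neq[symmetric])
    also have "\<dots> = (\<Sum>k<n. ln (1 + y\<^sup>2 / (real (Suc k))\<^sup>2))"
      by (rule sum.reindex_bij_witness[of _ Suc "\<lambda>k. k - 1"]) auto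
    finally show "ln (pi * y * (\<Prod>k=1..n. 1 + y\<^sup>2 / (real k)\<^sup>2))
        = ln (pi * y) + (\<Sum>k<n. ln (1 + y\<^sup>2 / (real (Suc k))\<^sup>2))" .
  qed
  finally have "(\<lambda>n. ln (pi * y) + (\<Sum>k<n. ln (1 + y\<^sup>2 / (real (Suc k))\<^sup>2)) - ln (pi * y))
      \<longlonglongrightarrow> ln (sinh (pi * y)) - ln (pi * y)"
    by (intro tendsto_diff tendsto_const)
  then show ?thesis
    by (simp add: sums_def)
qed

text \<open>Logarithmic derivative of the product for sinh. The Weierstrass test justifies
  differentiating the series term by term.\<close>

lemma coth_partial_fractions:
  fixes y :: real
  assumes y: "y > 0"
  shows "(\<lambda>n. 2 * y / (y\<^sup>2 + (real (Suc n))\<^sup>2)) sums (pi * cosh (pi * y) / sinh (pi * y) - 1 / y)"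
proof -
  \<comment> \<open>A bounded neighbourhood of y: the factor 2 * x in the derivatives has to be
    bounded uniformly for the comparison with 1 / (n + 1)^2.\<close>
  define S where "S = {0<..<y + 1}"
  define f' where "f' = (\<lambda>n y. 2 * y / (y\<^sup>2 + (real (Suc n))\<^sup>2))"
  have bound: "norm (f' n x) \<le> 2 * (y + 1) * (1 / (real (Suc n))\<^sup>2)" if "x \<in> S" for n x
  proof -
    have "2 * x / (x\<^sup>2 + (real (Suc n))\<^sup>2) \<le> 2 * (y + 1) / (real (Suc n))\<^sup>2"
      using that by (intro frac_le) (auto simp: S_def)
    then show ?thesis
      using that by (simp add: f'_def S_def)
  qed
  have sm: "summable (\<lambda>n. 1 / (real (Suc n))\<^sup>2)"
    using inverse_squares_sums by (auto simp: sums_iff add_ac)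
  have uc: "uniformly_convergent_on S (\<lambda>n x. \<Sum>i<n. f' i x)"
    by (rule Weierstrass_m_test'[OF bound summable_mult[OF sm]])
  have der: "((\<lambda>x. ln (1 + x\<^sup>2 / (real (Suc n))\<^sup>2)) has_field_derivative f' n x) (at x within S)"
    if "x \<in> S" for n x
  proof -
    have p: "1 + x\<^sup>2 / (real (Suc n))\<^sup>2 > 0"
      by (intro add_pos_nonneg) auto
    show ?thesis
      using p by (auto intro!: derivative_eq_intros simp: f'_def divide_simps)
  qed
  have yS: "y \<in> S" "y \<in> interior S"
    using y by (auto simp: S_def)
  have smy: "summable (\<lambda>n. ln (1 + y\<^sup>2 / (real (Suc n))\<^sup>2))"
    using sums_ln_sinh[OF y] by (simp add: sums_iff)
  have "((\<lambda>x. \<Sum>n. ln (1 + x\<^sup>2 / (real (Suc n))\<^sup>2)) has_field_derivative (\<Sum>n. f' n y)) (at y)"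
    by (rule has_field_derivative_series'(2)[OF _ der uc yS(1) smy yS(2)]) (auto simp: S_def)
  moreover have "\<forall>\<^sub>F x in nhds y. (\<Sum>n. ln (1 + x\<^sup>2 / (real (Suc n))\<^sup>2)) = ln (sinh (pi * x)) - ln (pi * x)"
    using eventually_nhds_in_open[of "{0<..}" y] y
    by (auto elim!: eventually_mono dest!: sums_ln_sinh simp: sums_iff)
  ultimately have "((\<lambda>x. ln (sinh (pi * x)) - ln (pi * x)) has_field_derivative (\<Sum>n. f' n y)) (at y)"
    by (simp add: DERIV_cong_ev)
  moreover have "((\<lambda>x. ln (sinh (pi * x)) - ln (pi * x)) has_field_derivative
      (pi * cosh (pi * y) / sinh (pi * y) - 1 / y)) (at y)"
    using y by (auto intro!: derivative_eq_intros simp: field_simps)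
  ultimately have "(\<Sum>n. f' n y) = pi * cosh (pi * y) / sinh (pi * y) - 1 / y"
    by (rule DERIV_unique)
  moreover have "summable (\<lambda>n. f' n y)"
    by (rule summable_comparison_test'[OF summable_mult[OF sm] bound[OF yS(1)]])
  ultimately show ?thesis
    by (simp add: sums_iff f'_def)
qed

text \<open>Uses tanh x = 2 * coth (2 * x) - coth x. The first term has its fractions at all
  multiples of pi / 2, the second at the multiples of pi; the odd multiples of pi / 2
  survive.\<close>

lemma tanh_partial_fractions:
  fixes x :: real
  assumes x: "x > 0"
  shows "(\<lambda>k. 2 * x / (x\<^sup>2 + ((real k + 1/2) * pi)\<^sup>2)) sums tanh x"
proof -
  define g where "g = (\<lambda>n. 2 * x / (x\<^sup>2 + (real (Suc n) * pi / 2)\<^sup>2))"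
  have 1: "(\<lambda>n. 2 * x / (x\<^sup>2 + (real (Suc n) * pi)\<^sup>2)) sums (cosh x / sinh x - 1 / x)"
  proof -
    have "(\<lambda>n. 2 * (x/pi) / ((x/pi)\<^sup>2 + (real (Suc n))\<^sup>2) / pi)
        sums ((pi * cosh (pi * (x/pi)) / sinh (pi * (x/pi)) - 1 / (x/pi)) / pi)"
      using x by (intro sums_divide coth_partial_fractions) auto
    also have "(pi * cosh (pi * (x/pi)) / sinh (pi * (x/pi)) - 1 / (x/pi)) / pi = cosh x / sinh x - 1 / x"
      using x by (simp add: field_simps)
    also have "(\<lambda>n. 2 * (x/pi) / ((x/pi)\<^sup>2 + (real (Suc n))\<^sup>2) / pi)
        = (\<lambda>n. 2 * x / (x\<^sup>2 + (real (Suc n) * pi)\<^sup>2))"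
    proof
      fix n
      have "x\<^sup>2 + (real (Suc n) * pi)\<^sup>2 > 0" "(x/pi)\<^sup>2 + (real (Suc n))\<^sup>2 > 0"
        using x by (auto intro: add_pos_nonneg)
      moreover have "(x\<^sup>2 + (real (Suc n) * pi)\<^sup>2) = pi\<^sup>2 * ((x/pi)\<^sup>2 + (real (Suc n))\<^sup>2)"
        by (simp add: power_mult_distrib power_divide distrib_left)
      ultimately show "2 * (x/pi) / ((x/pi)\<^sup>2 + (real (Suc n))\<^sup>2) / pi = 2 * x / (x\<^sup>2 + (real (Suc n) * pi)\<^sup>2)"
        by (simp add: power2_eq_square)
    qed
    finally show ?thesis .
  qed
  have 2: "g sums (2 * (cosh (2 * x) / sinh (2 * x)) - 1 / x)"
  proof -
    have "(\<lambda>n. 2 * (2 * x / pi) / ((2 * x / pi)\<^sup>2 + (real (Suc n))\<^sup>2) * (2 / pi))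
        sums ((pi * cosh (pi * (2 * x / pi)) / sinh (pi * (2 * x / pi)) - 1 / (2 * x / pi)) * (2 / pi))"
      using x by (intro sums_mult2 coth_partial_fractions) auto
    also have "(pi * cosh (pi * (2 * x / pi)) / sinh (pi * (2 * x / pi)) - 1 / (2 * x / pi)) * (2 / pi)
        = 2 * (cosh (2 * x) / sinh (2 * x)) - 1 / x"
      using x by (simp add: field_simps)
    also have "(\<lambda>n. 2 * (2 * x / pi) / ((2 * x / pi)\<^sup>2 + (real (Suc n))\<^sup>2) * (2 / pi)) = g"
    proof
      fix n
      define E where "E = (2 * x / pi)\<^sup>2 + (real (Suc n))\<^sup>2"
      have E: "E > 0"
        using x by (auto simp: E_def intro: add_pos_nonneg)
      have eq: "x\<^sup>2 + (real (Suc n) * pi / 2)\<^sup>2 = pi\<^sup>2 / 4 * E"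
        by (simp add: E_def power_mult_distrib power_divide distrib_left)
      show "2 * (2 * x / pi) / ((2 * x / pi)\<^sup>2 + (real (Suc n))\<^sup>2) * (2 / pi) = g n"
        unfolding g_def E_def[symmetric] eq using E by (simp add: power2_eq_square)
    qed
    finally show ?thesis .
  qed
  \<comment> \<open>The n-th pair holds the fraction at (n + 1/2) * pi and the one at (n + 1) * pi;
    the latter cancels against the n-th term of coth.\<close>
  have "(\<lambda>n. sum g {n * 2..<n * 2 + 2}) sums (2 * (cosh (2 * x) / sinh (2 * x)) - 1 / x)"
    using 2 by (rule sums_group) simp
  from sums_diff[OF this 1]
  have "(\<lambda>n. sum g {n * 2..<n * 2 + 2} - 2 * x / (x\<^sup>2 + (real (Suc n) * pi)\<^sup>2))
      sums (2 * (cosh (2 * x) / sinh (2 * x)) - cosh x / sinh x)"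
    by simp
  also have "(\<lambda>n. sum g {n * 2..<n * 2 + 2} - 2 * x / (x\<^sup>2 + (real (Suc n) * pi)\<^sup>2))
      = (\<lambda>k. 2 * x / (x\<^sup>2 + ((real k + 1/2) * pi)\<^sup>2))"
  proof
    fix n :: nat
    have "sum g {n * 2..<n * 2 + 2} = g (2 * n) + g (2 * n + 1)"
      by (simp add: numeral_2_eq_2 mult.commute)
    moreover have "g (2 * n + 1) = 2 * x / (x\<^sup>2 + (real (Suc n) * pi)\<^sup>2)"
    proof -
      have "real (Suc (2 * n + 1)) * pi / 2 = real (Suc n) * pi"
        by (simp add: field_simps)
      then show ?thesis
        unfolding g_def by (simp only:)
    qed
    moreover have "g (2 * n) = 2 * x / (x\<^sup>2 + ((real n + 1/2) * pi)\<^sup>2)"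
      by (simp add: g_def field_simps)
    ultimately show "sum g {n * 2..<n * 2 + 2} - 2 * x / (x\<^sup>2 + (real (Suc n) * pi)\<^sup>2)
        = 2 * x / (x\<^sup>2 + ((real n + 1/2) * pi)\<^sup>2)"
      by simp
  qed
  also have "2 * (cosh (2 * x) / sinh (2 * x)) - cosh x / sinh x = tanh x"
  proof -
    have "sinh x > 0" "cosh x > 0"
      using x by auto
    then show ?thesis
      unfolding sinh_double cosh_double by (simp add: tanh_def field_simps power2_eq_square)
  qed
  finally show ?thesis .
qed

section \<open>Measures integrating \<open>1 - e\<^bsup>-x\<^esup>\<close>\<close>

text \<open>The Laplace exponent (Bernstein function) of a Levy measure. Subtracting the exponential
  from 1 keeps it finite when \<mu> is infinite near 0.\<close>

definition bernstein :: "real measure \<Rightarrow> real \<Rightarrow> real" where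
  "bernstein \<mu> l = (\<integral>x. 1 - exp (- (l * x)) \<partial>\<mu>)"

text \<open>The Laplace transform of x \<mu>(dx), that is, the l-derivative of
  \<open>bernstein\<close>. For l > 0 the exponential keeps it finite even if the mass is
  infinite.\<close>

definition mass_laplace :: "real measure \<Rightarrow> real \<Rightarrow> real" where
  "mass_laplace \<mu> l = (\<integral>x. x * exp (- (l * x)) \<partial>\<mu>)"

text \<open>Bernoulli's inequality for exp (- x) - 1 \<ge> - 1. It lets integrability at l = 1 imply
  integrability at every l.\<close>

lemma one_minus_exp_le:
  fixes x :: real
  assumes "x \<ge> 0"
  shows "1 - exp (- (real n * x)) \<le> real n * (1 - exp (- x))"
proof -
  have "1 + real n * (exp (- x) - 1) \<le> (1 + (exp (- x) - 1)) ^ n"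
    by (intro Bernoulli_inequality) simp
  also have "\<dots> = exp (- (real n * x))"
    by (simp flip: exp_of_nat_mult)
  finally show ?thesis
    by (simp add: algebra_simps)
qed

text \<open>From 1 + x \<le> exp x. It trades a mass factor x damped by an exponential for the
  weight 1 - exp (- x).\<close>

lemma mult_exp_le:
  fixes x :: real
  shows "x * exp (- x) \<le> 1 - exp (- x)"
proof -
  have "(1 + x) * exp (- x) \<le> exp x * exp (- x)"
    by (intro mult_right_mono) auto
  then show ?thesis
    by (simp add: algebra_simps flip: exp_add)
qed

lemma DERIV_imp_LIMSEQ:
  fixes f :: "real \<Rightarrow> real"
  assumes "(f has_real_derivative D) (at x)" "h \<longlonglongrightarrow> 0" "\<And>n. h n \<noteq> 0"
  shows "(\<lambda>n. (f (x + h n) - f x) / h n) \<longlonglongrightarrow> D"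
  by (rule filterlim_compose[OF assms(1)[unfolded DERIV_def]]) (use assms(2,3) in \<open>simp add: filterlim_at\<close>)

lemma integral_linear_diff:
  fixes f g :: "'a \<Rightarrow> real"
  assumes "integrable M f" "integrable M g"
  shows "(\<integral>x. a * f x - b * g x \<partial>M) = a * integral\<^sup>L M f - b * integral\<^sup>L M g"
  using assms by simp

text \<open>The common setting for solutions at every time and for the profile. Since 1 - exp (- x)
  is comparable to min 1 x, this is the integrability condition for the Levy measure of a
  subordinator.\<close>

locale levy_measure =
  fixes \<mu> :: "real measure"
  assumes sets_eq: "sets \<mu> = sets (restrict_space borel {0<..})"
    and integrable_weight: "integrable \<mu> (\<lambda>x. 1 - exp (- x))"
begin

lemma space_eq: "space \<mu> = {0<..}"
  using sets_eq_imp_space_eq[OF sets_eq] by (simp add: space_restrict_space)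

lemma sets_eqI: "A \<in> sets borel \<Longrightarrow> A \<subseteq> {0<..} \<Longrightarrow> A \<in> sets \<mu>"
  by (simp add: sets_eq sets_restrict_space_iff)

lemma measurable_eq: "measurable \<mu> M = measurable (restrict_space borel {0<..}) M"
  by (rule measurable_cong_sets) (auto simp: sets_eq)

lemma borel_measurable_continuous: "continuous_on {0<..} f \<Longrightarrow> f \<in> borel_measurable \<mu>"
  for f :: "real \<Rightarrow> real"
  unfolding measurable_eq by (rule borel_measurable_continuous_on_restrict)

lemma borel_measurable_borel: "f \<in> measurable borel M \<Longrightarrow> f \<in> measurable \<mu> M"
  unfolding measurable_eq by (rule measurable_restrict_space1)

lemma integrable_one_minus_exp:
  assumes "l \<ge> 0"
  shows "integrable \<mu> (\<lambda>x. 1 - exp (- (l * x)))"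
proof -
  obtain n :: nat where n: "l \<le> real n"
    using real_arch_simple by blast
  show ?thesis
  proof (rule Bochner_Integration.integrable_bound)
    show "integrable \<mu> (\<lambda>x. real n * (1 - exp (- x)))"
      by (intro integrable_mult_right integrable_weight)
    show "(\<lambda>x. 1 - exp (- (l * x))) \<in> borel_measurable \<mu>"
      by (intro borel_measurable_continuous continuous_intros)
    show "AE x in \<mu>. norm (1 - exp (- (l * x))) \<le> norm (real n * (1 - exp (- x)))"
    proof (rule AE_I2)
      fix x assume "x \<in> space \<mu>"
      then have x: "x > 0"
        by (simp add: space_eq)
      have "norm (1 - exp (- (l * x))) = 1 - exp (- (l * x))"
        using assms x by simp
      also have "\<dots> \<le> 1 - exp (- (real n * x))"
        using n x by simp
      also have "\<dots> \<le> real n * (1 - exp (- x))"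
        using x by (intro one_minus_exp_le) simp
      also have "\<dots> \<le> norm (real n * (1 - exp (- x)))"
        by simp
      finally show "norm (1 - exp (- (l * x))) \<le> norm (real n * (1 - exp (- x)))" .
    qed
  qed
qed

lemma integrable_mult_exp:
  assumes "l > 0"
  shows "integrable \<mu> (\<lambda>x. x * exp (- (l * x)))"
proof (rule Bochner_Integration.integrable_bound)
  show "integrable \<mu> (\<lambda>x. (1 - exp (- (l * x))) / l)"
    using assms by (intro integrable_divide integrable_one_minus_exp) auto
  show "(\<lambda>x. x * exp (- (l * x))) \<in> borel_measurable \<mu>"
    by (intro borel_measurable_continuous continuous_intros)
  show "AE x in \<mu>. norm (x * exp (- (l * x))) \<le> norm ((1 - exp (- (l * x))) / l)"
  proof (rule AE_I2)
    fix x assume "x \<in> space \<mu>"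
    then have x: "x > 0"
      by (simp add: space_eq)
    then show "norm (x * exp (- (l * x))) \<le> norm ((1 - exp (- (l * x))) / l)"
      using mult_exp_le[of "l * x"] assms by (simp add: field_simps)
  qed
qed

lemma bernstein_nonneg: "l \<ge> 0 \<Longrightarrow> bernstein \<mu> l \<ge> 0"
  unfolding bernstein_def by (intro integral_nonneg_AE AE_I2) (simp add: space_eq)

text \<open>Markov's inequality for the weight, which exceeds 1 - exp (- a) beyond a.\<close>

lemma emeasure_greaterThan_finite:
  assumes "a > 0"
  shows "emeasure \<mu> {a<..} < \<infinity>"
proof -
  define c where "c = 1 - exp (- a)"
  have c: "c > 0"
    using assms by (simp add: c_def)
  have S: "{a<..} \<in> sets \<mu>"
    using assms by (intro sets_eqI) auto
  have "emeasure \<mu> {a<..} = (\<integral>\<^sup>+x. indicator {a<..} x \<partial>\<mu>)"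
    using S by simp
  also have "\<dots> \<le> (\<integral>\<^sup>+x. ennreal (1 / c * (1 - exp (- x))) \<partial>\<mu>)"
  proof (intro nn_integral_mono)
    fix x assume "x \<in> space \<mu>"
    then have "x > 0"
      by (simp add: space_eq)
    have "1 \<le> 1 / c * (1 - exp (- x))" if "a < x"
      using that c by (simp add: c_def field_simps)
    then show "indicator {a<..} x \<le> ennreal (1 / c * (1 - exp (- x)))"
      by (auto simp: indicator_def)
  qed
  also have "\<dots> < \<infinity>"
    using integrable_mult_right[OF integrable_weight, of "1 / c"] c
    by (subst nn_integral_eq_integral) (auto simp: space_eq intro!: AE_I2)
  finally show ?thesis .
qed

lemma emeasure_compact_finite:
  assumes "compact K" "K \<subseteq> {0<..}"
  shows "emeasure \<mu> K < \<infinity>"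
proof (cases "K = {}")
  case False
  then obtain a where a: "a \<in> K" "\<And>x. x \<in> K \<Longrightarrow> a \<le> x"
    using compact_attains_inf[OF assms(1)] by blast
  then have "a > 0"
    using assms by auto
  have "emeasure \<mu> K \<le> emeasure \<mu> {a/2<..}"
  proof (rule emeasure_mono)
    show "K \<subseteq> {a/2<..}"
      using a \<open>a > 0\<close> by force
    show "{a/2<..} \<in> sets \<mu>"
      using \<open>a > 0\<close> by (intro sets_eqI) auto
  qed
  also have "\<dots> < \<infinity>"
    using \<open>a > 0\<close> by (intro emeasure_greaterThan_finite) simp
  finally show ?thesis .
qed simp

lemma radon_measure_on: "radon_measure_on {0<..} \<mu>"
  using emeasure_compact_finite sets_eq by (auto simp: radon_measure_on_def)

text \<open>Exhaustion by half-lines bounded away from 0. Sigma-finiteness is what Fubini on \<mu>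
  \<Otimes> \<mu> requires.\<close>

sublocale sigma_finite_measure \<mu>
proof
  let ?A = "\<lambda>n::nat. {1 / real (Suc n)<..}"
  have pos: "1 / real (Suc n) > 0" for n
    by simp
  have "x \<in> (\<Union>n. ?A n)" if "x > 0" for x
    using nat_approx_posE[OF that] by (metis UN_I UNIV_I greaterThan_iff)
  moreover have gp: "x > 0" if "x \<in> ?A n" for x n
    using that pos[of n] by (meson greaterThan_iff less_trans)
  ultimately have "(\<Union>n. ?A n) = space \<mu>"
    unfolding space_eq by blast
  moreover have "?A n \<in> sets \<mu>" for n
    by (rule sets_eqI) (use gp in \<open>auto intro: borel_open\<close>)
  moreover have "emeasure \<mu> (?A n) \<noteq> \<infinity>" for n
    using emeasure_greaterThan_finite[OF pos] by (rule less_imp_neq)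
  ultimately show "\<exists>A. countable A \<and> A \<subseteq> sets \<mu> \<and> \<Union> A = space \<mu> \<and> (\<forall>a\<in>A. emeasure \<mu> a \<noteq> \<infinity>)"
    by (intro exI[of _ "range ?A"]) auto
qed

sublocale pair_sigma_finite \<mu> \<mu> ..

text \<open>Differentiability is a hypothesis because in each application a closed form of
  \<open>bernstein\<close> supplies it; only the value of the derivative has to be identified. Right
  difference quotients suffice for that, and (1 - exp (- (h * x))) / h \<le> x gives the dominating
  function.\<close>

lemma has_derivative_bernstein:
  assumes l: "l > 0" and D: "(bernstein \<mu> has_real_derivative D) (at l)"
  shows "mass_laplace \<mu> l = D"
proof -
  define h :: "nat \<Rightarrow> real" where "h = (\<lambda>n. 1 / real (Suc n))"
  have h: "h n > 0" for n
    by (simp add: h_def)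
  have h0: "h \<longlonglongrightarrow> 0"
    unfolding h_def using LIMSEQ_inverse_real_of_nat by (simp add: inverse_eq_divide)
  have "(\<lambda>n. (bernstein \<mu> (l + h n) - bernstein \<mu> l) / h n) \<longlonglongrightarrow> D"
    using D h0 h by (intro DERIV_imp_LIMSEQ) (auto simp: less_imp_neq[symmetric])
  moreover have "(\<lambda>n. (bernstein \<mu> (l + h n) - bernstein \<mu> l) / h n) \<longlonglongrightarrow> mass_laplace \<mu> l"
  proof -
    have eq: "(bernstein \<mu> (l + h n) - bernstein \<mu> l) / h n
        = (\<integral>x. exp (- (l * x)) * ((1 - exp (- (h n * x))) / h n) \<partial>\<mu>)" for n
    proof -
      have "bernstein \<mu> (l + h n) - bernstein \<mu> l
          = (\<integral>x. (1 - exp (- ((l + h n) * x))) - (1 - exp (- (l * x))) \<partial>\<mu>)"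
        unfolding bernstein_def using l h[of n]
        by (intro Bochner_Integration.integral_diff[symmetric] integrable_one_minus_exp) auto
      also have "\<dots> = (\<integral>x. exp (- (l * x)) * (1 - exp (- (h n * x))) \<partial>\<mu>)"
        by (intro Bochner_Integration.integral_cong) (auto simp: algebra_simps simp flip: exp_add)
      finally show ?thesis
        by simp
    qed
    show ?thesis
      unfolding eq mass_laplace_def
    proof (rule integral_dominated_convergence)
      show "(\<lambda>x. x * exp (- (l * x))) \<in> borel_measurable \<mu>"
        "(\<lambda>x. exp (- (l * x)) * ((1 - exp (- (h n * x))) / h n)) \<in> borel_measurable \<mu>" for n
        using h[of n] by (auto intro!: borel_measurable_continuous continuous_intros)
      show "integrable \<mu> (\<lambda>x. x * exp (- (l * x)))"
        by (rule integrable_mult_exp[OF l])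
      show "AE x in \<mu>. (\<lambda>n. exp (- (l * x)) * ((1 - exp (- (h n * x))) / h n)) \<longlonglongrightarrow> x * exp (- (l * x))"
      proof (rule AE_I2)
        fix x assume "x \<in> space \<mu>"
        have "((\<lambda>h. 1 - exp (- (h * x))) has_real_derivative x) (at 0)"
          by (auto intro!: derivative_eq_intros)
        then have "(\<lambda>n. (1 - exp (- ((0 + h n) * x)) - (1 - exp (- (0 * x)))) / h n) \<longlonglongrightarrow> x"
          using h0 h by (intro DERIV_imp_LIMSEQ) (auto simp: less_imp_neq[symmetric])
        then have "(\<lambda>n. (1 - exp (- (h n * x))) / h n) \<longlonglongrightarrow> x"
          by simp
        then show "(\<lambda>n. exp (- (l * x)) * ((1 - exp (- (h n * x))) / h n)) \<longlonglongrightarrow> x * exp (- (l * x))"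
          by (subst mult.commute) (intro tendsto_intros)
      qed
      show "AE x in \<mu>. norm (exp (- (l * x)) * ((1 - exp (- (h n * x))) / h n)) \<le> x * exp (- (l * x))" for n
      proof (rule AE_I2)
        fix x assume "x \<in> space \<mu>"
        then have x: "x > 0"
          by (simp add: space_eq)
        have "1 - exp (- (h n * x)) \<le> h n * x"
          using exp_ge_add_one_self[of "- (h n * x)"] by simp
        then have "(1 - exp (- (h n * x))) / h n \<le> x"
          using h[of n] by (simp add: field_simps)
        moreover have "(1 - exp (- (h n * x))) / h n \<ge> 0"
          using x h[of n] by simp
        ultimately have "norm ((1 - exp (- (h n * x))) / h n) \<le> x"
          by (simp only: real_norm_def abs_of_nonneg)
        then have "exp (- (l * x)) * norm ((1 - exp (- (h n * x))) / h n) \<le> exp (- (l * x)) * x"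
          by (intro mult_left_mono) auto
        then show "norm (exp (- (l * x)) * ((1 - exp (- (h n * x))) / h n)) \<le> x * exp (- (l * x))"
          unfolding norm_mult by (simp add: mult.commute)
      qed
    qed
  qed
  ultimately show ?thesis
    by (rule LIMSEQ_unique[symmetric])
qed

text \<open>The increment splits into two products of a function of x and a function of y. The
  outcome is minus the l-derivative of the square of \<open>bernstein \<mu> l\<close>.\<close>

lemma coag_form_exp:
  assumes l: "l > 0"
  shows "coag_form (\<lambda>x. exp (- (l * x))) \<mu> = - 2 * bernstein \<mu> l * mass_laplace \<mu> l"
proof -
  note int = integrable_mult_exp[OF l] integrable_one_minus_exp[OF less_imp_le[OF l]]
  have eq: "coag_increment (\<lambda>x. exp (- (l * x))) x y
      = - (x * exp (- (l * x))) * (1 - exp (- (l * y))) - (1 - exp (- (l * x))) * (y * exp (- (l * y)))" for x y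
    by (simp add: coag_increment_def algebra_simps flip: exp_add)
  have "(\<integral>y. coag_increment (\<lambda>x. exp (- (l * x))) x y \<partial>\<mu>)
      = - (x * exp (- (l * x))) * bernstein \<mu> l - (1 - exp (- (l * x))) * mass_laplace \<mu> l" for x
    unfolding eq bernstein_def mass_laplace_def
    by (rule integral_linear_diff; rule int)
  then have "coag_form (\<lambda>x. exp (- (l * x))) \<mu>
      = (\<integral>x. - (bernstein \<mu> l) * (x * exp (- (l * x))) - mass_laplace \<mu> l * (1 - exp (- (l * x))) \<partial>\<mu>)"
    unfolding coag_form_def by (intro Bochner_Integration.integral_cong) (simp_all add: mult_ac)
  also have "\<dots> = - (bernstein \<mu> l) * mass_laplace \<mu> l - mass_laplace \<mu> l * bernstein \<mu> l"
    unfolding bernstein_def[of _ l] mass_laplace_def[of _ l]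
    by (rule integral_linear_diff; rule int)
  finally show ?thesis
    by simp
qed

text \<open>Here x * \<phi> x = 1 - exp (- (l * x)), and this function turns addition into the
  identity h (x + y) - h x - h y = - h x * h y, which makes the form a perfect square.\<close>

lemma coag_form_one_minus_exp:
  assumes l: "l > 0"
  shows "coag_form (\<lambda>x. (1 - exp (- (l * x))) / x) \<mu> = - (bernstein \<mu> l)\<^sup>2"
proof -
  have eq: "coag_increment (\<lambda>x. (1 - exp (- (l * x))) / x) x y
      = - (1 - exp (- (l * x))) * (1 - exp (- (l * y)))" if "x \<in> space \<mu>" "y \<in> space \<mu>" for x y
  proof -
    have "x > 0" "y > 0" "x + y > 0"
      using that by (auto simp: space_eq)
    then have "coag_increment (\<lambda>x. (1 - exp (- (l * x))) / x) x y
        = (1 - exp (- (l * (x + y)))) - (1 - exp (- (l * x))) - (1 - exp (- (l * y)))"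
      unfolding coag_increment_def by simp
    then show ?thesis
      by (simp add: algebra_simps flip: exp_add)
  qed
  have "(\<integral>y. coag_increment (\<lambda>x. (1 - exp (- (l * x))) / x) x y \<partial>\<mu>)
      = - (1 - exp (- (l * x))) * bernstein \<mu> l" if "x \<in> space \<mu>" for x
    unfolding bernstein_def integral_mult_right_zero[symmetric]
    using that by (intro Bochner_Integration.integral_cong eq) auto
  then have "coag_form (\<lambda>x. (1 - exp (- (l * x))) / x) \<mu>
      = (\<integral>x. - bernstein \<mu> l * (1 - exp (- (l * x))) \<partial>\<mu>)"
    unfolding coag_form_def
    by (intro Bochner_Integration.integral_cong) (simp_all add: mult.commute right_diff_distrib)
  also have "\<dots> = - bernstein \<mu> l * bernstein \<mu> l"
    unfolding bernstein_def[of _ l] by (rule integral_mult_right_zero)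
  finally show ?thesis
    by (simp add: power2_eq_square)
qed

section \<open>Increments as functions on the product space\<close>

lemma borel_measurable_coag_increment:
  assumes "continuous_on {0<..} \<phi>"
  shows "(\<lambda>(x, y). coag_increment \<phi> x y) \<in> borel_measurable (\<mu> \<Otimes>\<^sub>M \<mu>)"
proof -
  have 1: "\<phi> \<in> borel_measurable \<mu>"
    using assms by (rule borel_measurable_continuous)
  have [measurable]: "(\<lambda>x. x) \<in> borel_measurable \<mu>"
    by (intro borel_measurable_continuous continuous_intros)
  have [measurable]: "(\<lambda>p. fst p) \<in> borel_measurable (\<mu> \<Otimes>\<^sub>M \<mu>)" "(\<lambda>p. snd p) \<in> borel_measurable (\<mu> \<Otimes>\<^sub>M \<mu>)"
    using measurable_compose[OF measurable_fst, of "\<lambda>x. x" \<mu> borel \<mu>]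
      measurable_compose[OF measurable_snd, of "\<lambda>x. x" \<mu> borel \<mu>] by simp_all
  \<comment> \<open>The function \<phi> is controlled only on the positive half-line, so the sum
    must be measurable into the trace space before \<phi> is composed with it.\<close>
  have "(\<lambda>p. fst p + snd p) \<in> measurable (\<mu> \<Otimes>\<^sub>M \<mu>) (restrict_space borel {0<..})"
    by (rule measurable_restrict_space2) (auto simp: space_pair_measure space_eq)
  then have "(\<lambda>p. fst p + snd p) \<in> measurable (\<mu> \<Otimes>\<^sub>M \<mu>) \<mu>"
    by (simp add: measurable_cong_sets[OF refl sets_eq])
  note [measurable] = measurable_compose[OF this 1] measurable_compose[OF measurable_fst 1]
    measurable_compose[OF measurable_snd 1]
  show ?thesis
    unfolding coag_increment_def split_beta by measurable
qed

lemma integrable_prod_weight: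
  fixes \<omega> :: "real \<Rightarrow> real"
  assumes "integrable \<mu> \<omega>"
  shows "integrable (\<mu> \<Otimes>\<^sub>M \<mu>) (\<lambda>(x, y). \<omega> x * \<omega> y)"
proof (rule Fubini_integrable)
  have [measurable]: "\<omega> \<in> borel_measurable \<mu>"
    using assms by simp
  show "(\<lambda>(x, y). \<omega> x * \<omega> y) \<in> borel_measurable (\<mu> \<Otimes>\<^sub>M \<mu>)"
    by measurable
  show "integrable \<mu> (\<lambda>x. \<integral>y. norm (case (x, y) of (x, y) \<Rightarrow> \<omega> x * \<omega> y) \<partial>\<mu>)"
    using assms by (simp add: abs_mult)
  show "AE x in \<mu>. integrable \<mu> (\<lambda>y. case (x, y) of (x, y) \<Rightarrow> \<omega> x * \<omega> y)"
    using assms by simp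
qed

lemma integral_prod_weight:
  fixes \<omega> :: "real \<Rightarrow> real"
  assumes "integrable \<mu> \<omega>"
  shows "integral\<^sup>L (\<mu> \<Otimes>\<^sub>M \<mu>) (\<lambda>(x, y). \<omega> x * \<omega> y) = (integral\<^sup>L \<mu> \<omega>)\<^sup>2"
  using integral_fst'[OF integrable_prod_weight[OF assms]] assms by (simp add: power2_eq_square)

text \<open>The weight \<open>\<omega>\<close> is left open: it is an exponential weight where the
  mass may be infinite, and the identity for solutions, whose mass is finite.\<close>

lemma integrable_coag_increment:
  assumes "continuous_on {0<..} \<phi>" "integrable \<mu> \<omega>"
    and "\<And>x y. x > 0 \<Longrightarrow> y > 0 \<Longrightarrow> \<bar>coag_increment \<phi> x y\<bar> \<le> C * (\<omega> x * \<omega> y)"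
  shows "integrable (\<mu> \<Otimes>\<^sub>M \<mu>) (\<lambda>(x, y). coag_increment \<phi> x y)"
proof (rule Bochner_Integration.integrable_bound)
  show "integrable (\<mu> \<Otimes>\<^sub>M \<mu>) (\<lambda>p. C * (case p of (x, y) \<Rightarrow> \<omega> x * \<omega> y))"
    by (intro integrable_mult_right integrable_prod_weight assms)
  show "(\<lambda>(x, y). coag_increment \<phi> x y) \<in> borel_measurable (\<mu> \<Otimes>\<^sub>M \<mu>)"
    by (rule borel_measurable_coag_increment) fact
  show "AE p in \<mu> \<Otimes>\<^sub>M \<mu>. norm (case p of (x, y) \<Rightarrow> coag_increment \<phi> x y)
      \<le> norm (C * (case p of (x, y) \<Rightarrow> \<omega> x * \<omega> y))"
    using assms(3) by (intro AE_I2) (fastforce simp: space_pair_measure space_eq intro: order_trans[OF _ abs_ge_self])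
qed

lemma coag_form_eq_prod:
  assumes "integrable (\<mu> \<Otimes>\<^sub>M \<mu>) (\<lambda>(x, y). coag_increment \<phi> x y)"
  shows "coag_form \<phi> \<mu> = (\<integral>(x, y). coag_increment \<phi> x y \<partial>(\<mu> \<Otimes>\<^sub>M \<mu>))"
  using integral_fst'[OF assms] by (simp add: coag_form_def)

lemma abs_coag_form_le:
  assumes "continuous_on {0<..} \<phi>" "integrable \<mu> \<omega>"
    and "\<And>x y. x > 0 \<Longrightarrow> y > 0 \<Longrightarrow> \<bar>coag_increment \<phi> x y\<bar> \<le> C * (\<omega> x * \<omega> y)"
  shows "\<bar>coag_form \<phi> \<mu>\<bar> \<le> C * (integral\<^sup>L \<mu> \<omega>)\<^sup>2"
proof -
  note int = integrable_coag_increment[OF assms]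
  have "norm (\<integral>(x, y). coag_increment \<phi> x y \<partial>(\<mu> \<Otimes>\<^sub>M \<mu>))
      \<le> (\<integral>p. C * (case p of (x, y) \<Rightarrow> \<omega> x * \<omega> y) \<partial>(\<mu> \<Otimes>\<^sub>M \<mu>))"
  proof (rule Bochner_Integration.integral_norm_bound_integral)
    show "integrable (\<mu> \<Otimes>\<^sub>M \<mu>) (\<lambda>p. C * (case p of (x, y) \<Rightarrow> \<omega> x * \<omega> y))"
      by (intro integrable_mult_right integrable_prod_weight assms)
  qed (use assms(3) int in \<open>auto simp: space_pair_measure space_eq\<close>)
  then have "\<bar>coag_form \<phi> \<mu>\<bar> \<le> (\<integral>p. C * (case p of (x, y) \<Rightarrow> \<omega> x * \<omega> y) \<partial>(\<mu> \<Otimes>\<^sub>M \<mu>))"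
    by (simp add: coag_form_eq_prod[OF int])
  also have "\<dots> = C * (integral\<^sup>L \<mu> \<omega>)\<^sup>2"
    using integral_prod_weight[OF assms(2)] by simp
  finally show ?thesis .
qed

lemma coag_form_linear:
  assumes "integrable (\<mu> \<Otimes>\<^sub>M \<mu>) (\<lambda>(x, y). coag_increment \<phi> x y)"
    and "integrable (\<mu> \<Otimes>\<^sub>M \<mu>) (\<lambda>(x, y). coag_increment \<psi> x y)"
  shows "coag_form (\<lambda>x. \<phi> x + \<psi> x) \<mu> = coag_form \<phi> \<mu> + coag_form \<psi> \<mu>"
    and "integrable (\<mu> \<Otimes>\<^sub>M \<mu>) (\<lambda>(x, y). coag_increment (\<lambda>x. \<phi> x + \<psi> x) x y)"
proof -
  have eq: "(\<lambda>(x, y). coag_increment (\<lambda>x. \<phi> x + \<psi> x) x y)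
      = (\<lambda>p. (case p of (x, y) \<Rightarrow> coag_increment \<phi> x y) + (case p of (x, y) \<Rightarrow> coag_increment \<psi> x y))"
    by (auto simp: fun_eq_iff coag_increment_def algebra_simps)
  show int: "integrable (\<mu> \<Otimes>\<^sub>M \<mu>) (\<lambda>(x, y). coag_increment (\<lambda>x. \<phi> x + \<psi> x) x y)"
    unfolding eq by (intro Bochner_Integration.integrable_add assms)
  show "coag_form (\<lambda>x. \<phi> x + \<psi> x) \<mu> = coag_form \<phi> \<mu> + coag_form \<psi> \<mu>"
    unfolding coag_form_eq_prod[OF int] coag_form_eq_prod[OF assms(1)] coag_form_eq_prod[OF assms(2)] eq
    by (intro Bochner_Integration.integral_add assms)
qed

lemma integrable_coag_increment_exp:
  assumes l: "l > 0"
  shows "integrable (\<mu> \<Otimes>\<^sub>M \<mu>) (\<lambda>(x, y). coag_increment (\<lambda>x. exp (- (l * x))) x y)"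
proof (rule integrable_coag_increment[where \<omega> = "\<lambda>x. 1 - exp (- (l * x))" and C = "2 / l"])
  show "continuous_on {0<..} (\<lambda>x. exp (- (l * x)))"
    by (intro continuous_intros)
  show "integrable \<mu> (\<lambda>x. 1 - exp (- (l * x)))"
    using l by (intro integrable_one_minus_exp) simp
  fix x y :: real assume xy: "x > 0" "y > 0"
  have le: "z * exp (- (l * z)) \<le> (1 - exp (- (l * z))) / l" for z
    using mult_exp_le[of "l * z"] l by (simp add: field_simps)
  have "\<bar>coag_increment (\<lambda>x. exp (- (l * x))) x y\<bar>
      = x * exp (- (l * x)) * (1 - exp (- (l * y))) + y * exp (- (l * y)) * (1 - exp (- (l * x)))"
  proof -
    have "coag_increment (\<lambda>x. exp (- (l * x))) x y
      = - (x * exp (- (l * x)) * (1 - exp (- (l * y))) + y * exp (- (l * y)) * (1 - exp (- (l * x))))"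
      by (simp add: coag_increment_def algebra_simps flip: exp_add)
    moreover have "x * exp (- (l * x)) * (1 - exp (- (l * y))) + y * exp (- (l * y)) * (1 - exp (- (l * x))) \<ge> 0"
      using xy l by (intro add_nonneg_nonneg mult_nonneg_nonneg) auto
    ultimately show ?thesis
      by linarith
  qed
  also have "\<dots> \<le> (1 - exp (- (l * x))) / l * (1 - exp (- (l * y))) + (1 - exp (- (l * y))) / l * (1 - exp (- (l * x)))"
    using xy l by (intro add_mono mult_right_mono le) auto
  also have "\<dots> = 2 / l * ((1 - exp (- (l * x))) * (1 - exp (- (l * y))))"
    by simp
  finally show "\<bar>coag_increment (\<lambda>x. exp (- (l * x))) x y\<bar> \<le> 2 / l * ((1 - exp (- (l * x))) * (1 - exp (- (l * y))))" .
qed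

end

section \<open>Approximation by exponential sums\<close>

lemma exp_sum_approx:
  fixes k :: "real \<Rightarrow> real"
  assumes cont: "continuous_on {0..} k" and B: "B \<ge> 0" "\<And>x. x \<ge> B \<Longrightarrow> k x = 0" and e: "e > 0"
  shows "\<exists>b n. \<forall>x\<ge>0. \<bar>k x - (\<Sum>i\<le>n. b i * exp (- (real i * x)))\<bar> \<le> e"
proof -
  \<comment> \<open>The substitution s = exp (- x) moves the problem to [0, 1]. The maximum keeps
    the logarithm away from s = 0 and leaves the values unchanged, because k vanishes from B
    on.\<close>
  define G where "G = (\<lambda>s. k (- ln (max s (exp (- B)))))"
  have pos: "max s (exp (- B)) > 0" for s
    by (simp add: less_max_iff_disj)
  have "continuous_on {0..1} G"
    unfolding G_def
  proof (rule continuous_on_compose2[OF cont])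
    show "continuous_on {0..1} (\<lambda>s. - ln (max s (exp (- B))))"
      using pos by (intro continuous_intros) (auto simp: less_imp_neq[symmetric])
    show "(\<lambda>s. - ln (max s (exp (- B)))) ` {0..1} \<subseteq> {0..}"
      using pos B by auto
  qed
  then obtain p where p: "real_polynomial_function p" "\<And>s. s \<in> {0..1} \<Longrightarrow> \<bar>G s - p s\<bar> < e"
    using Stone_Weierstrass_real_polynomial_function[of "{0..1}" G e] e by auto
  obtain b n where pb: "p = (\<lambda>s. \<Sum>i\<le>n. b i * s ^ i)"
    using p(1) unfolding real_polynomial_function_iff_sum by blast
  have "\<bar>k x - (\<Sum>i\<le>n. b i * exp (- (real i * x)))\<bar> \<le> e" if x: "x \<ge> 0" for x
  proof -
    have "k x = G (exp (- x))"
      using B by (cases "x \<le> B") (auto simp: G_def max_def)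
    moreover have "(\<Sum>i\<le>n. b i * exp (- (real i * x))) = p (exp (- x))"
      by (simp add: pb flip: exp_of_nat_mult)
    ultimately show ?thesis
      using p(2)[of "exp (- x)"] x by simp
  qed
  then show ?thesis
    by blast
qed

lemma compact_support_on_atLeast_imp:
  assumes "compact_support_on {0..} \<phi>"
  shows "\<exists>B>0. \<forall>x\<ge>B. \<phi> x = 0"
proof -
  obtain K where K: "compact K" "\<forall>x\<in>{0..} - K. \<phi> x = 0"
    using assms by (auto simp: compact_support_on_def)
  then obtain b where b: "\<And>x. x \<in> K \<Longrightarrow> \<bar>x\<bar> \<le> b"
    using compact_imp_bounded by (fastforce simp: bounded_iff)
  have "\<phi> x = 0" if "x \<ge> max b 0 + 1" for x
    using that K(2) b[of x] by force
  moreover have "max b 0 + 1 > 0"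
    by simp
  ultimately show ?thesis
    by blast
qed

lemma C1c_imp:
  assumes "\<phi> \<in> C1c {0..}"
  shows "\<exists>\<phi>' B. (\<forall>x\<ge>0. (\<phi> has_real_derivative \<phi>' x) (at x within {0..})) \<and>
    continuous_on {0..} \<phi>' \<and> B > 0 \<and> (\<forall>x\<ge>B. \<phi> x = 0 \<and> \<phi>' x = 0)"
proof -
  obtain \<phi>' where \<phi>': "\<And>x. x \<ge> 0 \<Longrightarrow> (\<phi> has_real_derivative \<phi>' x) (at x within {0..})"
      "continuous_on {0..} \<phi>'" and supp: "compact_support_on {0..} \<phi>"
    using assms by (auto simp: C1c_def)
  obtain B where B: "B > 0" "\<And>x. x \<ge> B \<Longrightarrow> \<phi> x = 0"
    using compact_support_on_atLeast_imp[OF supp] by blast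
  \<comment> \<open>The extra 1 places x inside the open set {B<..} on which \<phi> vanishes
    identically.\<close>
  have "\<phi>' x = 0" if "x \<ge> B + 1" for x
  proof -
    have "(\<phi> has_real_derivative \<phi>' x) (at x)"
      using \<phi>'(1)[of x] that B at_within_interior[of x "{0..}"] by simp
    moreover have "(\<phi> has_real_derivative 0) (at x)"
      by (rule has_field_derivative_transform_within_open[of "\<lambda>_. 0" _ _ "{B<..}"]) (use that B in auto)
    ultimately show ?thesis
      by (rule DERIV_unique)
  qed
  then show ?thesis
    using \<phi>' B by (intro exI[of _ \<phi>'] exI[of _ "B + 1"]) auto
qed

lemma C1c_continuous_on:
  assumes "\<phi> \<in> C1c {0..}"
  shows "continuous_on {0..} \<phi>"
  using assms by (auto simp: C1c_def intro: DERIV_continuous_on)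

text \<open>Adding e * exp (- z) to D gives a nonincreasing function, subtracting it a nondecreasing
  one. The derivative bound is thus integrated without losing the exponential weight.\<close>

lemma abs_diff_le_exp_diff:
  fixes D :: "real \<Rightarrow> real"
  assumes D: "\<And>z. z \<ge> 0 \<Longrightarrow> (D has_real_derivative D' z) (at z within {0..})"
    and le: "\<And>z. z \<ge> 0 \<Longrightarrow> \<bar>D' z\<bar> \<le> e * exp (- z)"
    and xy: "0 \<le> x" "x \<le> y"
  shows "\<bar>D y - D x\<bar> \<le> e * (exp (- x) - exp (- y))"
proof -
  have D1: "(D has_real_derivative D' z) (at z within {x..y})" if "x \<le> z" for z
    using D[of z] xy that by (auto intro: has_field_derivative_subset)
  have D2: "((\<lambda>z. D z + e * exp (- z)) has_real_derivative (D' z - e * exp (- z))) (at z within {x..y})"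
    and D3: "((\<lambda>z. D z - e * exp (- z)) has_real_derivative (D' z + e * exp (- z))) (at z within {x..y})"
    if "x \<le> z" for z
    using D1[OF that] by (auto intro!: derivative_eq_intros)
  have "\<exists>z\<in>{x..y}. (D y + e * exp (- y)) - (D x + e * exp (- x)) = (D' z - e * exp (- z)) * (y - x)"
    by (rule mvt_very_simple[OF xy(2), where f' = "\<lambda>z. (*) (D' z - e * exp (- z))"])
       (rule D2[unfolded has_field_derivative_def])
  then obtain z where z: "z \<in> {x..y}"
    "(D y + e * exp (- y)) - (D x + e * exp (- x)) = (D' z - e * exp (- z)) * (y - x)"
    by blast
  have "\<exists>z\<in>{x..y}. (D y - e * exp (- y)) - (D x - e * exp (- x)) = (D' z + e * exp (- z)) * (y - x)"
    by (rule mvt_very_simple[OF xy(2), where f' = "\<lambda>z. (*) (D' z + e * exp (- z))"])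
       (rule D3[unfolded has_field_derivative_def])
  then obtain z' where z': "z' \<in> {x..y}"
    "(D y - e * exp (- y)) - (D x - e * exp (- x)) = (D' z' + e * exp (- z')) * (y - x)"
    by blast
  have "(D' z - e * exp (- z)) * (y - x) \<le> 0"
    using le[of z] z(1) xy by (intro mult_nonpos_nonneg) auto
  moreover have "(D' z' + e * exp (- z')) * (y - x) \<ge> 0"
    using le[of z'] z'(1) xy by (intro mult_nonneg_nonneg) auto
  ultimately show ?thesis
    using z(2) z'(2) by (simp add: abs_le_iff algebra_simps)
qed

lemma exp_neg_mult_tendsto_0:
  fixes c :: real
  assumes "c > 0"
  shows "((\<lambda>x. exp (- (c * x))) \<longlongrightarrow> 0) at_top"
  by (rule filterlim_compose[OF exp_at_bot])
     (use assms in \<open>auto simp: filterlim_uminus_at_bot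
        intro!: filterlim_tendsto_pos_mult_at_top[OF tendsto_const _ filterlim_ident]\<close>)

lemma exp_sum_tendsto_0: "((\<lambda>x. \<Sum>k\<le>n. a k * exp (- (real (Suc k) * x))) \<longlongrightarrow> 0) at_top"
proof -
  have "((\<lambda>x. exp (- (real (Suc k) * x))) \<longlongrightarrow> 0) at_top" for k
    by (rule exp_neg_mult_tendsto_0) simp
  then have "((\<lambda>x. \<Sum>k\<le>n. a k * exp (- (real (Suc k) * x))) \<longlongrightarrow> (\<Sum>k\<le>n. a k * 0)) at_top"
    by (intro tendsto_intros)
  then show ?thesis
    by simp
qed

text \<open>The weight \<open>e\<^bsup>-x\<^esup>\<close> in the error makes the error of the increment integrable even against the
  profile, whose mass is infinite.\<close>

lemma C1c_approx:
  assumes \<phi>: "\<phi> \<in> C1c {0..}" and e: "e > 0"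
  obtains a n where
    "\<And>x. x \<ge> 0 \<Longrightarrow> \<bar>\<phi> x - (\<Sum>k\<le>n. a k * exp (- (real (Suc k) * x)))\<bar> \<le> e * exp (- x)"
    "\<And>x y. x > 0 \<Longrightarrow> y > 0 \<Longrightarrow>
      \<bar>coag_increment (\<lambda>x. \<phi> x - (\<Sum>k\<le>n. a k * exp (- (real (Suc k) * x)))) x y\<bar>
        \<le> 2 * e * ((1 - exp (- x)) * (1 - exp (- y)))"
proof -
  obtain \<phi>' B where \<phi>': "\<And>x. x \<ge> 0 \<Longrightarrow> (\<phi> has_real_derivative \<phi>' x) (at x within {0..})"
    "continuous_on {0..} \<phi>'" and B: "B > 0" "\<And>x. x \<ge> B \<Longrightarrow> \<phi> x = 0" "\<And>x. x \<ge> B \<Longrightarrow> \<phi>' x = 0"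
    using C1c_imp[OF \<phi>] by blast
  \<comment> \<open>Fitting exp x * \<phi>' x by powers of exp (- x) and multiplying back by exp (-
    x) gives the weighted error. It also makes every exponent at least 1, so that the antiderivative
    is again a sum of decaying exponentials, with no linear term.\<close>
  have "continuous_on {0..} (\<lambda>x. exp x * \<phi>' x)"
    using \<phi>'(2) by (intro continuous_intros)
  then have "\<exists>b n. \<forall>x\<ge>0. \<bar>exp x * \<phi>' x - (\<Sum>i\<le>n. b i * exp (- (real i * x)))\<bar> \<le> e"
    by (rule exp_sum_approx[where B = B]) (use B e in auto)
  then obtain b n where b: "\<And>x. x \<ge> 0 \<Longrightarrow> \<bar>exp x * \<phi>' x - (\<Sum>i\<le>n. b i * exp (- (real i * x)))\<bar> \<le> e"
    by blast
  define a where "a = (\<lambda>k. - b k / real (Suc k))"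
  define \<psi> where "\<psi> = (\<lambda>x. \<Sum>k\<le>n. a k * exp (- (real (Suc k) * x)))"
  define D where "D = (\<lambda>x. \<phi> x - \<psi> x)"
  define D' where "D' = (\<lambda>x. \<phi>' x - (\<Sum>k\<le>n. b k * exp (- (real (Suc k) * x))))"
  have \<psi>': "(\<psi> has_real_derivative (\<Sum>k\<le>n. b k * exp (- (real (Suc k) * x)))) (at x within {0..})" for x
    unfolding \<psi>_def
  proof (rule DERIV_sum)
    fix k
    have "a k * - real (Suc k) = b k"
      by (simp add: a_def del: of_nat_Suc)
    then have "a k * (exp (- (real (Suc k) * x)) * - (real (Suc k))) = b k * exp (- (real (Suc k) * x))"
      by (metis mult.assoc mult.commute)
    then show "((\<lambda>x. a k * exp (- (real (Suc k) * x))) has_real_derivative b k * exp (- (real (Suc k) * x)))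
        (at x within {0..})"
      by (auto intro!: derivative_eq_intros simp: mult.commute)
  qed
  have D: "(D has_real_derivative D' x) (at x within {0..})" if "x \<ge> 0" for x
    unfolding D_def D'_def by (rule DERIV_diff[OF \<phi>'(1)[OF that] \<psi>'])
  have D'_le: "\<bar>D' x\<bar> \<le> e * exp (- x)" if "x \<ge> 0" for x
  proof -
    have "exp (- x) * (b i * exp (- (real i * x))) = b i * exp (- (real (Suc i) * x))" for i
    proof -
      have "- (real (Suc i) * x) = - x + - (real i * x)"
        by (simp add: algebra_simps)
      then show ?thesis
        by (simp only: exp_add mult_ac)
    qed
    moreover have "exp (- x) * (exp x * \<phi>' x) = \<phi>' x"
      by (simp add: exp_minus)
    ultimately have "D' x = exp (- x) * (exp x * \<phi>' x - (\<Sum>i\<le>n. b i * exp (- (real i * x))))"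
      by (simp only: D'_def right_diff_distrib sum_distrib_left)
    then show ?thesis
      using b[OF that] by (simp add: abs_mult)
  qed
  note diff = abs_diff_le_exp_diff[of D D' e, OF D D'_le]
  have D_le: "\<bar>D x\<bar> \<le> e * exp (- x)" if x: "x \<ge> 0" for x
  proof -
    \<comment> \<open>The derivative bound is used from x to infinity, where D tends to 0; this
      bounds D itself and not only its differences.\<close>
    have "((\<lambda>y. \<bar>D y - D x\<bar>) \<longlongrightarrow> \<bar>0 - 0 - D x\<bar>) at_top"
    proof -
      have "(\<phi> \<longlongrightarrow> 0) at_top"
        using B by (intro tendsto_eventually eventually_at_top_linorderI[of B])
      then show ?thesis
        unfolding D_def \<psi>_def
        by (intro tendsto_rabs tendsto_diff exp_sum_tendsto_0 tendsto_const)
    qed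
    moreover have "\<forall>\<^sub>F y in at_top. \<bar>D y - D x\<bar> \<le> e * exp (- x)"
    proof (rule eventually_at_top_linorderI[of x])
      fix y assume "x \<le> y"
      then have "\<bar>D y - D x\<bar> \<le> e * (exp (- x) - exp (- y))"
        by (intro diff) (use x in auto)
      also have "\<dots> \<le> e * exp (- x)"
        using e by (intro mult_left_mono) auto
      finally show "\<bar>D y - D x\<bar> \<le> e * exp (- x)" .
    qed
    ultimately have "\<bar>0 - 0 - D x\<bar> \<le> e * exp (- x)"
      by (rule tendsto_upperbound) simp
    then show ?thesis
      by simp
  qed
  have D_inc: "\<bar>coag_increment D x y\<bar> \<le> 2 * e * ((1 - exp (- x)) * (1 - exp (- y)))"
    if xy: "x > 0" "y > 0" for x y
  proof -
    have 1: "\<bar>D (u + v) - D u\<bar> \<le> e * exp (- u) * (1 - exp (- v))" if "u > 0" "v > 0" for u v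
      using diff[of u "u + v"] that by (simp add: algebra_simps flip: exp_add)
    have 2: "\<bar>u * (D (u + v) - D u)\<bar> \<le> e * ((1 - exp (- u)) * (1 - exp (- v)))" if uv: "u > 0" "v > 0" for u v
    proof -
      have "\<bar>u * (D (u + v) - D u)\<bar> \<le> u * (e * exp (- u) * (1 - exp (- v)))"
        using 1[OF uv] uv by (simp add: abs_mult mult_left_mono)
      also have "\<dots> = e * (u * exp (- u) * (1 - exp (- v)))"
        by simp
      also have "\<dots> \<le> e * ((1 - exp (- u)) * (1 - exp (- v)))"
        using e uv mult_exp_le[of u] by (intro mult_left_mono mult_right_mono) auto
      finally show ?thesis .
    qed
    \<comment> \<open>In each difference the step length supplies one weight; the position supplies
      the other, through u * exp (- u) \<le> 1 - exp (- u).\<close>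
    have "coag_increment D x y = x * (D (x + y) - D x) + y * (D (y + x) - D y)"
      by (simp add: coag_increment_def algebra_simps)
    then show ?thesis
      using 2[OF xy] 2[OF xy(2,1)] by (simp add: mult.commute)
  qed
  show thesis
  proof (rule that[of a n])
    fix x :: real assume "x \<ge> 0"
    from D_le[OF this] show "\<bar>\<phi> x - (\<Sum>k\<le>n. a k * exp (- (real (Suc k) * x)))\<bar> \<le> e * exp (- x)"
      by (simp only: D_def \<psi>_def)
  next
    fix x y :: real assume "x > 0" "y > 0"
    from D_inc[OF this] show "\<bar>coag_increment (\<lambda>x. \<phi> x - (\<Sum>k\<le>n. a k * exp (- (real (Suc k) * x)))) x y\<bar>
        \<le> 2 * e * ((1 - exp (- x)) * (1 - exp (- y)))"
      by (simp only: D_def \<psi>_def)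
  qed
qed

text \<open>Since the support of h stays away from 0, h divided by 1 - exp (- x) extends
  continuously by 0. Approximating this quotient uniformly makes the error of h relative to the
  weight, hence integrable against every Levy measure.\<close>

lemma Cc_approx:
  assumes h: "h \<in> Cc {0<..}" and e: "e > 0"
  obtains b n where
    "\<And>x. x > 0 \<Longrightarrow> \<bar>h x - (\<Sum>i\<le>n. b i * exp (- (real i * x))) * (1 - exp (- x))\<bar> \<le> e * (1 - exp (- x))"
proof -
  obtain K where K: "compact K" "K \<subseteq> {0<..}" "\<And>x. x > 0 \<Longrightarrow> x \<notin> K \<Longrightarrow> h x = 0"
    and cont: "continuous_on {0<..} h"
    using h by (auto simp: Cc_def compact_support_on_def)
  obtain a where a: "a > 0" "\<And>x. x \<in> K \<Longrightarrow> a < x"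
  proof (cases "K = {}")
    case False
    then obtain x where "x \<in> K" "\<And>y. y \<in> K \<Longrightarrow> x \<le> y"
      using compact_attains_inf[OF K(1)] by blast
    then show ?thesis
      using K(2) by (intro that[of "x / 2"]) force+
  qed (auto intro: that[of 1])
  obtain B where B: "\<And>x. x \<in> K \<Longrightarrow> \<bar>x\<bar> \<le> B"
    using compact_imp_bounded[OF K(1)] by (auto simp: bounded_iff)
  define k where "k = (\<lambda>x. if x \<le> a then 0 else h x / (1 - exp (- x)))"
  have "continuous_on ({0..a} \<union> {a..}) k"
    unfolding k_def
  proof (rule continuous_on_cases)
    show "continuous_on {a..} (\<lambda>x. h x / (1 - exp (- x)))"
      using a by (intro continuous_intros continuous_on_subset[OF cont]) auto
    show "\<forall>x. x \<in> {0..a} \<and> \<not> x \<le> a \<or> x \<in> {a..} \<and> x \<le> a \<longrightarrow> 0 = h x / (1 - exp (- x))"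
      using K(3) a by fastforce
  qed auto
  moreover have "{0..a} \<union> {a..} = {0..}"
    using a by auto
  ultimately have "continuous_on {0..} k"
    by simp
  moreover have "k x = 0" if "x \<ge> max B 0 + 1" for x
  proof -
    have "x > 0" "x \<notin> K"
      using that B[of x] by auto
    then show ?thesis
      by (simp add: k_def K(3))
  qed
  ultimately have "\<exists>b n. \<forall>x\<ge>0. \<bar>k x - (\<Sum>i\<le>n. b i * exp (- (real i * x)))\<bar> \<le> e"
    using e by (intro exp_sum_approx[of k "max B 0 + 1" e]) auto
  then obtain b n where b: "\<And>x. x \<ge> 0 \<Longrightarrow> \<bar>k x - (\<Sum>i\<le>n. b i * exp (- (real i * x)))\<bar> \<le> e"
    by blast
  show thesis
  proof (rule that[of b n])
    fix x :: real assume x: "x > 0"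
    have "h x = 0" if "x \<le> a"
      using a(2)[of x] that by (intro K(3) x) auto
    then have "h x = k x * (1 - exp (- x))"
      using x by (auto simp: k_def)
    then have "h x - (\<Sum>i\<le>n. b i * exp (- (real i * x))) * (1 - exp (- x))
        = (k x - (\<Sum>i\<le>n. b i * exp (- (real i * x)))) * (1 - exp (- x))"
      by (simp add: left_diff_distrib)
    then show "\<bar>h x - (\<Sum>i\<le>n. b i * exp (- (real i * x))) * (1 - exp (- x))\<bar> \<le> e * (1 - exp (- x))"
      using b[of x] x by (simp add: abs_mult mult_right_mono)
  qed
qed

section \<open>The weak equation and weak convergence in terms of Bernstein functions\<close>

context levy_measure
begin

lemma coag_form_sum:
  assumes int: "\<And>k. k \<le> n \<Longrightarrow> integrable (\<mu> \<Otimes>\<^sub>M \<mu>) (\<lambda>(x, y). coag_increment (\<phi> k) x y)"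
  shows "integrable (\<mu> \<Otimes>\<^sub>M \<mu>) (\<lambda>(x, y). coag_increment (\<lambda>x. \<Sum>k\<le>n. a k * \<phi> k x) x y)"
    and "coag_form (\<lambda>x. \<Sum>k\<le>n. a k * \<phi> k x) \<mu> = (\<Sum>k\<le>n. a k * coag_form (\<phi> k) \<mu>)"
proof -
  have "coag_increment (\<lambda>x. \<Sum>k\<le>n. a k * \<phi> k x) x y = (\<Sum>k\<le>n. a k * coag_increment (\<phi> k) x y)" for x y
    by (simp add: coag_increment_def sum_distrib_left sum_subtractf right_diff_distrib mult.left_commute)
  then have eq: "(\<lambda>(x, y). coag_increment (\<lambda>x. \<Sum>k\<le>n. a k * \<phi> k x) x y)
      = (\<lambda>p. \<Sum>k\<le>n. a k * (case p of (x, y) \<Rightarrow> coag_increment (\<phi> k) x y))"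
    by (simp add: fun_eq_iff)
  show int': "integrable (\<mu> \<Otimes>\<^sub>M \<mu>) (\<lambda>(x, y). coag_increment (\<lambda>x. \<Sum>k\<le>n. a k * \<phi> k x) x y)"
    unfolding eq by (intro Bochner_Integration.integrable_sum integrable_mult_right int) simp
  have "coag_form (\<lambda>x. \<Sum>k\<le>n. a k * \<phi> k x) \<mu>
      = (\<Sum>k\<le>n. \<integral>p. a k * (case p of (x, y) \<Rightarrow> coag_increment (\<phi> k) x y) \<partial>(\<mu> \<Otimes>\<^sub>M \<mu>))"
    unfolding coag_form_eq_prod[OF int'] eq
    by (intro Bochner_Integration.integral_sum integrable_mult_right int) simp
  also have "\<dots> = (\<Sum>k\<le>n. a k * coag_form (\<phi> k) \<mu>)"
    by (intro sum.cong refl) (simp add: coag_form_eq_prod int)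
  finally show "coag_form (\<lambda>x. \<Sum>k\<le>n. a k * \<phi> k x) \<mu> = (\<Sum>k\<le>n. a k * coag_form (\<phi> k) \<mu>)" .
qed

text \<open>Replaces \<phi> by an exponential sum, on which the form is known in closed form. The
  error depends on \<mu> only through \<open>bernstein \<mu> 1\<close>, so it is uniform over
  families where that is bounded.\<close>

lemma coag_form_approx:
  assumes \<phi>: "continuous_on {0..} \<phi>"
    and le: "\<And>x y. x > 0 \<Longrightarrow> y > 0 \<Longrightarrow>
      \<bar>coag_increment (\<lambda>x. \<phi> x - (\<Sum>k\<le>n. a k * exp (- (real (Suc k) * x)))) x y\<bar>
        \<le> 2 * e * ((1 - exp (- x)) * (1 - exp (- y)))"
  shows "integrable (\<mu> \<Otimes>\<^sub>M \<mu>) (\<lambda>(x, y). coag_increment \<phi> x y)"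
    and "\<bar>coag_form \<phi> \<mu> + (\<Sum>k\<le>n. a k * (2 * bernstein \<mu> (Suc k) * mass_laplace \<mu> (Suc k)))\<bar>
      \<le> 2 * e * (bernstein \<mu> 1)\<^sup>2"
proof -
  define \<psi> where "\<psi> = (\<lambda>x. \<Sum>k\<le>n. a k * exp (- (real (Suc k) * x)))"
  define D where "D = (\<lambda>x. \<phi> x - \<psi> x)"
  have cont: "continuous_on {0<..} D"
    unfolding D_def \<psi>_def by (intro continuous_intros continuous_on_subset[OF \<phi>]) auto
  have le': "\<bar>coag_increment D x y\<bar> \<le> 2 * e * ((1 - exp (- x)) * (1 - exp (- y)))" if "x > 0" "y > 0" for x y
    using le[OF that] by (simp only: D_def \<psi>_def)
  have int_exp: "integrable (\<mu> \<Otimes>\<^sub>M \<mu>) (\<lambda>(x, y). coag_increment (\<lambda>x. exp (- (real (Suc k) * x))) x y)" for k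
    by (rule integrable_coag_increment_exp) simp
  have int_\<psi>: "integrable (\<mu> \<Otimes>\<^sub>M \<mu>) (\<lambda>(x, y). coag_increment \<psi> x y)"
    unfolding \<psi>_def by (rule coag_form_sum(1)) (rule int_exp)
  have "coag_form \<psi> \<mu> = (\<Sum>k\<le>n. a k * coag_form (\<lambda>x. exp (- (real (Suc k) * x))) \<mu>)"
    unfolding \<psi>_def by (rule coag_form_sum(2)) (rule int_exp)
  also have "\<dots> = (\<Sum>k\<le>n. a k * (- 2 * bernstein \<mu> (Suc k) * mass_laplace \<mu> (Suc k)))"
    by (subst coag_form_exp) auto
  also have "\<dots> = - (\<Sum>k\<le>n. a k * (2 * bernstein \<mu> (Suc k) * mass_laplace \<mu> (Suc k)))"
    by (simp add: sum_negf)
  finally have \<psi>: "coag_form \<psi> \<mu> = - (\<Sum>k\<le>n. a k * (2 * bernstein \<mu> (Suc k) * mass_laplace \<mu> (Suc k)))" .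
  have int_D: "integrable (\<mu> \<Otimes>\<^sub>M \<mu>) (\<lambda>(x, y). coag_increment D x y)"
    by (rule integrable_coag_increment[OF cont integrable_weight le'])
  have eq: "\<phi> = (\<lambda>x. D x + \<psi> x)"
    by (simp add: D_def)
  show "integrable (\<mu> \<Otimes>\<^sub>M \<mu>) (\<lambda>(x, y). coag_increment \<phi> x y)"
    unfolding eq by (rule coag_form_linear(2)[OF int_D int_\<psi>])
  have "coag_form \<phi> \<mu> = coag_form D \<mu> + coag_form \<psi> \<mu>"
    unfolding eq by (rule coag_form_linear(1)[OF int_D int_\<psi>])
  moreover have "\<bar>coag_form D \<mu>\<bar> \<le> 2 * e * (bernstein \<mu> 1)\<^sup>2"
    using abs_coag_form_le[OF cont integrable_weight le'] by (simp add: bernstein_def)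
  ultimately show "\<bar>coag_form \<phi> \<mu> + (\<Sum>k\<le>n. a k * (2 * bernstein \<mu> (Suc k) * mass_laplace \<mu> (Suc k)))\<bar>
      \<le> 2 * e * (bernstein \<mu> 1)\<^sup>2"
    using \<psi> by simp
qed

text \<open>The counterpart for the left-hand side of the equation: the extra factor x in the
  integrand is absorbed by the exp (- x) in the error.\<close>

lemma mass_approx:
  assumes \<phi>: "continuous_on {0..} \<phi>"
    and le: "\<And>x. x \<ge> 0 \<Longrightarrow> \<bar>\<phi> x - (\<Sum>k\<le>n. a k * exp (- (real (Suc k) * x)))\<bar> \<le> e * exp (- x)"
    and e: "e \<ge> 0"
  shows "\<bar>(\<integral>x. \<phi> x * x \<partial>\<mu>) - (\<Sum>k\<le>n. a k * mass_laplace \<mu> (Suc k))\<bar> \<le> e * bernstein \<mu> 1"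
proof -
  define D where "D = (\<lambda>x. (\<phi> x - (\<Sum>k\<le>n. a k * exp (- (real (Suc k) * x)))) * x)"
  define \<psi> where "\<psi> = (\<lambda>x. \<Sum>k\<le>n. a k * (x * exp (- (real (Suc k) * x))))"
  have D_le: "norm (D x) \<le> e * (1 - exp (- x))" if "x \<in> space \<mu>" for x
  proof -
    have x: "x > 0"
      using that by (simp add: space_eq)
    have "norm (D x) \<le> e * exp (- x) * x"
      unfolding D_def using le[of x] x by (simp add: abs_mult mult_right_mono del: of_nat_Suc)
    also have "\<dots> = e * (x * exp (- x))"
      by simp
    also have "\<dots> \<le> e * (1 - exp (- x))"
      using mult_exp_le e by (rule mult_left_mono)
    finally show ?thesis .
  qed
  have int: "integrable \<mu> (\<lambda>x. e * (1 - exp (- x)))"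
    by (intro integrable_mult_right integrable_weight)
  have int_D: "integrable \<mu> D"
  proof (rule Bochner_Integration.integrable_bound[OF int])
    show "D \<in> borel_measurable \<mu>"
      unfolding D_def
      by (intro borel_measurable_continuous continuous_intros continuous_on_subset[OF \<phi>]) auto
    show "AE x in \<mu>. norm (D x) \<le> norm (e * (1 - exp (- x)))"
      using D_le by (intro AE_I2) (fastforce intro: order_trans)
  qed
  have int_\<psi>: "integrable \<mu> \<psi>"
    unfolding \<psi>_def by (intro Bochner_Integration.integrable_sum integrable_mult_right integrable_mult_exp) simp
  have "\<psi> x = (\<Sum>k\<le>n. a k * exp (- (real (Suc k) * x))) * x" for x
    unfolding \<psi>_def sum_distrib_right by (intro sum.cong refl) (simp only: mult_ac)
  then have "(\<integral>x. \<phi> x * x \<partial>\<mu>) = (\<integral>x. D x + \<psi> x \<partial>\<mu>)"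
    by (simp only: D_def left_diff_distrib diff_add_cancel)
  also have "\<dots> = (\<integral>x. D x \<partial>\<mu>) + (\<integral>x. \<psi> x \<partial>\<mu>)"
    by (rule Bochner_Integration.integral_add[OF int_D int_\<psi>])
  also have "(\<integral>x. \<psi> x \<partial>\<mu>) = (\<Sum>k\<le>n. a k * mass_laplace \<mu> (Suc k))"
    unfolding \<psi>_def mass_laplace_def
    by (subst Bochner_Integration.integral_sum)
       (auto intro!: integrable_mult_right integrable_mult_exp simp del: of_nat_Suc)
  finally have "(\<integral>x. \<phi> x * x \<partial>\<mu>) - (\<Sum>k\<le>n. a k * mass_laplace \<mu> (Suc k)) = (\<integral>x. D x \<partial>\<mu>)"
    by simp
  moreover have "norm (\<integral>x. D x \<partial>\<mu>) \<le> (\<integral>x. e * (1 - exp (- x)) \<partial>\<mu>)"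
    by (rule Bochner_Integration.integral_norm_bound_integral[OF int_D int D_le])
  ultimately show ?thesis
    by (simp add: bernstein_def)
qed

text \<open>The hypothesis is the stationary Riccati equation U^2 = l differentiated in l. It makes
  the form equal to - 1 on every exponential, which balances the value 1 of that exponential at
  0.\<close>

lemma stationary_flux_solutionI:
  assumes "\<And>l. l > 0 \<Longrightarrow> 2 * bernstein \<mu> l * mass_laplace \<mu> l = 1"
  shows "stationary_flux_solution \<mu>"
  unfolding stationary_flux_solution_def
proof (intro conjI ballI)
  fix \<phi> assume \<phi>: "\<phi> \<in> C1c {0..}"
  have cont: "continuous_on {0..} \<phi>"
    using \<phi> by (rule C1c_continuous_on)
  have *: "integrable (\<mu> \<Otimes>\<^sub>M \<mu>) (\<lambda>(x, y). coag_increment \<phi> x y) \<and>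
      \<bar>coag_form \<phi> \<mu> + \<phi> 0\<bar> \<le> e * (2 * (bernstein \<mu> 1)\<^sup>2 + 1)" if e: "e > 0" for e
  proof (rule C1c_approx[OF \<phi> e])
    fix a :: "nat \<Rightarrow> real" and n :: nat
    let ?\<psi> = "\<lambda>x. \<Sum>k\<le>n. a k * exp (- (real (Suc k) * x))"
    assume le: "\<And>x. x \<ge> 0 \<Longrightarrow> \<bar>\<phi> x - ?\<psi> x\<bar> \<le> e * exp (- x)"
      and inc: "\<And>x y. x > 0 \<Longrightarrow> y > 0 \<Longrightarrow>
        \<bar>coag_increment (\<lambda>x. \<phi> x - ?\<psi> x) x y\<bar> \<le> 2 * e * ((1 - exp (- x)) * (1 - exp (- y)))"
    have "(\<Sum>k\<le>n. a k * (2 * bernstein \<mu> (Suc k) * mass_laplace \<mu> (Suc k))) = ?\<psi> 0"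
      using assms by (simp del: of_nat_Suc)
    then have "\<bar>coag_form \<phi> \<mu> + ?\<psi> 0\<bar> \<le> 2 * e * (bernstein \<mu> 1)\<^sup>2"
      using coag_form_approx(2)[OF cont inc] by (simp only:)
    moreover have "\<bar>\<phi> 0 - ?\<psi> 0\<bar> \<le> e"
      using le[of 0] by simp
    ultimately have "\<bar>coag_form \<phi> \<mu> + \<phi> 0\<bar> \<le> e * (2 * (bernstein \<mu> 1)\<^sup>2 + 1)"
      by (simp only: distrib_left mult_1_right)
    then show ?thesis
      using coag_form_approx(1)[OF cont inc] by blast
  qed
  show "integrable (\<mu> \<Otimes>\<^sub>M \<mu>) (\<lambda>(x, y). coag_increment \<phi> x y)"
    using *[of 1] by simp
  have "\<bar>coag_form \<phi> \<mu> + \<phi> 0\<bar> \<le> 0"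
  proof (rule field_le_epsilon)
    fix e :: real assume e: "e > 0"
    have pos: "2 * (bernstein \<mu> 1)\<^sup>2 + 1 > 0"
      by (intro add_nonneg_pos) auto
    then show "\<bar>coag_form \<phi> \<mu> + \<phi> 0\<bar> \<le> 0 + e"
      using *[of "e / (2 * (bernstein \<mu> 1)\<^sup>2 + 1)"] e by auto
  qed
  then show "coag_form \<phi> \<mu> + \<phi> 0 = 0"
    by simp
qed (rule radon_measure_on)

text \<open>Multiplying exp (- (i * x)) by the weight gives the difference of the integrands of
  \<open>bernstein\<close> at i + 1 and at i. Hence the values of \<open>bernstein\<close> at
  natural numbers already determine integrals of test functions.\<close>

lemma integral_approx:
  assumes h: "h \<in> Cc {0<..}" and e: "e \<ge> 0"
    and le: "\<And>x. x > 0 \<Longrightarrow>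
      \<bar>h x - (\<Sum>i\<le>n. b i * exp (- (real i * x))) * (1 - exp (- x))\<bar> \<le> e * (1 - exp (- x))"
  shows "\<bar>(\<integral>x. h x \<partial>\<mu>) - (\<Sum>i\<le>n. b i * (bernstein \<mu> (real (Suc i)) - bernstein \<mu> (real i)))\<bar> \<le> e * bernstein \<mu> 1"
proof -
  define \<psi> where "\<psi> = (\<lambda>x. \<Sum>i\<le>n. b i * ((1 - exp (- (real (Suc i) * x))) - (1 - exp (- (real i * x)))))"
  define D where "D = (\<lambda>x. h x - \<psi> x)"
  have "exp (- (real i * x)) * (1 - exp (- x)) = (1 - exp (- (real (Suc i) * x))) - (1 - exp (- (real i * x)))" for i x
    by (simp add: algebra_simps flip: exp_add)
  then have "\<psi> x = (\<Sum>i\<le>n. b i * exp (- (real i * x))) * (1 - exp (- x))" for x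
    by (simp only: \<psi>_def sum_distrib_right mult.assoc)
  then have D_le: "norm (D x) \<le> e * (1 - exp (- x))" if "x \<in> space \<mu>" for x
    using le[of x] that by (simp add: D_def space_eq)
  have int: "integrable \<mu> (\<lambda>x. e * (1 - exp (- x)))"
    by (intro integrable_mult_right integrable_weight)
  have int_D: "integrable \<mu> D"
  proof (rule Bochner_Integration.integrable_bound[OF int])
    show "D \<in> borel_measurable \<mu>"
      using h unfolding D_def \<psi>_def
      by (intro borel_measurable_continuous continuous_intros) (auto simp: Cc_def)
    show "AE x in \<mu>. norm (D x) \<le> norm (e * (1 - exp (- x)))"
      using D_le by (intro AE_I2) (fastforce intro: order_trans)
  qed
  have int_i: "integrable \<mu> (\<lambda>x. 1 - exp (- (real i * x)))" for i
    by (rule integrable_one_minus_exp) simp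
  have int_\<psi>: "integrable \<mu> \<psi>"
    unfolding \<psi>_def
    by (intro Bochner_Integration.integrable_sum integrable_mult_right Bochner_Integration.integrable_diff int_i)
  have "(\<integral>x. h x \<partial>\<mu>) = (\<integral>x. D x + \<psi> x \<partial>\<mu>)"
    by (simp add: D_def)
  also have "\<dots> = (\<integral>x. D x \<partial>\<mu>) + (\<integral>x. \<psi> x \<partial>\<mu>)"
    by (rule Bochner_Integration.integral_add[OF int_D int_\<psi>])
  also have "(\<integral>x. \<psi> x \<partial>\<mu>)
      = (\<Sum>i\<le>n. \<integral>x. b i * ((1 - exp (- (real (Suc i) * x))) - (1 - exp (- (real i * x)))) \<partial>\<mu>)"
    unfolding \<psi>_def
    by (intro Bochner_Integration.integral_sum integrable_mult_right Bochner_Integration.integrable_diff int_i)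
  also have "\<dots> = (\<Sum>i\<le>n. b i * (bernstein \<mu> (real (Suc i)) - bernstein \<mu> (real i)))"
    unfolding bernstein_def integral_mult_right_zero
    by (subst Bochner_Integration.integral_diff[OF int_i int_i]) (rule refl)
  finally have "(\<integral>x. h x \<partial>\<mu>) - (\<Sum>i\<le>n. b i * (bernstein \<mu> (real (Suc i)) - bernstein \<mu> (real i)))
      = (\<integral>x. D x \<partial>\<mu>)"
    by simp
  moreover have "norm (\<integral>x. D x \<partial>\<mu>) \<le> (\<integral>x. e * (1 - exp (- x)) \<partial>\<mu>)"
    by (rule Bochner_Integration.integral_norm_bound_integral[OF int_D int D_le])
  ultimately show ?thesis
    by (simp add: bernstein_def)
qed

end

text \<open>A continuity theorem for Bernstein functions. Convergence at k = 1 bounds the weighted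
  masses eventually, which makes the approximation error uniform along the filter.\<close>

lemma weak_star_tendsto_bernstein:
  assumes \<mu>: "\<forall>\<^sub>F t in F. levy_measure (\<mu> t)" and "levy_measure \<nu>"
    and lim: "\<And>k::nat. ((\<lambda>t. bernstein (\<mu> t) (real k)) \<longlongrightarrow> bernstein \<nu> (real k)) F"
  shows "weak_star_tendsto {0<..} \<mu> \<nu> F"
  unfolding weak_star_tendsto_def
proof (intro ballI tendstoI)
  fix h and e :: real assume h: "h \<in> Cc {0<..}" and e: "e > 0"
  interpret \<nu>: levy_measure \<nu> by fact
  define U where "U = bernstein \<nu> 1"
  have U: "U \<ge> 0"
    unfolding U_def by (rule \<nu>.bernstein_nonneg) simp
  \<comment> \<open>Chosen so that the errors d * (U + 1) for \<mu> t and d * U for \<nu> add up to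
    e / 2, leaving e / 2 for the exponential sums.\<close>
  define d where "d = e / (2 * (2 * U + 1))"
  have d: "d > 0"
    using e U by (simp add: d_def)
  show "\<forall>\<^sub>F t in F. dist (\<integral>x. h x \<partial>\<mu> t) (\<integral>x. h x \<partial>\<nu>) < e"
  proof (rule Cc_approx[OF h d])
    fix b :: "nat \<Rightarrow> real" and n :: nat
    define L where "L = (\<lambda>\<mu>. \<Sum>i\<le>n. b i * (bernstein \<mu> (real (Suc i)) - bernstein \<mu> (real i)))"
    assume le: "\<And>x. x > 0 \<Longrightarrow>
      \<bar>h x - (\<Sum>i\<le>n. b i * exp (- (real i * x))) * (1 - exp (- x))\<bar> \<le> d * (1 - exp (- x))"
    have "((\<lambda>t. L (\<mu> t)) \<longlongrightarrow> L \<nu>) F"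
      unfolding L_def by (intro tendsto_intros lim)
    then have "\<forall>\<^sub>F t in F. dist (L (\<mu> t)) (L \<nu>) < e / 2"
      using e by (intro tendstoD) auto
    moreover have "\<forall>\<^sub>F t in F. bernstein (\<mu> t) 1 < U + 1"
      using lim[of 1] by (intro order_tendstoD(2)) (auto simp: U_def)
    ultimately show ?thesis
      using \<mu>
    proof eventually_elim
      case (elim t)
      then interpret \<mu>: levy_measure "\<mu> t" by simp
      have "\<bar>(\<integral>x. h x \<partial>\<mu> t) - L (\<mu> t)\<bar> \<le> d * bernstein (\<mu> t) 1"
        unfolding L_def using d by (intro \<mu>.integral_approx h le) auto
      also have "\<dots> \<le> d * (U + 1)"
        using elim d by (intro mult_left_mono) auto
      finally have 1: "\<bar>(\<integral>x. h x \<partial>\<mu> t) - L (\<mu> t)\<bar> \<le> d * (U + 1)" .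
      have 2: "\<bar>(\<integral>x. h x \<partial>\<nu>) - L \<nu>\<bar> \<le> d * U"
        unfolding L_def U_def using d by (intro \<nu>.integral_approx h le) auto
      have "d * (U + 1) + d * U = d * (2 * U + 1)"
        by (simp add: algebra_simps)
      also have "\<dots> = e / 2"
        using U by (simp add: d_def divide_simps)
      finally show ?case
        using 1 2 elim(1) unfolding dist_real_def by linarith
    qed
  qed
qed

text \<open>Recover the finite measures \<open>(1 - e\<^bsup>-x\<^esup>) \<mu>(dx)\<close> from their tails, then divide by the weight.\<close>

lemma levy_measure_eqI:
  assumes "levy_measure \<mu>" "levy_measure \<nu>"
    and eq: "\<And>k::nat. bernstein \<mu> (real k) = bernstein \<nu> (real k)"
  shows "\<mu> = \<nu>"
proof -
  interpret \<mu>: levy_measure \<mu> by fact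
  interpret \<nu>: levy_measure \<nu> by fact
  define w :: "real \<Rightarrow> real" where "w = (\<lambda>x. 1 - exp (- x))"
  have w_pos: "w x > 0" if "x > 0" for x
    using that by (simp add: w_def)
  have [measurable]: "w \<in> borel_measurable borel"
    by (simp add: w_def)
  have int_eq: "(\<integral>x. h x \<partial>\<mu>) = (\<integral>x. h x \<partial>\<nu>)" if "h \<in> Cc {0<..}" for h
  proof -
    \<comment> \<open>Uniqueness follows from the continuity theorem, applied to a constant
      family.\<close>
    have "weak_star_tendsto {0<..} (\<lambda>_. \<mu>) \<nu> at_top"
      using assms by (intro weak_star_tendsto_bernstein) auto
    then have "((\<lambda>_::real. \<integral>x. h x \<partial>\<mu>) \<longlongrightarrow> (\<integral>x. h x \<partial>\<nu>)) at_top"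
      using that by (auto simp: weak_star_tendsto_def)
    then show ?thesis
      by (simp add: tendsto_const_iff)
  qed
  have tail_eq: "(\<integral>x. w x * indicator {c<..} x \<partial>\<mu>) = (\<integral>x. w x * indicator {c<..} x \<partial>\<nu>)" if c: "c \<ge> 0" for c
  proof -
    \<comment> \<open>A continuous trapezoid under the indicator of {c<..}: it rises with slope n
      from c + 1 / (n + 1) and falls to 0 on [n - 1, n]. The offset keeps the support away from 0
      even for c = 0.\<close>
    define h where "h = (\<lambda>(n::nat) x. w x * (min 1 (real n * max 0 (x - c - 1 / real (Suc n)))
      * min 1 (max 0 (real n - x))))"
    have cont: "continuous_on A (h n)" for n A
      unfolding h_def w_def by (intro continuous_intros)
    have "h n \<in> Cc {0<..}" for n
    proof -
      have "c + 1 / real (Suc n) > 0"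
        using c by (intro add_nonneg_pos) auto
      then have "{c + 1 / real (Suc n)..real n} \<subseteq> {0<..}"
        by (metis atLeastAtMost_iff greaterThan_iff less_le_trans subsetI)
      then show ?thesis
        using cont unfolding Cc_def compact_support_on_def
        by (intro CollectI conjI exI[of _ "{c + 1 / real (Suc n)..real n}"]) (auto simp: h_def max_def)
    qed
    note heq = int_eq[OF this]
    have bound: "norm (h n x) \<le> w x" if "x > 0" for n x
    proof -
      have "min 1 (real n * max 0 (x - c - 1 / real (Suc n))) * min 1 (max 0 (real n - x)) \<le> 1 * 1"
        by (intro mult_mono) auto
      moreover have "min 1 (real n * max 0 (x - c - 1 / real (Suc n))) * min 1 (max 0 (real n - x)) \<ge> 0"
        by (intro mult_nonneg_nonneg) auto
      ultimately show ?thesis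
        using w_pos[OF that] by (simp add: h_def abs_mult mult_left_le)
    qed
    have lim: "(\<lambda>n. h n x) \<longlonglongrightarrow> w x * indicator {c<..} x" for x
    proof (cases "x > c")
      case True
      \<comment> \<open>The bound x + 1 puts x before the falling edge. The bound 2 / (x - c) makes
        the rising edge at least 2 - n / (n + 1) \<ge> 1.\<close>
      have "\<forall>\<^sub>F n in sequentially. real n \<ge> max (x + 1) (2 / (x - c))"
        using filterlim_real_sequentially by (simp only: filterlim_at_top)
      then have "\<forall>\<^sub>F n in sequentially. h n x = w x * indicator {c<..} x"
      proof eventually_elim
        case (elim n)
        have n: "real n \<ge> x + 1" "real n \<ge> 2 / (x - c)"
          using elim by auto
        then have n2: "real n * (x - c) \<ge> 2"
          using True by (simp add: field_simps)
        have "real n / real (Suc n) \<le> 1"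
          by simp
        moreover have "real n * (x - c - 1 / real (Suc n)) = real n * (x - c) - real n / real (Suc n)"
          by (simp add: right_diff_distrib)
        ultimately have "real n * (x - c - 1 / real (Suc n)) \<ge> 1"
          using n2 by linarith
        moreover have "real n * max 0 (x - c - 1 / real (Suc n)) \<ge> real n * (x - c - 1 / real (Suc n))"
          by (intro mult_left_mono) auto
        ultimately show ?case
          using n(1) True by (simp add: h_def)
      qed
      then show ?thesis
        by (rule tendsto_eventually)
    next
      case False
      have "1 / real (Suc n) \<ge> 0" for n
        by simp
      then have "x - c - 1 / real (Suc n) \<le> 0" for n
        using False by (smt (verit))
      then have "h n x = 0" for n
        by (simp only: h_def max_absorb1)
      then show ?thesis
        using False by simp
    qed
    have conv: "(\<lambda>n. \<integral>x. h n x \<partial>\<rho>) \<longlonglongrightarrow> (\<integral>x. w x * indicator {c<..} x \<partial>\<rho>)" if "levy_measure \<rho>" for \<rho>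
    proof (rule integral_dominated_convergence)
      interpret levy_measure \<rho> by fact
      show "integrable \<rho> w"
        unfolding w_def by (rule integrable_weight)
      show "(\<lambda>x. w x * indicator {c<..} x) \<in> borel_measurable \<rho>"
        by (rule borel_measurable_borel) measurable
      show "h n \<in> borel_measurable \<rho>" for n
        by (intro borel_measurable_continuous cont)
      show "AE x in \<rho>. (\<lambda>n. h n x) \<longlonglongrightarrow> w x * indicator {c<..} x"
        using lim by simp
      show "AE x in \<rho>. norm (h n x) \<le> w x" for n
        using bound by (intro AE_I2) (simp add: space_eq)
    qed
    show ?thesis
      using conv[OF assms(1)] conv[OF assms(2)] unfolding heq by (rule LIMSEQ_unique)
  qed
  \<comment> \<open>The weighted measure is pushed to the whole line, where a measure with finite
    upper half-lines is determined by its values on them.\<close>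
  define M where "M = (\<lambda>\<rho>. distr (density \<rho> (\<lambda>x. ennreal (w x))) borel (\<lambda>x. x))"
  have M_tail: "emeasure (M \<rho>) {x<..} = ennreal (\<integral>z. w z * indicator {max x 0<..} z \<partial>\<rho>)"
    if "levy_measure \<rho>" for \<rho> x
  proof -
    interpret levy_measure \<rho> by fact
    have [measurable]: "(\<lambda>x. x) \<in> measurable \<rho> borel" "w \<in> borel_measurable \<rho>"
      by (rule borel_measurable_borel; measurable)+
    have S: "{x<..} \<inter> space \<rho> \<in> sets \<rho>"
      by (rule sets_eqI) (auto simp: space_eq)
    have "emeasure (M \<rho>) {x<..} = emeasure (density \<rho> (\<lambda>x. ennreal (w x))) ({x<..} \<inter> space \<rho>)"
      unfolding M_def by (subst emeasure_distr) auto
    also have "\<dots> = (\<integral>\<^sup>+z. ennreal (w z) * indicator ({x<..} \<inter> space \<rho>) z \<partial>\<rho>)"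
      using S by (subst emeasure_density) auto
    also have "\<dots> = (\<integral>\<^sup>+z. ennreal (w z * indicator {max x 0<..} z) \<partial>\<rho>)"
      by (intro nn_integral_cong) (auto simp: space_eq indicator_def)
    also have "\<dots> = ennreal (\<integral>z. w z * indicator {max x 0<..} z \<partial>\<rho>)"
    proof (rule nn_integral_eq_integral)
      have "(\<lambda>z. w z * indicator {max x 0<..} z) \<in> borel_measurable \<rho>"
        by (rule borel_measurable_borel) measurable
      then show "integrable \<rho> (\<lambda>z. w z * indicator {max x 0<..} z)"
        by (rule Bochner_Integration.integrable_bound[OF integrable_weight])
           (auto simp: w_def indicator_def)
      show "AE z in \<rho>. 0 \<le> w z * indicator {max x 0<..} z"
        using w_pos by (intro AE_I2) (auto simp: indicator_def less_imp_le)
    qed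
    finally show ?thesis .
  qed
  have M_eq: "M \<mu> = M \<nu>"
  proof (rule measure_eqI_lessThan)
    show "sets (M \<mu>) = sets borel" "sets (M \<nu>) = sets borel"
      by (simp_all add: M_def)
    show "emeasure (M \<mu>) {x<..} < \<infinity>" for x
      by (simp add: M_tail[OF assms(1)])
    show "emeasure (M \<mu>) {x<..} = emeasure (M \<nu>) {x<..}" for x
      by (simp add: M_tail[OF assms(1)] M_tail[OF assms(2)] tail_eq)
  qed
  have recover: "emeasure \<rho> A = (\<integral>\<^sup>+x. indicator A x * ennreal (1 / w x) \<partial>M \<rho>)"
    if "levy_measure \<rho>" "A \<in> sets \<rho>" for \<rho> A
  proof -
    interpret levy_measure \<rho> by fact
    have [measurable]: "(\<lambda>x. x) \<in> measurable \<rho> borel" "w \<in> borel_measurable \<rho>" "A \<in> sets \<rho>"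
      using that(2) by (auto intro: borel_measurable_borel)
    have [measurable]: "A \<in> sets borel"
      using that(2) by (auto simp: sets_eq sets_restrict_space_iff)
    have "(\<integral>\<^sup>+x. indicator A x * ennreal (1 / w x) \<partial>M \<rho>)
        = (\<integral>\<^sup>+x. ennreal (w x) * (indicator A x * ennreal (1 / w x)) \<partial>\<rho>)"
    proof -
      have g: "(\<lambda>x. indicator A x * ennreal (1 / w x)) \<in> borel_measurable borel"
        by measurable
      have "(\<integral>\<^sup>+x. indicator A x * ennreal (1 / w x) \<partial>M \<rho>)
          = (\<integral>\<^sup>+x. indicator A x * ennreal (1 / w x) \<partial>density \<rho> (\<lambda>x. ennreal (w x)))"
        unfolding M_def by (subst nn_integral_distr) (use g in \<open>simp_all, measurable\<close>)
      also have "\<dots> = (\<integral>\<^sup>+x. ennreal (w x) * (indicator A x * ennreal (1 / w x)) \<partial>\<rho>)"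
        by (rule nn_integral_density[OF _ borel_measurable_borel[OF g]]) measurable
      finally show ?thesis .
    qed
    also have "\<dots> = (\<integral>\<^sup>+x. indicator A x \<partial>\<rho>)"
    proof (intro nn_integral_cong)
      fix x assume "x \<in> space \<rho>"
      then have "w x > 0"
        using w_pos by (simp add: space_eq)
      then have "ennreal (w x) * ennreal (1 / w x) = 1"
        by (subst ennreal_mult[symmetric]) auto
      then show "ennreal (w x) * (indicator A x * ennreal (1 / w x)) = indicator A x"
        by (metis mult.left_commute mult.right_neutral)
    qed
    finally show ?thesis
      by simp
  qed
  show ?thesis
  proof (rule measure_eqI)
    show "sets \<mu> = sets \<nu>"
      by (simp add: \<mu>.sets_eq \<nu>.sets_eq)
    then show "emeasure \<mu> A = emeasure \<nu> A" if "A \<in> sets \<mu>" for A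
      using that by (simp add: recover[OF assms(1)] recover[OF assms(2)] M_eq)
  qed
qed

section \<open>The explicit solution\<close>

text \<open>The numbers - \<open>decay_rate t k\<close> are the poles of sqrt l * tanh (sqrt l * t)
  as a function of l.\<close>

definition decay_rate :: "real \<Rightarrow> nat \<Rightarrow> real" where
  "decay_rate t k = ((real k + 1/2) * pi / t)\<^sup>2"

text \<open>At \<open>t = 0\<close> division by zero makes every term vanish, so the measure is null.\<close>

definition explicit_solution :: "real \<Rightarrow> real measure" where
  "explicit_solution t = density (restrict_space lborel {0<..})
     (\<lambda>x. \<Sum>k. ennreal (2 / t * (decay_rate t k * exp (- (decay_rate t k * x)))))"

lemma sets_restrict_lborel: "sets (restrict_space lborel {0<..}) = sets (restrict_space borel ({0<..} :: real set))"
  by (simp add: sets_restrict_space)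

text \<open>A single computation with nonnegative integrals yields both integrability of the weight,
  from l = 1, and the transform.\<close>

lemma levy_measureI:
  assumes sets: "sets \<mu> = sets (restrict_space borel {0<..})"
    and nn: "\<And>l. l > 0 \<Longrightarrow> (\<integral>\<^sup>+x. ennreal (1 - exp (- (l * x))) \<partial>\<mu>) = ennreal (U l)"
    and U: "\<And>l. l > 0 \<Longrightarrow> U l \<ge> 0"
  shows "levy_measure \<mu>" and "\<And>l. l > 0 \<Longrightarrow> bernstein \<mu> l = U l"
proof -
  have space: "space \<mu> = {0<..}"
    using sets_eq_imp_space_eq[OF sets] by (simp add: space_restrict_space)
  have meas: "(\<lambda>x. 1 - exp (- (l * x))) \<in> borel_measurable \<mu>" for l
    unfolding measurable_cong_sets[OF sets refl]
    by (intro borel_measurable_continuous_on_restrict continuous_intros)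
  have bi: "has_bochner_integral \<mu> (\<lambda>x. 1 - exp (- (l * x))) (U l)" if "l > 0" for l
    using meas that nn[OF that] U[OF that]
    by (intro has_bochner_integral_nn_integral) (auto simp: space)
  show "levy_measure \<mu>"
    using bi[of 1] by unfold_locales (auto simp: sets has_bochner_integral_iff)
  show "bernstein \<mu> l = U l" if "l > 0" for l
    using bi[OF that] by (simp add: bernstein_def has_bochner_integral_iff)
qed

section \<open>Transform of the explicit density\<close>

lemma nn_integral_exp_weight:
  fixes b l :: real
  assumes b: "b > 0" and l: "l > 0"
  shows "(\<integral>\<^sup>+x. ennreal (b * exp (- (b * x)) * (1 - exp (- (l * x)))) \<partial>restrict_space lborel {0<..})
    = ennreal (l / (l + b))"
proof -
  define F where "F = (\<lambda>x. - exp (- (b * x)) + b / (l + b) * exp (- ((l + b) * x)))"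
  have "(\<integral>\<^sup>+x. ennreal (b * exp (- (b * x)) * (1 - exp (- (l * x)))) \<partial>restrict_space lborel {0<..})
      = (\<integral>\<^sup>+x. ennreal (b * exp (- (b * x)) * (1 - exp (- (l * x)))) * indicator {0<..} x \<partial>lborel)"
    by (rule nn_integral_restrict_space) simp
  also have "\<dots> = (\<integral>\<^sup>+x. ennreal (b * exp (- (b * x)) * (1 - exp (- (l * x)))) * indicator {0..} x \<partial>lborel)"
    by (intro nn_integral_cong) (auto simp: indicator_def)
  also have "\<dots> = ennreal (0 - F 0)"
  proof (rule nn_integral_FTC_atLeast)
    show "(\<lambda>x. b * exp (- (b * x)) * (1 - exp (- (l * x)))) \<in> borel_measurable borel"
      by measurable
    show "(F has_real_derivative b * exp (- (b * x)) * (1 - exp (- (l * x)))) (at x)" for x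
    proof -
      have "(F has_real_derivative b * exp (- (b * x)) + b / (l + b) * (exp (- ((l + b) * x)) * - (l + b))) (at x)"
        using b l unfolding F_def by (auto intro!: derivative_eq_intros)
      moreover have "b / (l + b) * (exp (- ((l + b) * x)) * - (l + b)) = - b * exp (- ((l + b) * x))"
      proof -
        have "l + b \<noteq> 0"
          using b l by linarith
        then show ?thesis
          by (simp add: divide_simps) (simp add: algebra_simps)
      qed
      moreover have "exp (- ((l + b) * x)) = exp (- (b * x)) * exp (- (l * x))"
        by (simp add: algebra_simps flip: exp_add)
      ultimately show ?thesis
        by (simp add: right_diff_distrib mult.assoc)
    qed
    show "b * exp (- (b * x)) * (1 - exp (- (l * x))) \<ge> 0" if "0 \<le> x" for x
      using b l that by simp
    show "(F \<longlongrightarrow> 0) at_top"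
    proof -
      have "(F \<longlongrightarrow> - 0 + b / (l + b) * 0) at_top"
        using b l unfolding F_def by (intro tendsto_intros exp_neg_mult_tendsto_0) auto
      then show ?thesis
        by simp
    qed
  qed
  also have "0 - F 0 = l / (l + b)"
    using b l by (simp add: F_def field_simps)
  finally show ?thesis .
qed

lemma tanh_le_self:
  fixes x :: real
  assumes "x \<ge> 0"
  shows "tanh x \<le> x"
proof -
  have "(\<lambda>x. x - tanh x) 0 \<le> (\<lambda>x. x - tanh x) x"
  proof (rule DERIV_nonneg_imp_nondecreasing[OF assms])
    fix y :: real
    have "((\<lambda>x. x - tanh x) has_real_derivative (tanh y)\<^sup>2) (at y)"
      by (auto intro!: derivative_eq_intros)
    then show "\<exists>z. ((\<lambda>x. x - tanh x) has_real_derivative z) (at y) \<and> 0 \<le> z"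
      by auto
  qed
  then show ?thesis
    by simp
qed

text \<open>Each exponential density b * exp (- (b * x)) has transform l / (l + b). With the factor
  2 / t these are the partial fractions of tanh at sqrt l * t, multiplied by sqrt l; positivity of
  the terms allows summing under the integral.\<close>

lemma nn_integral_explicit_solution:
  assumes t: "t \<ge> 0" and l: "l > 0"
  shows "(\<integral>\<^sup>+x. ennreal (1 - exp (- (l * x))) \<partial>explicit_solution t) = ennreal (sqrt l * tanh (sqrt l * t))"
proof -
  let ?R = "restrict_space lborel ({0<..} :: real set)"
  have mR: "f \<in> borel_measurable ?R" if "f \<in> borel_measurable borel" for f :: "real \<Rightarrow> ennreal"
    using that by (intro measurable_restrict_space1) simp
  have density: "(\<integral>\<^sup>+x. ennreal (1 - exp (- (l * x))) \<partial>explicit_solution t)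
      = (\<integral>\<^sup>+x. (\<Sum>k. ennreal (2 / t * (decay_rate t k * exp (- (decay_rate t k * x)))))
          * ennreal (1 - exp (- (l * x))) \<partial>?R)"
    unfolding explicit_solution_def by (intro nn_integral_density mR) measurable
  show ?thesis
  proof (cases "t = 0")
    case True
    then show ?thesis
      unfolding density by simp
  next
    case False
    with t have t: "t > 0"
      by simp
    define r where "r = decay_rate t"
    have r: "r k > 0" for k
      using t by (auto simp: r_def decay_rate_def intro!: zero_less_power divide_pos_pos mult_pos_pos add_nonneg_pos)
    have sums: "(\<lambda>k. 2 / t * (l / (l + r k))) sums (sqrt l * tanh (sqrt l * t))"
    proof -
      have "(\<lambda>k. sqrt l * (2 * (sqrt l * t) / ((sqrt l * t)\<^sup>2 + ((real k + 1/2) * pi)\<^sup>2))) sums (sqrt l * tanh (sqrt l * t))"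
        using l t by (intro sums_mult tanh_partial_fractions) simp
      moreover have "sqrt l * (2 * (sqrt l * t) / ((sqrt l * t)\<^sup>2 + ((real k + 1/2) * pi)\<^sup>2)) = 2 / t * (l / (l + r k))" for k
      proof -
        have rk: "((real k + 1/2) * pi)\<^sup>2 = t\<^sup>2 * r k"
          using t by (simp add: r_def decay_rate_def power_divide)
        have "(sqrt l * t)\<^sup>2 + ((real k + 1/2) * pi)\<^sup>2 = t\<^sup>2 * (l + r k)"
          using l unfolding rk by (simp add: power_mult_distrib algebra_simps)
        moreover have "sqrt l * (2 * (sqrt l * t)) = 2 * l * t"
        proof -
          have "sqrt l * (2 * (sqrt l * t)) = 2 * (sqrt l * sqrt l) * t"
            by (simp only: mult_ac)
          then show ?thesis
            using l by simp
        qed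
        ultimately have "sqrt l * (2 * (sqrt l * t) / ((sqrt l * t)\<^sup>2 + ((real k + 1/2) * pi)\<^sup>2))
            = 2 * l * t / (t\<^sup>2 * (l + r k))"
          by (simp only: times_divide_eq_right)
        then show ?thesis
          using t by (simp add: power2_eq_square)
      qed
      ultimately show ?thesis
        by simp
    qed
    have "(\<integral>\<^sup>+x. ennreal (1 - exp (- (l * x))) \<partial>explicit_solution t)
        = (\<integral>\<^sup>+x. (\<Sum>k. ennreal (2 / t * (r k * exp (- (r k * x))))) * ennreal (1 - exp (- (l * x))) \<partial>?R)"
      unfolding r_def by (rule density)
    also have "\<dots> = (\<integral>\<^sup>+x. (\<Sum>k. ennreal (2 / t) * ennreal (r k * exp (- (r k * x)) * (1 - exp (- (l * x))))) \<partial>?R)"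
    proof (intro nn_integral_cong)
      fix x assume "x \<in> space ?R"
      then have x: "x > 0"
        by (simp add: space_restrict_space)
      have "ennreal (2 / t * (r k * exp (- (r k * x)))) * ennreal (1 - exp (- (l * x)))
          = ennreal (2 / t) * ennreal (r k * exp (- (r k * x)) * (1 - exp (- (l * x))))" for k
        using t r[of k] x l by (simp add: ac_simps flip: ennreal_mult)
      then show "(\<Sum>k. ennreal (2 / t * (r k * exp (- (r k * x))))) * ennreal (1 - exp (- (l * x)))
          = (\<Sum>k. ennreal (2 / t) * ennreal (r k * exp (- (r k * x)) * (1 - exp (- (l * x)))))"
        by (simp add: ennreal_suminf_multc[symmetric])
    qed
    also have "\<dots> = (\<Sum>k. \<integral>\<^sup>+x. ennreal (2 / t) * ennreal (r k * exp (- (r k * x)) * (1 - exp (- (l * x)))) \<partial>?R)"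
      by (intro nn_integral_suminf mR) measurable
    also have "\<dots> = (\<Sum>k. ennreal (2 / t * (l / (l + r k))))"
    proof (intro suminf_cong)
      fix k
      have "(\<integral>\<^sup>+x. ennreal (2 / t) * ennreal (r k * exp (- (r k * x)) * (1 - exp (- (l * x)))) \<partial>?R)
          = ennreal (2 / t) * (\<integral>\<^sup>+x. ennreal (r k * exp (- (r k * x)) * (1 - exp (- (l * x)))) \<partial>?R)"
        by (intro nn_integral_cmult mR) measurable
      then show "(\<integral>\<^sup>+x. ennreal (2 / t) * ennreal (r k * exp (- (r k * x)) * (1 - exp (- (l * x)))) \<partial>?R)
          = ennreal (2 / t * (l / (l + r k)))"
        using t l r[of k] by (simp add: nn_integral_exp_weight flip: ennreal_mult)
    qed
    also have "\<dots> = ennreal (sqrt l * tanh (sqrt l * t))"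
    proof (intro suminf_ennreal_eq sums)
      show "0 \<le> 2 / t * (l / (l + r k))" for k
        using t l r[of k] by simp
    qed
    finally show ?thesis .
  qed
qed

lemma
  assumes "t \<ge> 0"
  shows levy_measure_explicit_solution: "levy_measure (explicit_solution t)"
    and bernstein_explicit_solution: "\<And>l. l > 0 \<Longrightarrow> bernstein (explicit_solution t) l = sqrt l * tanh (sqrt l * t)"
proof -
  have "sets (explicit_solution t) = sets (restrict_space borel {0<..})"
    by (simp add: explicit_solution_def sets_restrict_lborel)
  note * = levy_measureI[OF this nn_integral_explicit_solution[OF assms]]
  show "levy_measure (explicit_solution t)"
    by (rule *(1)) (use assms in auto)
  show "\<And>l. l > 0 \<Longrightarrow> bernstein (explicit_solution t) l = sqrt l * tanh (sqrt l * t)"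
    by (rule *(2)) (use assms in auto)
qed

lemma bernstein_0 [simp]: "bernstein \<mu> 0 = 0"
  by (simp add: bernstein_def)

text \<open>The derivative of \<open>\<surd>l tanh (t \<surd>l)\<close> with respect to \<open>l\<close>.\<close>

definition tanh_moment :: "real \<Rightarrow> real \<Rightarrow> real" where
  "tanh_moment l t = (tanh (sqrt l * t) / sqrt l + t * (1 - (tanh (sqrt l * t))\<^sup>2)) / 2"

lemma mass_laplace_explicit_solution:
  assumes t: "t \<ge> 0" and l: "l > 0"
  shows "mass_laplace (explicit_solution t) l = tanh_moment l t"
proof -
  interpret levy_measure "explicit_solution t"
    using t by (rule levy_measure_explicit_solution)
  have "((\<lambda>l. sqrt l * tanh (sqrt l * t)) has_real_derivative tanh_moment l t) (at l)"
    using l by (auto intro!: derivative_eq_intros simp: tanh_moment_def field_simps)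
  then have "(bernstein (explicit_solution t) has_real_derivative tanh_moment l t) (at l)"
    by (rule has_field_derivative_transform_within_open[of _ _ _ "{0<..}"])
       (use l t bernstein_explicit_solution in auto)
  then show ?thesis
    by (rule has_derivative_bernstein[OF l])
qed

text \<open>This is the Riccati equation differentiated in l. Computing it from the closed form
  avoids interchanging the two derivatives.\<close>

lemma has_derivative_tanh_moment:
  assumes l: "l > 0"
  shows "(tanh_moment l has_real_derivative 1 - 2 * (sqrt l * tanh (sqrt l * t)) * tanh_moment l t) (at t within A)"
proof -
  define r where "r = sqrt l"
  define T where "T = (\<lambda>t. tanh (r * t))"
  have r: "r > 0"
    using l by (simp add: r_def)
  have T: "(T has_real_derivative r * (1 - (T t)\<^sup>2)) (at t within A)"
    unfolding T_def by (auto intro!: derivative_eq_intros)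
  have "((\<lambda>t. T t / r + t * (1 - T t * T t)) has_real_derivative
      r * (1 - (T t)\<^sup>2) / r + (1 * (1 - T t * T t)
        + (0 - (r * (1 - (T t)\<^sup>2) * T t + r * (1 - (T t)\<^sup>2) * T t)) * t)) (at t within A)"
    by (intro DERIV_add DERIV_cdivide DERIV_mult DERIV_diff DERIV_ident DERIV_const T)
  then have "((\<lambda>t. (T t / r + t * (1 - T t * T t)) / 2) has_real_derivative
      (r * (1 - (T t)\<^sup>2) / r + (1 * (1 - T t * T t)
        + (0 - (r * (1 - (T t)\<^sup>2) * T t + r * (1 - (T t)\<^sup>2) * T t)) * t)) / 2) (at t within A)"
    by (rule DERIV_cdivide)
  moreover have "(r * (1 - (T t)\<^sup>2) / r + (1 * (1 - T t * T t)
        + (0 - (r * (1 - (T t)\<^sup>2) * T t + r * (1 - (T t)\<^sup>2) * T t)) * t)) / 2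
      = 1 - 2 * (r * T t) * ((T t / r + t * (1 - T t * T t)) / 2)"
    using r by (simp add: power2_eq_square) (simp add: field_simps)
  ultimately have "((\<lambda>t. (T t / r + t * (1 - T t * T t)) / 2) has_real_derivative
      1 - 2 * (r * T t) * ((T t / r + t * (1 - T t * T t)) / 2)) (at t within A)"
    by (simp only:)
  moreover have "tanh_moment l = (\<lambda>t. (T t / r + t * (1 - T t * T t)) / 2)"
    by (simp add: fun_eq_iff tanh_moment_def T_def r_def power2_eq_square)
  ultimately show ?thesis
    by (simp only: T_def r_def)
qed

text \<open>Fatou's lemma for (1 - exp (- (h * x))) / h, which tends to x as h tends to 0.\<close>

lemma (in levy_measure) nn_integral_mass_le:
  assumes "\<And>l. l > 0 \<Longrightarrow> bernstein \<mu> l \<le> C * l"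
  shows "(\<integral>\<^sup>+x. ennreal x \<partial>\<mu>) \<le> ennreal C"
proof -
  define h :: "nat \<Rightarrow> real" where "h = (\<lambda>n. 1 / real (Suc n))"
  have h: "h n > 0" for n
    by (simp add: h_def)
  have h0: "h \<longlonglongrightarrow> 0"
    unfolding h_def using LIMSEQ_inverse_real_of_nat by (simp add: inverse_eq_divide)
  have "(\<integral>\<^sup>+x. ennreal x \<partial>\<mu>) = (\<integral>\<^sup>+x. liminf (\<lambda>n. ennreal ((1 - exp (- (h n * x))) / h n)) \<partial>\<mu>)"
  proof (intro nn_integral_cong)
    fix x :: real
    have "((\<lambda>h. 1 - exp (- (h * x))) has_real_derivative x) (at 0)"
      by (auto intro!: derivative_eq_intros)
    then have "(\<lambda>n. (1 - exp (- ((0 + h n) * x)) - (1 - exp (- (0 * x)))) / h n) \<longlonglongrightarrow> x"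
      using h0 h by (intro DERIV_imp_LIMSEQ) (auto simp: less_imp_neq[symmetric])
    then have "(\<lambda>n. ennreal ((1 - exp (- (h n * x))) / h n)) \<longlonglongrightarrow> ennreal x"
      by (intro tendsto_ennrealI) simp
    then show "ennreal x = liminf (\<lambda>n. ennreal ((1 - exp (- (h n * x))) / h n))"
      by (simp add: lim_imp_Liminf)
  qed
  also have "\<dots> \<le> liminf (\<lambda>n. \<integral>\<^sup>+x. ennreal ((1 - exp (- (h n * x))) / h n) \<partial>\<mu>)"
    using h by (intro nn_integral_liminf measurable_compose[OF _ measurable_ennreal]
        borel_measurable_continuous continuous_intros) (auto simp: less_imp_neq[symmetric])
  also have "\<dots> \<le> liminf (\<lambda>n. ennreal C)"
  proof (intro Liminf_mono always_eventually allI)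
    fix n
    have "(\<integral>\<^sup>+x. ennreal ((1 - exp (- (h n * x))) / h n) \<partial>\<mu>) = ennreal (\<integral>x. (1 - exp (- (h n * x))) / h n \<partial>\<mu>)"
      using h[of n] by (intro nn_integral_eq_integral integrable_divide integrable_one_minus_exp AE_I2)
        (auto simp: space_eq)
    also have "(\<integral>x. (1 - exp (- (h n * x))) / h n \<partial>\<mu>) = bernstein \<mu> (h n) / h n"
      by (simp add: bernstein_def)
    also have "\<dots> \<le> C"
      using assms[OF h[of n]] h[of n] by (simp add: field_simps)
    finally show "(\<integral>\<^sup>+x. ennreal ((1 - exp (- (h n * x))) / h n) \<partial>\<mu>) \<le> ennreal C"
      by (simp add: ennreal_leI)
  qed
  finally show ?thesis
    by (simp add: Liminf_const)
qed

lemma (in levy_measure) mass_measure_finite: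
  assumes "(\<integral>\<^sup>+x. ennreal x \<partial>\<mu>) \<le> ennreal C"
  shows "radon_measure_on {0<..} (mass_measure \<mu>)" "finite_measure (mass_measure \<mu>)"
proof -
  have "(\<lambda>x. ennreal x) \<in> borel_measurable \<mu>"
    by (rule borel_measurable_borel) measurable
  then have fin: "emeasure (mass_measure \<mu>) (space (mass_measure \<mu>)) < \<infinity>"
    using assms by (simp add: mass_measure_def emeasure_density le_less_trans)
  then show "finite_measure (mass_measure \<mu>)"
    by (intro finite_measureI) auto
  have "emeasure (mass_measure \<mu>) K < \<infinity>" for K
    by (rule le_less_trans[OF emeasure_space fin])
  then show "radon_measure_on {0<..} (mass_measure \<mu>)"
    by (simp add: radon_measure_on_def mass_measure_def sets_eq)
qed

lemma (in levy_measure) integral_mass_measure: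
  assumes "h \<in> Cc {0<..}"
  shows "(\<integral>x. h x \<partial>mass_measure \<mu>) = (\<integral>x. x * h x \<partial>\<mu>)"
  unfolding mass_measure_def using assms
  by (subst integral_density) (auto simp: Cc_def space_eq intro!: borel_measurable_continuous AE_I2 continuous_intros)

section \<open>Weak continuity and the weak equation for the explicit solution\<close>

lemma weak_star_continuous_on_bernstein:
  assumes "\<And>t. t \<in> T \<Longrightarrow> levy_measure (\<mu> t)"
    and cont: "\<And>k::nat. continuous_on T (\<lambda>t. bernstein (\<mu> t) (real k))"
  shows "weak_star_continuous_on {0<..} T \<mu>"
  unfolding weak_star_continuous_on_def continuous_on_def
proof (intro ballI)
  fix h t assume "h \<in> Cc {0<..}" "t \<in> T"
  have "weak_star_tendsto {0<..} \<mu> (\<mu> t) (at t within T)"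
    using assms(1) \<open>t \<in> T\<close> cont
    by (intro weak_star_tendsto_bernstein) (auto simp: eventually_at_filter continuous_on_def)
  then show "((\<lambda>t. \<integral>x. h x \<partial>\<mu> t) \<longlongrightarrow> (\<integral>x. h x \<partial>\<mu> t)) (at t within T)"
    using \<open>h \<in> Cc {0<..}\<close> by (auto simp: weak_star_tendsto_def)
qed

text \<open>For exponential sums the equation is an integrated ordinary differential equation. The
  error of replacing \<phi> is uniform in time because \<open>bernstein\<close> at 1 equals tanh s,
  which stays below 1.\<close>

lemma explicit_solution_equation:
  assumes \<phi>: "\<phi> \<in> C1c {0..}" and t: "t > 0"
  shows "set_integrable lborel {0..t} (\<lambda>s. coag_form \<phi> (explicit_solution s))"
    and "(\<integral>x. \<phi> x * x \<partial>explicit_solution t)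
      = (LINT s:{0..t}|lborel. coag_form \<phi> (explicit_solution s)) + t * \<phi> 0"
proof -
  define F where "F = (\<lambda>s. coag_form \<phi> (explicit_solution s))"
  define A where "A = (\<integral>x. \<phi> x * x \<partial>explicit_solution t)"
  have \<phi>_cont: "continuous_on {0..} \<phi>"
    using \<phi> by (rule C1c_continuous_on)
  have approx: "\<exists>G I. continuous_on {0..t} G \<and> (G has_integral I) {0..t} \<and>
      (\<forall>s\<in>{0..t}. \<bar>F s - G s\<bar> \<le> 2 * e) \<and> \<bar>A - (I + t * \<phi> 0)\<bar> \<le> e * (1 + t)" if e: "e > 0" for e
  proof (rule C1c_approx[OF \<phi> e])
    fix a :: "nat \<Rightarrow> real" and n :: nat
    let ?\<psi> = "\<lambda>x. \<Sum>k\<le>n. a k * exp (- (real (Suc k) * x))"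
    assume le: "\<And>x. x \<ge> 0 \<Longrightarrow> \<bar>\<phi> x - ?\<psi> x\<bar> \<le> e * exp (- x)"
      and inc: "\<And>x y. x > 0 \<Longrightarrow> y > 0 \<Longrightarrow>
        \<bar>coag_increment (\<lambda>x. \<phi> x - ?\<psi> x) x y\<bar> \<le> 2 * e * ((1 - exp (- x)) * (1 - exp (- y)))"
    define V where "V = (\<lambda>k. tanh_moment (real (Suc k)))"
    define W where "W = (\<lambda>k s. 2 * (sqrt (real (Suc k)) * tanh (sqrt (real (Suc k)) * s)) * V k s)"
    define G where "G = (\<lambda>s. - (\<Sum>k\<le>n. a k * W k s))"
    have V': "(V k has_real_derivative 1 - W k s) (at s within S)" for k s S
      unfolding V_def W_def by (rule has_derivative_tanh_moment) simp
    have U1: "bernstein (explicit_solution s) 1 \<ge> 0" "bernstein (explicit_solution s) 1 \<le> 1"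
      if "s \<ge> 0" for s
      using that tanh_real_lt_1[of s] by (simp_all add: bernstein_explicit_solution)
    have FG: "\<bar>F s - G s\<bar> \<le> 2 * e" if "s \<in> {0..t}" for s
    proof -
      interpret levy_measure "explicit_solution s"
        using that by (intro levy_measure_explicit_solution) simp
      have "2 * bernstein (explicit_solution s) (Suc k) * mass_laplace (explicit_solution s) (Suc k) = W k s" for k
        using that by (simp add: W_def V_def bernstein_explicit_solution mass_laplace_explicit_solution del: of_nat_Suc)
      then have "\<bar>F s - G s\<bar> \<le> 2 * e * (bernstein (explicit_solution s) 1)\<^sup>2"
        using coag_form_approx(2)[OF \<phi>_cont inc] by (simp add: F_def G_def)
      also have "\<dots> \<le> 2 * e * 1"
        using U1[of s] that e by (intro mult_left_mono) (auto simp: power_le_one)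
      finally show ?thesis
        by simp
    qed
    have contG: "continuous_on {0..t} G"
    proof -
      have "continuous_on {0..t} (V k)" for k
        by (rule DERIV_continuous_on[OF V'])
      then show ?thesis
        unfolding G_def W_def by (intro continuous_intros) (auto simp: cosh_real_nonzero)
    qed
    \<comment> \<open>Since W k = 1 - V k', the integrand G is the sum of a k * (V k' - 1). The part
      with - t sums to - t times the exponential sum at 0, which the flux term t * \<phi> 0
      compensates up to the error.\<close>
    define I where "I = (\<Sum>k\<le>n. a k * (V k t - t))"
    have "((\<lambda>s. \<Sum>k\<le>n. a k * (V k s - s)) has_real_derivative G s) (at s within {0..t})" for s
    proof -
      have "((\<lambda>s. \<Sum>k\<le>n. a k * (V k s - s)) has_real_derivative (\<Sum>k\<le>n. a k * ((1 - W k s) - 1))) (at s within {0..t})"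
        by (intro DERIV_sum DERIV_cmult DERIV_diff V' DERIV_ident)
      then show ?thesis
        by (simp add: G_def sum_negf)
    qed
    then have "(G has_integral (\<Sum>k\<le>n. a k * (V k t - t)) - (\<Sum>k\<le>n. a k * (V k 0 - 0))) {0..t}"
      using t by (intro fundamental_theorem_of_calculus)
        (auto simp flip: has_real_derivative_iff_has_vector_derivative)
    moreover have "V k 0 = 0" for k
      by (simp add: V_def tanh_moment_def)
    ultimately have G_int: "(G has_integral I) {0..t}"
      by (simp add: I_def)
    have "\<bar>A - (\<Sum>k\<le>n. a k * V k t)\<bar> \<le> e"
    proof -
      interpret levy_measure "explicit_solution t"
        using t by (intro levy_measure_explicit_solution) simp
      have "mass_laplace (explicit_solution t) (Suc k) = V k t" for k
        using t by (simp add: V_def mass_laplace_explicit_solution del: of_nat_Suc)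
      then have "\<bar>A - (\<Sum>k\<le>n. a k * V k t)\<bar> \<le> e * bernstein (explicit_solution t) 1"
        using mass_approx[OF \<phi>_cont le] e by (simp add: A_def)
      also have "\<dots> \<le> e * 1"
        using U1[of t] t e by (intro mult_left_mono) auto
      finally show ?thesis
        by simp
    qed
    moreover have "\<bar>t * (\<phi> 0 - ?\<psi> 0)\<bar> \<le> t * e"
      using le[of 0] t by (simp add: abs_mult)
    moreover have "A - (I + t * \<phi> 0) = (A - (\<Sum>k\<le>n. a k * V k t)) - t * (\<phi> 0 - ?\<psi> 0)"
      by (simp add: I_def right_diff_distrib sum_subtractf sum_distrib_left mult.commute)
    ultimately have "\<bar>A - (I + t * \<phi> 0)\<bar> \<le> e + t * e"
      by linarith
    then have "\<bar>A - (I + t * \<phi> 0)\<bar> \<le> e * (1 + t)"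
      by (simp add: algebra_simps)
    then show ?thesis
      using contG G_int FG by blast
  qed
  have F_cont: "continuous_on {0..t} F"
  \<comment> \<open>The form is a uniform limit of continuous functions of time; its continuity
    yields the required time integrability.\<close>
  proof -
    have "\<forall>m::nat. \<exists>G. continuous_on {0..t} G \<and> (\<forall>s\<in>{0..t}. \<bar>F s - G s\<bar> \<le> 2 * (1 / real (Suc m)))"
      using approx by (metis of_nat_0_less_iff zero_less_Suc zero_less_divide_1_iff)
    then obtain G where G: "\<And>m. continuous_on {0..t} (G m)"
      "\<And>m s. s \<in> {0..t} \<Longrightarrow> \<bar>F s - G m s\<bar> \<le> 2 * (1 / real (Suc m))"
      by metis
    have "uniform_limit {0..t} G F sequentially"
    proof (rule uniform_limitI)
      fix e :: real assume e: "e > 0"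
      have "(\<lambda>m. 2 * (1 / real (Suc m))) \<longlonglongrightarrow> 2 * 0"
        using LIMSEQ_inverse_real_of_nat by (intro tendsto_intros) (simp add: inverse_eq_divide)
      then have "\<forall>\<^sub>F m in sequentially. 2 * (1 / real (Suc m)) < e"
        using e by (intro order_tendstoD(2)) auto
      then show "\<forall>\<^sub>F m in sequentially. \<forall>s\<in>{0..t}. dist (G m s) (F s) < e"
        by eventually_elim (use G(2) in \<open>fastforce simp: dist_real_def abs_minus_commute intro: le_less_trans\<close>)
    qed
    then show ?thesis
      by (rule uniform_limit_theorem[rotated]) (use G(1) in auto)
  qed
  then have si: "set_integrable lborel {0..t} F"
    by (rule borel_integrable_atLeastAtMost')
  then show "set_integrable lborel {0..t} (\<lambda>s. coag_form \<phi> (explicit_solution s))"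
    by (simp add: F_def)
  have F_int: "(F has_integral integral {0..t} F) {0..t}"
    by (intro integrable_integral integrable_continuous_real F_cont)
  have "\<bar>A - (integral {0..t} F + t * \<phi> 0)\<bar> \<le> 0"
  proof (rule field_le_epsilon)
    fix d :: real assume d: "d > 0"
    \<comment> \<open>The error e * (1 + t) of the equation for G and the error 2 * e * t from
      replacing F by G add up to d.\<close>
    define e where "e = d / (1 + 3 * t)"
    have e: "e > 0"
      using d t by (simp add: e_def)
    obtain G I where G: "(G has_integral I) {0..t}" "\<And>s. s \<in> {0..t} \<Longrightarrow> \<bar>F s - G s\<bar> \<le> 2 * e"
      "\<bar>A - (I + t * \<phi> 0)\<bar> \<le> e * (1 + t)"
      using approx[OF e] by blast
    have "norm (integral {0..t} F - I) \<le> 2 * e * measure lborel (cbox 0 t)"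
      by (rule has_integral_bound[of "2 * e" "\<lambda>s. F s - G s"])
        (use e G(2) has_integral_diff[OF F_int G(1)] in auto)
    then have "\<bar>integral {0..t} F - I\<bar> \<le> 2 * e * t"
      using t by simp
    then have "\<bar>A - (integral {0..t} F + t * \<phi> 0)\<bar> \<le> e * (1 + t) + 2 * e * t"
      using G(3) by linarith
    also have "\<dots> = d"
      using t by (simp add: e_def divide_simps) (simp add: algebra_simps)
    finally show "\<bar>A - (integral {0..t} F + t * \<phi> 0)\<bar> \<le> 0 + d"
      by simp
  qed
  then show "(\<integral>x. \<phi> x * x \<partial>explicit_solution t)
      = (LINT s:{0..t}|lborel. coag_form \<phi> (explicit_solution s)) + t * \<phi> 0"
    using set_borel_integral_eq_integral(2)[OF si] by (simp add: A_def F_def)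
qed

lemma flux_solution_explicit_solution: "flux_solution explicit_solution"
  unfolding flux_solution_def
proof (intro conjI allI impI ballI)
  fix t :: real assume t: "t \<ge> 0"
  then interpret levy_measure "explicit_solution t"
    by (rule levy_measure_explicit_solution)
  show "radon_measure_on {0<..} (explicit_solution t)"
    by (rule radon_measure_on)
  have "bernstein (explicit_solution t) l \<le> t * l" if l: "l > 0" for l
  proof -
    have "sqrt l * tanh (sqrt l * t) \<le> sqrt l * (sqrt l * t)"
      using l t by (intro mult_left_mono tanh_le_self) auto
    also have "\<dots> = l * t"
      using l by (simp flip: mult.assoc)
    finally show ?thesis
      using l t by (simp add: bernstein_explicit_solution mult.commute)
  qed
  then have "(\<integral>\<^sup>+x. ennreal x \<partial>explicit_solution t) \<le> ennreal t"
    by (rule nn_integral_mass_le)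
  from mass_measure_finite[OF this]
  show "radon_measure_on {0<..} (mass_measure (explicit_solution t))"
    "finite_measure (mass_measure (explicit_solution t))" .
next
  have "continuous_on {0..} (\<lambda>t. bernstein (explicit_solution t) (real k))" for k
  proof (cases "k = 0")
    case False
    have "continuous_on {0..} (\<lambda>t. sqrt (real k) * tanh (sqrt (real k) * t))"
      by (intro continuous_intros) (auto simp: cosh_real_nonzero)
    then show ?thesis
      using False by (subst continuous_on_cong[OF refl bernstein_explicit_solution]) auto
  qed simp
  then show cont: "weak_star_continuous_on {0<..} {0..} explicit_solution"
    by (intro weak_star_continuous_on_bernstein levy_measure_explicit_solution) auto
  show "weak_star_continuous_on {0<..} {0..} (\<lambda>t. mass_measure (explicit_solution t))"
    unfolding weak_star_continuous_on_def
  proof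
    fix h :: "real \<Rightarrow> real" assume h: "h \<in> Cc {0<..}"
    then have "(\<lambda>x. x * h x) \<in> Cc {0<..}"
      by (auto simp: Cc_def compact_support_on_def intro!: continuous_intros)
    then have "continuous_on {0..} (\<lambda>t. \<integral>x. x * h x \<partial>explicit_solution t)"
      using cont by (auto simp: weak_star_continuous_on_def)
    then show "continuous_on {0..} (\<lambda>t. \<integral>x. h x \<partial>mass_measure (explicit_solution t))"
      using h by (subst continuous_on_cong[OF refl levy_measure.integral_mass_measure[OF levy_measure_explicit_solution]]) auto
  qed
  show "explicit_solution 0 = null_measure (restrict_space borel {0<..})"
    by (rule measure_eqI) (auto simp: explicit_solution_def sets_restrict_lborel emeasure_density)
next
  fix \<phi> and t :: real assume "\<phi> \<in> C1c {0..}" "t > 0"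
  from explicit_solution_equation[OF this]
  show "set_integrable lborel {0..t} (\<lambda>s. coag_form \<phi> (explicit_solution s))"
    "(\<integral>x. \<phi> x * x \<partial>explicit_solution t)
      = (LINT s:{0..t}|lborel. coag_form \<phi> (explicit_solution s)) + t * \<phi> 0" .
qed

section \<open>The stationary profile\<close>

text \<open>Gamma (1 / 2) = sqrt pi, rescaled by y to l * y.\<close>

lemma nn_integral_exp_powr:
  fixes l :: real
  assumes l: "l > 0"
  shows "(\<integral>\<^sup>+y. ennreal (l * exp (- (l * y)) * y powr (- 1 / 2)) * indicator {0<..} y \<partial>lborel) = ennreal (sqrt pi * sqrt l)"
proof -
  define g where "g = (\<lambda>y::real. ennreal (exp (- y) * y powr (- 1 / 2)) * indicator {0<..} y)"
  have [measurable]: "g \<in> borel_measurable borel"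
    unfolding g_def by measurable
  have "((\<lambda>t::real. t powr (1 / 2 - 1) / exp t) has_integral Gamma (1 / 2)) {0..}"
    by (rule Gamma_integral_real) simp
  from nn_integral_has_integral_lebesgue'[OF _ this]
  have "integral\<^sup>N lborel (\<lambda>y::real. ennreal (y powr (1 / 2 - 1) / exp y) * indicator {0..} y) = ennreal (Gamma (1 / 2))"
    by simp
  also have "(\<lambda>y::real. ennreal (y powr (1 / 2 - 1) / exp y) * indicator {0..} y) = g"
  proof
    fix y :: real
    have "y powr (1 / 2 - 1) / exp y = exp (- y) * y powr (- 1 / 2)"
      by (simp add: exp_minus field_simps)
    then show "ennreal (y powr (1 / 2 - 1) / exp y) * indicator {0..} y = g y"
      by (cases "y = 0") (simp_all add: g_def indicator_def)
  qed
  finally have "ennreal (sqrt pi) = (\<integral>\<^sup>+y. g y \<partial>lborel)"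
    by (simp add: Gamma_one_half_real)
  also have "\<dots> = ennreal \<bar>l\<bar> * (\<integral>\<^sup>+y. g (0 + l * y) \<partial>lborel)"
    using l by (intro nn_integral_real_affine) auto
  also have "\<dots> = (\<integral>\<^sup>+y. ennreal \<bar>l\<bar> * g (0 + l * y) \<partial>lborel)"
    by (rule nn_integral_cmult[symmetric]) measurable
  \<comment> \<open>Multiplying by sqrt l removes the factor l powr (- 1 / 2) that the rescaling
    leaves inside the integrand.\<close>
  finally have "ennreal (sqrt l) * ennreal (sqrt pi) = ennreal (sqrt l) * (\<integral>\<^sup>+y. ennreal \<bar>l\<bar> * g (0 + l * y) \<partial>lborel)"
    by simp
  also have "\<dots> = (\<integral>\<^sup>+y. ennreal (sqrt l) * (ennreal \<bar>l\<bar> * g (0 + l * y)) \<partial>lborel)"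
    by (rule nn_integral_cmult[symmetric]) measurable
  also have "\<dots> = (\<integral>\<^sup>+y. ennreal (l * exp (- (l * y)) * y powr (- 1 / 2)) * indicator {0<..} y \<partial>lborel)"
  proof (intro nn_integral_cong)
    fix y :: real
    show "ennreal (sqrt l) * (ennreal \<bar>l\<bar> * g (0 + l * y))
        = ennreal (l * exp (- (l * y)) * y powr (- 1 / 2)) * indicator {0<..} y"
    proof (cases "y > 0")
      case True
      have "sqrt l * l powr (- 1 / 2) = 1"
        using l by (simp add: powr_minus powr_half_sqrt)
      then have "sqrt l * (l * (exp (- (l * y)) * (l * y) powr (- 1 / 2))) = l * exp (- (l * y)) * y powr (- 1 / 2)"
        using l True by (simp add: powr_mult mult_ac)
      then show ?thesis
        using l True by (simp add: g_def flip: ennreal_mult)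
    next
      case False
      then show ?thesis
        using l by (simp add: g_def zero_less_mult_iff)
    qed
  qed
  finally show ?thesis
    using l by (simp add: mult.commute flip: ennreal_mult)
qed

text \<open>Write 1 - exp (- (l * x)) as the integral of l * exp (- (l * y)) over [0, x] and
  exchange the integrals. The inner one becomes the tail 2 * c * y powr (- 1 / 2) of the profile,
  the outer one a Gamma integral, and c = 1 / (2 * sqrt pi) makes the constant 1.\<close>

lemma nn_integral_flux_profile:
  assumes l: "l > 0"
  shows "(\<integral>\<^sup>+x. ennreal (1 - exp (- (l * x))) \<partial>flux_profile) = ennreal (sqrt l)"
proof -
  define c where "c = 1 / (2 * sqrt pi)"
  have c: "c > 0"
    by (simp add: c_def)
  let ?p = "\<lambda>x::real. ennreal (c * x powr (- 3 / 2))"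
  let ?k = "\<lambda>y::real. ennreal (l * exp (- (l * y)))"
  have inner: "(\<integral>\<^sup>+y. ?k y * indicator {0..x} y \<partial>lborel) = ennreal (1 - exp (- (l * x)))" if "x > 0" for x
  proof -
    have "(\<integral>\<^sup>+y. ?k y * indicator {0..x} y \<partial>lborel) = ennreal ((- exp (- (l * x))) - (- exp (- (l * 0))))"
      using that l by (intro nn_integral_FTC_Icc) (auto intro!: derivative_eq_intros)
    then show ?thesis
      by simp
  qed
  have outer: "(\<integral>\<^sup>+x. ?p x * indicator {y..} x \<partial>lborel) = ennreal (2 * c * y powr (- 1 / 2))" if y: "y > 0" for y
  proof -
    have "(\<integral>\<^sup>+x. ?p x * indicator {y..} x \<partial>lborel) = ennreal (0 - (- (2 * c) * y powr (- 1 / 2)))"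
    proof (rule nn_integral_FTC_atLeast)
      show "((\<lambda>x. - (2 * c) * x powr (- 1 / 2)) has_real_derivative c * x powr (- 3 / 2)) (at x)" if "y \<le> x" for x
        using y that by (auto intro!: derivative_eq_intros)
      have "((\<lambda>x. - (2 * c) * x powr (- 1 / 2)) \<longlongrightarrow> - (2 * c) * 0) at_top"
        by (intro tendsto_intros tendsto_neg_powr filterlim_ident) simp
      then show "((\<lambda>x. - (2 * c) * x powr (- 1 / 2)) \<longlongrightarrow> 0) at_top"
        by simp
    qed (use c in auto)
    then show ?thesis
      by simp
  qed
  have "(\<integral>\<^sup>+x. ennreal (1 - exp (- (l * x))) \<partial>flux_profile)
      = (\<integral>\<^sup>+x. ?p x * ennreal (1 - exp (- (l * x))) \<partial>restrict_space lborel {0<..})"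
    unfolding flux_profile_def c_def
    by (intro nn_integral_density measurable_restrict_space1) measurable
  also have "\<dots> = (\<integral>\<^sup>+x. ?p x * ennreal (1 - exp (- (l * x))) * indicator {0<..} x \<partial>lborel)"
    by (rule nn_integral_restrict_space) simp
  also have "\<dots> = (\<integral>\<^sup>+x. \<integral>\<^sup>+y. ?k y * (?p x * indicator {y..} x) * indicator {0<..} y \<partial>lborel \<partial>lborel)"
  proof (intro nn_integral_cong)
    fix x :: real
    show "?p x * ennreal (1 - exp (- (l * x))) * indicator {0<..} x
        = (\<integral>\<^sup>+y. ?k y * (?p x * indicator {y..} x) * indicator {0<..} y \<partial>lborel)"
    proof (cases "x > 0")
      case True
      have "(\<integral>\<^sup>+y. ?k y * (?p x * indicator {y..} x) * indicator {0<..} y \<partial>lborel)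
          = (\<integral>\<^sup>+y. ?p x * (?k y * indicator {0..x} y) \<partial>lborel)"
      proof (rule nn_integral_cong_AE)
        have "AE y in lborel. y \<noteq> (0::real)"
          by (rule AE_lborel_singleton)
        then show "AE y in lborel. ?k y * (?p x * indicator {y..} x) * indicator {0<..} y = ?p x * (?k y * indicator {0..x} y)"
          by eventually_elim (auto simp: indicator_def mult.commute)
      qed
      also have "\<dots> = ?p x * ennreal (1 - exp (- (l * x)))"
        by (subst nn_integral_cmult) (use True inner in auto)
      finally show ?thesis
        using True by simp
    next
      case False
      then have "(\<integral>\<^sup>+y. ?k y * (?p x * indicator {y..} x) * indicator {0<..} y \<partial>lborel) = (\<integral>\<^sup>+y. 0 \<partial>(lborel :: real measure))"
        by (intro nn_integral_cong) (auto simp: indicator_def)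
      then show ?thesis
        using False by simp
    qed
  qed
  also have "\<dots> = (\<integral>\<^sup>+y. \<integral>\<^sup>+x. ?k y * (?p x * indicator {y..} x) * indicator {0<..} y \<partial>lborel \<partial>lborel)"
  proof (rule lborel_pair.Fubini'[symmetric])
    \<comment> \<open>The moving half-line {y..} is rewritten as a fixed set of pairs, which makes
      joint measurability visible.\<close>
    have "(\<lambda>(x, y). ?k y * (?p x * indicator {p. snd p \<le> fst p} (x, y)) * indicator {0<..} y)
        \<in> borel_measurable (lborel \<Otimes>\<^sub>M lborel)"
      by measurable
    then show "(\<lambda>(x, y). ?k y * (?p x * indicator {y..} x) * indicator {0<..} y) \<in> borel_measurable (lborel \<Otimes>\<^sub>M lborel)"
      by (rule measurable_cong[THEN iffD1, rotated]) (auto simp: indicator_def)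
  qed
  also have "\<dots> = (\<integral>\<^sup>+y. ennreal (2 * c) * (ennreal (l * exp (- (l * y)) * y powr (- 1 / 2)) * indicator {0<..} y) \<partial>lborel)"
  proof (intro nn_integral_cong)
    fix y :: real
    show "(\<integral>\<^sup>+x. ?k y * (?p x * indicator {y..} x) * indicator {0<..} y \<partial>lborel)
        = ennreal (2 * c) * (ennreal (l * exp (- (l * y)) * y powr (- 1 / 2)) * indicator {0<..} y)"
    proof (cases "y > 0")
      case True
      have "(\<integral>\<^sup>+x. ?k y * (?p x * indicator {y..} x) * indicator {0<..} y \<partial>lborel)
          = (\<integral>\<^sup>+x. ?k y * (?p x * indicator {y..} x) \<partial>lborel)"
        using True by (intro nn_integral_cong) simp
      also have "\<dots> = ?k y * (\<integral>\<^sup>+x. ?p x * indicator {y..} x \<partial>lborel)"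
        by (rule nn_integral_cmult) measurable
      also have "\<dots> = ennreal (l * exp (- (l * y)) * (2 * c * y powr (- 1 / 2)))"
        unfolding outer[OF True] using l c by (intro ennreal_mult[symmetric]) auto
      also have "\<dots> = ennreal (2 * c * (l * exp (- (l * y)) * y powr (- 1 / 2)))"
        by (simp only: mult_ac)
      also have "\<dots> = ennreal (2 * c) * ennreal (l * exp (- (l * y)) * y powr (- 1 / 2))"
        using l c by (intro ennreal_mult) auto
      finally show ?thesis
        using True by simp
    qed simp
  qed
  also have "\<dots> = ennreal (2 * c) * ennreal (sqrt pi * sqrt l)"
    unfolding nn_integral_exp_powr[OF l, symmetric] by (rule nn_integral_cmult) measurable
  also have "\<dots> = ennreal (sqrt l)"
    using c l by (simp add: c_def flip: ennreal_mult)
  finally show ?thesis .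
qed

lemma
  shows levy_measure_flux_profile: "levy_measure flux_profile"
    and bernstein_flux_profile: "\<And>l. l > 0 \<Longrightarrow> bernstein flux_profile l = sqrt l"
proof -
  have "sets flux_profile = sets (restrict_space borel {0<..})"
    by (simp add: flux_profile_def sets_restrict_lborel)
  note * = levy_measureI[OF this nn_integral_flux_profile]
  show "levy_measure flux_profile"
    by (rule *(1)) auto
  show "\<And>l. l > 0 \<Longrightarrow> bernstein flux_profile l = sqrt l"
    by (rule *(2)) auto
qed

text \<open>With U = sqrt l one has U^2 = l, so 2 * U * U' = 1.\<close>

lemma stationary_flux_profile: "stationary_flux_solution flux_profile"
proof -
  interpret levy_measure flux_profile
    by (rule levy_measure_flux_profile)
  show ?thesis
  proof (rule stationary_flux_solutionI)
    fix l :: real assume l: "l > 0"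
    have "(sqrt has_real_derivative inverse (sqrt l) / 2) (at l)"
      using l by (rule DERIV_real_sqrt)
    then have "(bernstein flux_profile has_real_derivative inverse (sqrt l) / 2) (at l)"
      by (rule has_field_derivative_transform_within_open[of _ _ _ "{0<..}"])
         (use l bernstein_flux_profile in auto)
    then have m: "mass_laplace flux_profile l = inverse (sqrt l) / 2"
      by (rule has_derivative_bernstein[OF l])
    show "2 * bernstein flux_profile l * mass_laplace flux_profile l = 1"
      using l by (simp add: bernstein_flux_profile m)
  qed
qed

lemma explicit_solution_tendsto: "weak_star_tendsto {0<..} explicit_solution flux_profile at_top"
proof (rule weak_star_tendsto_bernstein)
  show "\<forall>\<^sub>F t in at_top. levy_measure (explicit_solution t)"
    using eventually_ge_at_top[of 0] by eventually_elim (rule levy_measure_explicit_solution)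
  show "((\<lambda>t. bernstein (explicit_solution t) (real k)) \<longlongrightarrow> bernstein flux_profile (real k)) at_top" for k
  proof (cases "k = 0")
    case False
    have "filterlim (\<lambda>t. sqrt (real k) * t) at_top at_top"
      using False by (intro filterlim_tendsto_pos_mult_at_top[OF tendsto_const _ filterlim_ident]) simp
    then have "((\<lambda>t. sqrt (real k) * tanh (sqrt (real k) * t)) \<longlongrightarrow> sqrt (real k) * 1) at_top"
      by (intro tendsto_mult tendsto_const filterlim_compose[OF tanh_real_at_top])
    moreover have "\<forall>\<^sub>F t in at_top. sqrt (real k) * tanh (sqrt (real k) * t) = bernstein (explicit_solution t) (real k)"
      using eventually_ge_at_top[of 0]
      by eventually_elim (use False in \<open>simp add: bernstein_explicit_solution\<close>)
    ultimately show ?thesis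
      using False by (simp add: bernstein_flux_profile tendsto_cong)
  qed simp
qed (rule levy_measure_flux_profile)

section \<open>Uniqueness\<close>

lemma has_derivative_max_square: "((\<lambda>x. (max 0 x)\<^sup>2) has_real_derivative 2 * max 0 x) (at (x::real))"
proof (cases x "0 :: real" rule: linorder_cases)
  case less
  have "((\<lambda>x. 0) has_real_derivative 2 * max 0 x) (at x)"
    using less by simp
  then show ?thesis
    by (rule has_field_derivative_transform_within_open[of _ _ _ "{..<0}"]) (use less in auto)
next
  case equal
  have "((\<lambda>h::real. (max 0 h)\<^sup>2 / h) \<longlongrightarrow> 0) (at 0)"
  proof (rule Lim_null_comparison)
    show "\<forall>\<^sub>F h in at 0. norm ((max 0 h)\<^sup>2 / h) \<le> \<bar>h::real\<bar>"
      by (intro always_eventually allI) (simp add: max_def power2_eq_square)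
    show "((\<lambda>h::real. \<bar>h\<bar>) \<longlongrightarrow> 0) (at 0)"
      by (intro tendsto_rabs_zero tendsto_ident_at)
  qed
  then show ?thesis
    using equal by (simp add: DERIV_def)
next
  case greater
  have "((\<lambda>x. x\<^sup>2) has_real_derivative 2 * max 0 x) (at x)"
    using greater by (auto intro!: derivative_eq_intros)
  then show ?thesis
    by (rule has_field_derivative_transform_within_open[of _ _ _ "{0<..}"]) (use greater in auto)
qed

text \<open>Squaring the linear ramp removes its kink at n + 1, so the cutoff is an admissible test
  function while staying decreasing.\<close>

definition cutoff :: "nat \<Rightarrow> real \<Rightarrow> real" where
  "cutoff n x = (max 0 (1 - x / real (Suc n)))\<^sup>2"

lemma has_derivative_cutoff:
  "(cutoff n has_real_derivative - 2 * max 0 (1 - x / real (Suc n)) / real (Suc n)) (at x within A)"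
proof -
  have "((\<lambda>x. 1 - x / real (Suc n)) has_real_derivative - 1 / real (Suc n)) (at x within A)"
    by (auto intro!: derivative_eq_intros)
  from DERIV_chain2[OF has_derivative_max_square this]
  show ?thesis
    by (simp add: cutoff_def[abs_def])
qed

lemma cutoff_bounds:
  assumes "x \<ge> 0"
  shows "0 \<le> max 0 (1 - x / real (Suc n))" "max 0 (1 - x / real (Suc n)) \<le> 1" "0 \<le> cutoff n x" "cutoff n x \<le> 1"
  using assms by (auto simp: cutoff_def intro!: power_le_one)

lemma cutoff_0 [simp]: "cutoff n 0 = 1"
  by (simp add: cutoff_def)

lemma cutoff_antimono: "x \<le> y \<Longrightarrow> cutoff n y \<le> cutoff n x"
  unfolding cutoff_def by (intro power_mono max.mono diff_left_mono divide_right_mono) auto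

lemma cutoff_tendsto: "(\<lambda>n. cutoff n x) \<longlonglongrightarrow> 1"
proof -
  have "(\<lambda>n. 1 - x * inverse (real (Suc n))) \<longlonglongrightarrow> 1 - x * 0"
    by (intro tendsto_intros LIMSEQ_inverse_real_of_nat)
  then have "(\<lambda>n. (max 0 (1 - x * inverse (real (Suc n))))\<^sup>2) \<longlonglongrightarrow> (max 0 (1 - x * 0))\<^sup>2"
    by (intro tendsto_power tendsto_max tendsto_const)
  then show ?thesis
    by (simp add: cutoff_def divide_inverse)
qed

text \<open>The cutoff has slope at most 2, so the product is Lipschitz with constant 2 * A + B for
  every n. Independence of n is what dominated convergence uses; the outer factor 2 comes from the
  two differences in the increment.\<close>

lemma cutoff_mult:
  assumes \<rho>: "\<And>x. x \<ge> 0 \<Longrightarrow> (\<rho> has_real_derivative \<rho>' x) (at x within {0..})" "continuous_on {0..} \<rho>'"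
    and bound: "\<And>x. x \<ge> 0 \<Longrightarrow> \<bar>\<rho> x\<bar> \<le> A" "\<And>x. x \<ge> 0 \<Longrightarrow> \<bar>\<rho>' x\<bar> \<le> B"
  shows "(\<lambda>x. cutoff n x * \<rho> x) \<in> C1c {0..}"
    and "\<And>x y. x > 0 \<Longrightarrow> y > 0 \<Longrightarrow>
      \<bar>coag_increment (\<lambda>x. cutoff n x * \<rho> x) x y\<bar> \<le> 2 * (2 * A + B) * (x * y)"
proof -
  define c' where "c' = (\<lambda>x. - 2 * max 0 (1 - x / real (Suc n)) / real (Suc n))"
  define \<phi> where "\<phi> = (\<lambda>x. cutoff n x * \<rho> x)"
  define \<phi>' where "\<phi>' = (\<lambda>x. c' x * \<rho> x + \<rho>' x * cutoff n x)"
  have d: "(\<phi> has_real_derivative \<phi>' x) (at x within {0..})" if "x \<ge> 0" for x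
    unfolding \<phi>_def \<phi>'_def c'_def by (rule DERIV_mult[OF has_derivative_cutoff \<rho>(1)[OF that]])
  have cont_\<rho>: "continuous_on {0..} \<rho>"
    using \<rho>(1) by (intro DERIV_continuous_on) auto
  have cont: "continuous_on {0..} \<phi>'"
    unfolding \<phi>'_def c'_def cutoff_def by (intro continuous_intros cont_\<rho> \<rho>(2)) auto
  have supp: "compact_support_on {0..} \<phi>"
    unfolding compact_support_on_def
  proof (intro exI[of _ "{0..real (Suc n)}"] conjI ballI)
    fix x assume "x \<in> {0..} - {0..real (Suc n)}"
    then have "x > real (Suc n)"
      by auto
    then have "x / real (Suc n) > 1"
      by (simp add: less_divide_eq)
    then have "max 0 (1 - x / real (Suc n)) = 0"
      by (simp only: max_def) simp
    then show "\<phi> x = 0"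
      by (simp add: \<phi>_def cutoff_def)
  qed auto
  show "(\<lambda>x. cutoff n x * \<rho> x) \<in> C1c {0..}"
    using d cont supp unfolding C1c_def \<phi>_def by blast
  have bd: "norm (\<phi>' x) \<le> 2 * A + B" if x: "x \<ge> 0" for x
  proof -
    have "\<bar>c' x\<bar> = 2 * max 0 (1 - x / real (Suc n)) / real (Suc n)"
      using cutoff_bounds(1)[OF x, of n] by (simp add: c'_def abs_mult)
    also have "\<dots> \<le> 2 * 1 / 1"
      using cutoff_bounds[OF x, of n] by (intro frac_le mult_left_mono) auto
    finally have "\<bar>c' x\<bar> * \<bar>\<rho> x\<bar> \<le> 2 * A"
      using bound(1)[OF x] by (intro mult_mono) auto
    moreover have "\<bar>\<rho>' x\<bar> * \<bar>cutoff n x\<bar> \<le> B * 1"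
      using bound(2)[OF x] cutoff_bounds[OF x, of n] by (intro mult_mono) auto
    ultimately show ?thesis
      unfolding \<phi>'_def real_norm_def by (intro order_trans[OF abs_triangle_ineq]) (simp add: abs_mult)
  qed
  have lip: "\<bar>\<phi> (u + v) - \<phi> u\<bar> \<le> (2 * A + B) * v" if "u > 0" "v > 0" for u v
  proof -
    have "norm (\<phi> (u + v) - \<phi> u) \<le> (2 * A + B) * norm (u + v - u)"
      by (rule field_differentiable_bound[where S = "{0..}" and f' = \<phi>']) (use d bd that in auto)
    then show ?thesis
      using that by simp
  qed
  show "\<bar>coag_increment (\<lambda>x. cutoff n x * \<rho> x) x y\<bar> \<le> 2 * (2 * A + B) * (x * y)"
    if xy: "x > 0" "y > 0" for x y
  proof -
    have "coag_increment \<phi> x y = x * (\<phi> (x + y) - \<phi> x) + y * (\<phi> (y + x) - \<phi> y)"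
      by (simp add: coag_increment_def algebra_simps)
    also have "\<bar>\<dots>\<bar> \<le> \<bar>x * (\<phi> (x + y) - \<phi> x)\<bar> + \<bar>y * (\<phi> (y + x) - \<phi> y)\<bar>"
      by (rule abs_triangle_ineq)
    also have "\<dots> \<le> x * ((2 * A + B) * y) + y * ((2 * A + B) * x)"
      using lip[OF xy] lip[OF xy(2,1)] xy by (intro add_mono) (simp_all add: abs_mult mult_left_mono)
    finally show ?thesis
      by (simp add: \<phi>_def algebra_simps)
  qed
qed

text \<open>Riemann sums of \<open>\<integral>\<^sub>0\<^sup>l e\<^bsup>-sx\<^esup> ds = (1 - e\<^bsup>-lx\<^esup>) / x\<close>; unlike the limit they are visibly \<open>C\<^sup>1\<close> at 0.\<close>

definition exp_riemann_sum :: "real \<Rightarrow> nat \<Rightarrow> real \<Rightarrow> real" where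
  "exp_riemann_sum l n x = (\<Sum>k\<le>n. l / real (Suc n) * exp (- (l * real (Suc k) / real (Suc n) * x)))"

definition exp_riemann_sum_deriv :: "real \<Rightarrow> nat \<Rightarrow> real \<Rightarrow> real" where
  "exp_riemann_sum_deriv l n x =
    (\<Sum>k\<le>n. l / real (Suc n) * (exp (- (l * real (Suc k) / real (Suc n) * x)) * - (l * real (Suc k) / real (Suc n))))"

lemma exp_riemann_sum_0 [simp]: "exp_riemann_sum l n 0 = l"
  by (simp add: exp_riemann_sum_def)

lemma has_derivative_exp_riemann_sum:
  "(exp_riemann_sum l n has_real_derivative exp_riemann_sum_deriv l n x) (at x within A)"
  unfolding exp_riemann_sum_def[abs_def] exp_riemann_sum_deriv_def
  by (intro DERIV_sum DERIV_cmult) (auto intro!: derivative_eq_intros simp del: of_nat_Suc)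

lemma continuous_on_exp_riemann_sum_deriv: "continuous_on A (exp_riemann_sum_deriv l n)"
  unfolding exp_riemann_sum_deriv_def[abs_def] by (intro continuous_intros) auto

lemma exp_riemann_sum_bounds:
  assumes l: "l > 0" and x: "x \<ge> 0"
  shows "\<bar>exp_riemann_sum l n x\<bar> \<le> l"
    and "\<bar>exp_riemann_sum_deriv l n x\<bar> \<le> l * l"
proof -
  have e: "exp (- (l * real (Suc k) / real (Suc n) * x)) \<le> 1" for k
    using l x by simp
  have "\<bar>exp_riemann_sum l n x\<bar> \<le> (\<Sum>k\<le>n. l / real (Suc n))"
    unfolding exp_riemann_sum_def using e l
    by (intro order_trans[OF sum_abs] sum_mono) (simp add: abs_mult divide_right_mono del: of_nat_Suc)
  then show "\<bar>exp_riemann_sum l n x\<bar> \<le> l"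
    by simp
  have "\<bar>exp_riemann_sum_deriv l n x\<bar> \<le> (\<Sum>k\<le>n. l / real (Suc n) * l)"
    unfolding exp_riemann_sum_deriv_def
  proof (intro order_trans[OF sum_abs] sum_mono)
    fix k assume "k \<in> {..n}"
    then have "l * real (Suc k) / real (Suc n) \<le> l"
      using l by (simp add: field_simps)
    moreover have "l * real (Suc k) / real (Suc n) \<ge> 0"
      using l by simp
    ultimately have "exp (- (l * real (Suc k) / real (Suc n) * x)) * (l * real (Suc k) / real (Suc n)) \<le> 1 * l"
      using e[of k] by (intro mult_mono) auto
    then have "l / real (Suc n) * (exp (- (l * real (Suc k) / real (Suc n) * x)) * (l * real (Suc k) / real (Suc n))) \<le> l / real (Suc n) * (1 * l)"
      using l by (intro mult_left_mono) auto
    moreover have "\<bar>l / real (Suc n) * (exp (- (l * real (Suc k) / real (Suc n) * x)) * - (l * real (Suc k) / real (Suc n)))\<bar>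
        = l / real (Suc n) * (exp (- (l * real (Suc k) / real (Suc n) * x)) * (l * real (Suc k) / real (Suc n)))"
      using l unfolding mult_minus_right abs_minus_cancel by (intro abs_of_nonneg) simp
    ultimately show "\<bar>l / real (Suc n) * (exp (- (l * real (Suc k) / real (Suc n) * x)) * - (l * real (Suc k) / real (Suc n)))\<bar> \<le> l / real (Suc n) * l"
      by (simp only: mult_1_left)
  qed
  then show "\<bar>exp_riemann_sum_deriv l n x\<bar> \<le> l * l"
    by simp
qed

text \<open>A geometric sum with step h = l / (n + 1). In closed form its denominator is (exp (h *
  x) - 1) / h, a difference quotient that tends to x.\<close>

lemma exp_riemann_sum_tendsto:
  assumes l: "l > 0" and x: "x > 0"
  shows "(\<lambda>n. exp_riemann_sum l n x) \<longlonglongrightarrow> (1 - exp (- (l * x))) / x"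
proof -
  define h where "h = (\<lambda>n. l / real (Suc n))"
  have h: "h n > 0" for n
    using l by (simp add: h_def)
  have eq: "exp_riemann_sum l n x = (1 - exp (- (l * x))) / ((exp (h n * x) - 1) / h n)" for n
  proof -
    define q where "q = exp (- (h n * x))"
    have q: "0 < q" "q < 1"
      using h[of n] x by (auto simp: q_def)
    have "exp (- (l * real (Suc k) / real (Suc n) * x)) = q * q ^ k" for k
    proof -
      have "- (l * real (Suc k) / real (Suc n) * x) = real (Suc k) * (- (h n * x))"
        by (simp add: h_def)
      then show ?thesis
        by (simp only: q_def exp_of_nat_mult power_Suc)
    qed
    then have "exp_riemann_sum l n x = h n * (q * (\<Sum>k\<le>n. q ^ k))"
      by (simp only: exp_riemann_sum_def h_def sum_distrib_left)
    also have "(\<Sum>k\<le>n. q ^ k) = (1 - q ^ Suc n) / (1 - q)"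
      using q by (subst sum_gp0) auto
    also have "q ^ Suc n = exp (- (l * x))"
    proof -
      have "real (Suc n) * (- (h n * x)) = - (l * x)"
        by (simp add: h_def)
      then show ?thesis
        unfolding q_def by (simp only: exp_of_nat_mult[symmetric])
    qed
    also have "h n * (q * ((1 - exp (- (l * x))) / (1 - q))) = (1 - exp (- (l * x))) / ((1 / q - 1) / h n)"
      using q h[of n] by (simp add: field_simps)
    also have "1 / q = exp (h n * x)"
      by (simp add: q_def exp_minus field_simps)
    finally show ?thesis .
  qed
  have "h \<longlonglongrightarrow> 0"
    unfolding h_def using tendsto_mult[OF tendsto_const[of l] LIMSEQ_inverse_real_of_nat] by (simp add: divide_inverse)
  moreover have "((\<lambda>h. exp (h * x)) has_real_derivative x) (at 0)"
    by (auto intro!: derivative_eq_intros)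
  ultimately have "(\<lambda>n. (exp ((0 + h n) * x) - exp (0 * x)) / h n) \<longlonglongrightarrow> x"
    using h by (intro DERIV_imp_LIMSEQ) (auto simp: less_imp_neq[symmetric])
  then have "(\<lambda>n. (exp (h n * x) - 1) / h n) \<longlonglongrightarrow> x"
    by simp
  then show ?thesis
    unfolding eq using x by (intro tendsto_divide tendsto_const) auto
qed

lemma (in levy_measure) coag_form_tendsto:
  assumes cont: "\<And>n. continuous_on {0<..} (\<phi> n)" and \<omega>: "integrable \<mu> \<omega>"
    and le: "\<And>n x y. x > 0 \<Longrightarrow> y > 0 \<Longrightarrow> \<bar>coag_increment (\<phi> n) x y\<bar> \<le> C * (\<omega> x * \<omega> y)"
    and lim: "\<And>x. x > 0 \<Longrightarrow> (\<lambda>n. \<phi> n x) \<longlonglongrightarrow> \<psi> x" and cont': "continuous_on {0<..} \<psi>"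
  shows "(\<lambda>n. coag_form (\<phi> n) \<mu>) \<longlonglongrightarrow> coag_form \<psi> \<mu>"
proof -
  have lim_inc: "(\<lambda>n. coag_increment (\<phi> n) x y) \<longlonglongrightarrow> coag_increment \<psi> x y" if "x > 0" "y > 0" for x y
    unfolding coag_increment_def using that by (intro tendsto_intros lim) auto
  have le': "\<bar>coag_increment \<psi> x y\<bar> \<le> C * (\<omega> x * \<omega> y)" if "x > 0" "y > 0" for x y
    by (rule tendsto_upperbound[OF tendsto_rabs[OF lim_inc[OF that]]]) (use le[OF that] in auto)
  have int: "integrable (\<mu> \<Otimes>\<^sub>M \<mu>) (\<lambda>p. C * (case p of (x, y) \<Rightarrow> \<omega> x * \<omega> y))"
    by (intro integrable_mult_right integrable_prod_weight \<omega>)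
  have "(\<lambda>n. \<integral>(x, y). coag_increment (\<phi> n) x y \<partial>(\<mu> \<Otimes>\<^sub>M \<mu>)) \<longlonglongrightarrow> (\<integral>(x, y). coag_increment \<psi> x y \<partial>(\<mu> \<Otimes>\<^sub>M \<mu>))"
  proof (rule integral_dominated_convergence[OF _ _ int])
    show "AE p in \<mu> \<Otimes>\<^sub>M \<mu>. (\<lambda>n. case p of (x, y) \<Rightarrow> coag_increment (\<phi> n) x y) \<longlonglongrightarrow> (case p of (x, y) \<Rightarrow> coag_increment \<psi> x y)"
      using lim_inc by (intro AE_I2) (auto simp: space_pair_measure space_eq)
    show "AE p in \<mu> \<Otimes>\<^sub>M \<mu>. norm (case p of (x, y) \<Rightarrow> coag_increment (\<phi> n) x y) \<le> C * (case p of (x, y) \<Rightarrow> \<omega> x * \<omega> y)" for n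
      using le by (intro AE_I2) (auto simp: space_pair_measure space_eq)
  qed (intro borel_measurable_coag_increment cont cont')+
  then show ?thesis
    by (simp add: coag_form_eq_prod[OF integrable_coag_increment[OF cont \<omega> le]]
        coag_form_eq_prod[OF integrable_coag_increment[OF cont' \<omega> le']])
qed

text \<open>The quantity (r - u) / (r + u) * exp (2 * r * s) is a first integral; nonnegativity of u
  keeps its denominator positive.\<close>

lemma riccati_unique:
  fixes u :: "real \<Rightarrow> real"
  assumes r: "r > 0" and t: "t \<ge> 0" and u0: "u 0 = 0" and nonneg: "\<And>s. s \<in> {0..t} \<Longrightarrow> u s \<ge> 0"
    and u': "\<And>s. s \<in> {0..t} \<Longrightarrow> (u has_real_derivative r\<^sup>2 - (u s)\<^sup>2) (at s within {0..t})"
  shows "u t = r * tanh (r * t)"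
proof -
  define h where "h = (\<lambda>s. (r - u s) / (r + u s) * exp (2 * r * s))"
  have "(h has_real_derivative 0) (at s within {0..t})" if s: "s \<in> {0..t}" for s
  proof -
    have pos: "r + u s > 0"
      using r nonneg[OF s] by simp
    define E where "E = exp (2 * r * s)"
    have 1: "((\<lambda>s. (r - u s) / (r + u s)) has_real_derivative
        ((0 - (r\<^sup>2 - (u s)\<^sup>2)) * (r + u s) - (r - u s) * (0 + (r\<^sup>2 - (u s)\<^sup>2))) / ((r + u s) * (r + u s)))
        (at s within {0..t})"
      by (intro DERIV_divide DERIV_diff DERIV_add DERIV_const u'[OF s]) (use pos in auto)
    have 2: "((\<lambda>s. exp (2 * r * s)) has_real_derivative 2 * r * E) (at s within {0..t})"
      unfolding E_def by (auto intro!: derivative_eq_intros)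
    have "((0 - (r\<^sup>2 - (u s)\<^sup>2)) * (r + u s) - (r - u s) * (0 + (r\<^sup>2 - (u s)\<^sup>2))) / ((r + u s) * (r + u s))
        = - 2 * r * ((r - u s) / (r + u s))"
    proof -
      have "(0 - (r\<^sup>2 - (u s)\<^sup>2)) * (r + u s) - (r - u s) * (0 + (r\<^sup>2 - (u s)\<^sup>2))
          = - 2 * r * (r - u s) * (r + u s)"
        by (simp add: power2_eq_square algebra_simps)
      then show ?thesis
        using pos by (simp add: divide_simps)
    qed
    from DERIV_mult[OF 1[unfolded this] 2] show ?thesis
      by (simp add: h_def E_def)
  qed
  then have "\<exists>c. \<forall>s\<in>{0..t}. h s = c"
    by (intro has_field_derivative_zero_constant) auto
  then have "h t = h 0"
    using t by (metis atLeastAtMost_iff order_refl)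
  also have "h 0 = 1"
    using r u0 by (simp add: h_def)
  finally have eq: "(r - u t) / (r + u t) * exp (2 * r * t) = 1"
    unfolding h_def .
  have pos: "r + u t > 0"
    using r nonneg[of t] t by simp
  have "(r - u t) * exp (2 * r * t) = ((r - u t) / (r + u t) * exp (2 * r * t)) * (r + u t)"
    using pos by simp
  also have "\<dots> = r + u t"
    unfolding eq by simp
  finally have "(r - u t) * exp (2 * r * t) = r + u t" .
  then have "(r - u t) * (exp (2 * r * t) * exp (- 2 * (r * t))) = (r + u t) * exp (- 2 * (r * t))"
    by (metis mult.assoc)
  then have "r - u t = (r + u t) * exp (- 2 * (r * t))"
    by (simp flip: exp_add)
  then have "u t * (1 + exp (- 2 * (r * t))) = r * (1 - exp (- 2 * (r * t)))"
    by (simp add: algebra_simps)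
  moreover have "1 + exp (- 2 * (r * t)) > 0"
    by (intro add_pos_pos) auto
  ultimately show ?thesis
    unfolding tanh_real_altdef by (simp add: field_simps)
qed

section \<open>The transform of an arbitrary flux solution\<close>

context
  fixes g :: "real \<Rightarrow> real measure"
  assumes g: "flux_solution g"
begin

lemma flux_solution_equation:
  assumes "\<phi> \<in> C1c {0..}" "t > 0"
  shows "set_integrable lborel {0..t} (\<lambda>s. coag_form \<phi> (g s))"
    and "(\<integral>x. \<phi> x * x \<partial>g t) = (LINT s:{0..t}|lborel. coag_form \<phi> (g s)) + t * \<phi> 0"
  using g assms unfolding flux_solution_def by blast+

lemma
  assumes t: "t \<ge> 0"
  shows flux_solution_levy_measure: "levy_measure (g t)"
    and flux_solution_integrable_mass: "integrable (g t) (\<lambda>x. x)"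
proof -
  have sets: "sets (g t) = sets (restrict_space borel {0<..})"
    and fin: "finite_measure (mass_measure (g t))"
    using g t by (auto simp: flux_solution_def radon_measure_on_def)
  have space: "space (g t) = {0<..}"
    using sets_eq_imp_space_eq[OF sets] by (simp add: space_restrict_space)
  have meas: "f \<in> borel_measurable (g t)" if "f \<in> borel_measurable borel" for f :: "real \<Rightarrow> real"
    unfolding measurable_cong_sets[OF sets refl] using that by (rule measurable_restrict_space1)
  have "(\<integral>\<^sup>+x. ennreal x \<partial>g t) = emeasure (mass_measure (g t)) (space (mass_measure (g t)))"
  proof -
    have "(\<lambda>x. ennreal x) \<in> borel_measurable (g t)"
      by (intro measurable_compose[OF meas measurable_ennreal]) simp
    then have "emeasure (mass_measure (g t)) (space (mass_measure (g t)))
        = (\<integral>\<^sup>+x. ennreal x * indicator (space (g t)) x \<partial>g t)"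
      by (simp add: mass_measure_def emeasure_density)
    also have "\<dots> = (\<integral>\<^sup>+x. ennreal x \<partial>g t)"
      by (intro nn_integral_cong) simp
    finally show ?thesis ..
  qed
  also have "\<dots> < \<infinity>"
    using finite_measure.emeasure_finite[OF fin] by (simp add: top.not_eq_extremum)
  finally show int: "integrable (g t) (\<lambda>x. x)"
    by (intro integrableI_nonneg meas AE_I2) (auto simp: space)
  show "levy_measure (g t)"
  proof
    show "integrable (g t) (\<lambda>x. 1 - exp (- x))"
    proof (rule Bochner_Integration.integrable_bound[OF int])
      show "AE x in g t. norm (1 - exp (- x)) \<le> norm x"
      proof (rule AE_I2)
        fix x assume "x \<in> space (g t)"
        then show "norm (1 - exp (- x)) \<le> norm x"
          using exp_ge_add_one_self[of "- x"] by (simp add: space)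
      qed
    qed (rule meas, measurable)
  qed (rule sets)
qed

text \<open>The increments of a decreasing test function are nonpositive; its flux contribution is at most \<open>t\<close>.\<close>

lemma flux_solution_mass_le:
  assumes t: "t \<ge> 0"
  shows "(\<integral>x. x \<partial>g t) \<le> t"
proof (cases "t = 0")
  case True
  have "g 0 = null_measure (restrict_space borel {0<..})"
    using g by (simp add: flux_solution_def)
  then show ?thesis
    using True by simp
next
  case False
  with t have t: "t > 0"
    by simp
  interpret levy_measure "g t"
    using t by (intro flux_solution_levy_measure) simp
  have cut: "cutoff n \<in> C1c {0..}" for n
    using cutoff_mult(1)[of "\<lambda>_. 1" "\<lambda>_. 0" 1 0 n] by simp
  have le: "(\<integral>x. cutoff n x * x \<partial>g t) \<le> t" for n
  proof -
    have "coag_form (cutoff n) (g s) \<le> 0" if s: "s \<in> {0..t}" for s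
    proof -
      interpret s: levy_measure "g s"
        using s by (intro flux_solution_levy_measure) simp
      have "coag_increment (cutoff n) x y \<le> 0" if "x > 0" "y > 0" for x y
      proof -
        have "x * cutoff n (x + y) \<le> x * cutoff n x" "y * cutoff n (x + y) \<le> y * cutoff n y"
          using that by (auto intro!: mult_left_mono cutoff_antimono)
        then show ?thesis
          by (simp add: coag_increment_def algebra_simps)
      qed
      then have "0 \<le> (\<integral>x. - (\<integral>y. coag_increment (cutoff n) x y \<partial>g s) \<partial>g s)"
        unfolding integral_minus[symmetric]
        by (intro integral_nonneg_AE AE_I2) (auto simp: s.space_eq)
      then show ?thesis
        by (simp add: coag_form_def)
    qed
    then have "0 \<le> (LINT s:{0..t}|lborel. - coag_form (cutoff n) (g s))"
      unfolding set_lebesgue_integral_def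
      by (intro integral_nonneg_AE AE_I2) (auto simp: indicator_def)
    then have "(LINT s:{0..t}|lborel. coag_form (cutoff n) (g s)) \<le> 0"
      by (simp add: set_lebesgue_integral_def)
    then show ?thesis
      using flux_solution_equation(2)[OF cut t, of n] by simp
  qed
  have "(\<lambda>n. \<integral>x. cutoff n x * x \<partial>g t) \<longlonglongrightarrow> (\<integral>x. x \<partial>g t)"
  proof (rule integral_dominated_convergence)
    show "integrable (g t) (\<lambda>x. x)"
      using t by (intro flux_solution_integrable_mass) simp
    show "(\<lambda>x. cutoff n x * x) \<in> borel_measurable (g t)" for n
      unfolding cutoff_def by (intro borel_measurable_continuous continuous_intros) auto
    show "AE x in g t. (\<lambda>n. cutoff n x * x) \<longlonglongrightarrow> x"
      using tendsto_mult[OF cutoff_tendsto tendsto_const] by (intro AE_I2) fastforce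
    show "AE x in g t. norm (cutoff n x * x) \<le> x" for n
    proof (rule AE_I2)
      fix x assume "x \<in> space (g t)"
      then show "norm (cutoff n x * x) \<le> x"
        using cutoff_bounds(3,4)[of x n] mult_right_mono[of "cutoff n x" 1 x]
        by (simp add: space_eq abs_mult)
    qed
  qed (rule borel_measurable_borel, simp)
  then show ?thesis
    by (rule tendsto_upperbound) (use le in auto)
qed

text \<open>The equation is tested with compactly supported approximations. Their increments are
  dominated by L * x * y in space, and by the mass bound their forms are dominated by L * t^2 in
  time, so both sides pass to the limit.\<close>

lemma flux_solution_bernstein_integral:
  assumes t: "t > 0" and l: "l > 0"
  shows "set_integrable lborel {0..t} (\<lambda>s. - (bernstein (g s) l)\<^sup>2)"
    and "bernstein (g t) l = (LINT s:{0..t}|lborel. - (bernstein (g s) l)\<^sup>2) + t * l"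
proof -
  define \<phi> where "\<phi> = (\<lambda>n x. cutoff n x * exp_riemann_sum l n x)"
  define \<psi> where "\<psi> = (\<lambda>x. (1 - exp (- (l * x))) / x)"
  define L where "L = 2 * (2 * l + l * l)"
  have L: "L \<ge> 0"
    using l by (simp add: L_def)
  have \<phi>: "\<phi> n \<in> C1c {0..}"
    "\<And>x y. x > 0 \<Longrightarrow> y > 0 \<Longrightarrow> \<bar>coag_increment (\<phi> n) x y\<bar> \<le> L * (x * y)" for n
  proof -
    note cm = cutoff_mult[OF has_derivative_exp_riemann_sum continuous_on_exp_riemann_sum_deriv
        exp_riemann_sum_bounds[OF l]]
    show "\<phi> n \<in> C1c {0..}"
      unfolding \<phi>_def by (rule cm(1))
    show "\<bar>coag_increment (\<phi> n) x y\<bar> \<le> L * (x * y)" if "x > 0" "y > 0" for x y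
      unfolding \<phi>_def L_def by (rule cm(2)) (use that in auto)
  qed
  have \<phi>_cont: "continuous_on {0<..} (\<phi> n)" for n
    using C1c_continuous_on[OF \<phi>(1)] by (rule continuous_on_subset) auto
  have \<psi>_cont: "continuous_on {0<..} \<psi>"
    unfolding \<psi>_def by (intro continuous_intros) auto
  have lim: "(\<lambda>n. \<phi> n x) \<longlonglongrightarrow> \<psi> x" if "x > 0" for x
    using tendsto_mult[OF cutoff_tendsto exp_riemann_sum_tendsto[OF l that]] by (simp add: \<phi>_def \<psi>_def)
  have form: "(\<lambda>n. coag_form (\<phi> n) (g s)) \<longlonglongrightarrow> - (bernstein (g s) l)\<^sup>2"
    and form_le: "\<And>n. \<bar>coag_form (\<phi> n) (g s)\<bar> \<le> L * t\<^sup>2" if s: "s \<in> {0..t}" for s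
  proof -
    interpret levy_measure "g s"
      using s by (intro flux_solution_levy_measure) simp
    have int: "integrable (g s) (\<lambda>x. x)"
      using s by (intro flux_solution_integrable_mass) simp
    have "(\<lambda>n. coag_form (\<phi> n) (g s)) \<longlonglongrightarrow> coag_form \<psi> (g s)"
      by (rule coag_form_tendsto[OF \<phi>_cont int \<phi>(2) lim \<psi>_cont])
    then show "(\<lambda>n. coag_form (\<phi> n) (g s)) \<longlonglongrightarrow> - (bernstein (g s) l)\<^sup>2"
      using coag_form_one_minus_exp[OF l] by (simp add: \<psi>_def)
    fix n
    have "\<bar>coag_form (\<phi> n) (g s)\<bar> \<le> L * (\<integral>x. x \<partial>g s)\<^sup>2"
      by (rule abs_coag_form_le[OF \<phi>_cont int \<phi>(2)])
    also have "\<dots> \<le> L * t\<^sup>2"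
    proof (intro mult_left_mono power_mono L)
      show "(\<integral>x. x \<partial>g s) \<le> t"
        using flux_solution_mass_le[of s] s by simp
      show "0 \<le> (\<integral>x. x \<partial>g s)"
        by (intro integral_nonneg_AE AE_I2) (simp add: space_eq)
    qed
    finally show "\<bar>coag_form (\<phi> n) (g s)\<bar> \<le> L * t\<^sup>2" .
  qed
  let ?f = "\<lambda>n s. indicator {0..t} s *\<^sub>R coag_form (\<phi> n) (g s)"
  let ?F = "\<lambda>s. indicator {0..t} s *\<^sub>R (- (bernstein (g s) l)\<^sup>2)"
  have meas: "?f n \<in> borel_measurable lborel" for n
    using flux_solution_equation(1)[OF \<phi>(1) t, of n] unfolding set_integrable_def by (rule borel_measurable_integrable)
  have pw: "(\<lambda>n. ?f n s) \<longlonglongrightarrow> ?F s" for s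
    using form[of s] by (cases "s \<in> {0..t}") auto
  have bound: "norm (?f n s) \<le> indicator {0..t} s * (L * t\<^sup>2)" for n s
    using form_le[of s n] by (cases "s \<in> {0..t}") auto
  have int_bound: "integrable lborel (\<lambda>s. indicator {0..t} s * (L * t\<^sup>2))"
    by (intro integrable_mult_left integrable_real_indicator) (simp_all add: emeasure_lborel_Icc_eq)
  \<comment> \<open>Measurability of the transform in time is inherited from the forms in the
    equation, which are integrable by definition of a solution.\<close>
  have meas_F: "?F \<in> borel_measurable lborel"
    by (rule borel_measurable_LIMSEQ_real[OF pw meas])
  show "set_integrable lborel {0..t} (\<lambda>s. - (bernstein (g s) l)\<^sup>2)"
    unfolding set_integrable_def
    by (rule integrable_dominated_convergence[OF meas_F meas int_bound AE_I2 AE_I2]) (rule pw, rule bound)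
  have "(\<lambda>n. LINT s:{0..t}|lborel. coag_form (\<phi> n) (g s)) \<longlonglongrightarrow> (LINT s:{0..t}|lborel. - (bernstein (g s) l)\<^sup>2)"
    unfolding set_lebesgue_integral_def
    by (rule integral_dominated_convergence[OF meas_F meas int_bound AE_I2 AE_I2]) (rule pw, rule bound)
  then have rhs: "(\<lambda>n. (LINT s:{0..t}|lborel. coag_form (\<phi> n) (g s)) + t * l)
      \<longlonglongrightarrow> (LINT s:{0..t}|lborel. - (bernstein (g s) l)\<^sup>2) + t * l"
    by (intro tendsto_intros)
  have eq: "(\<integral>x. \<phi> n x * x \<partial>g t) = (LINT s:{0..t}|lborel. coag_form (\<phi> n) (g s)) + t * l" for n
    using flux_solution_equation(2)[OF \<phi>(1) t, of n] by (simp add: \<phi>_def)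
  have lhs: "(\<lambda>n. \<integral>x. \<phi> n x * x \<partial>g t) \<longlonglongrightarrow> bernstein (g t) l"
    unfolding bernstein_def
  proof (rule integral_dominated_convergence)
    interpret levy_measure "g t"
      using t by (intro flux_solution_levy_measure) simp
    show "(\<lambda>x. 1 - exp (- (l * x))) \<in> borel_measurable (g t)"
      by (intro borel_measurable_continuous continuous_intros)
    show "(\<lambda>x. \<phi> n x * x) \<in> borel_measurable (g t)" for n
      by (intro borel_measurable_continuous continuous_intros \<phi>_cont)
    show "integrable (g t) (\<lambda>x. l * x)"
      using t by (intro integrable_mult_right flux_solution_integrable_mass) simp
    show "AE x in g t. (\<lambda>n. \<phi> n x * x) \<longlonglongrightarrow> 1 - exp (- (l * x))"
    proof (rule AE_I2)
      fix x assume "x \<in> space (g t)"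
      then have "x > 0"
        by (simp add: space_eq)
      then show "(\<lambda>n. \<phi> n x * x) \<longlonglongrightarrow> 1 - exp (- (l * x))"
        using tendsto_mult[OF lim[OF \<open>x > 0\<close>] tendsto_const[of x]] by (simp add: \<psi>_def)
    qed
    show "AE x in g t. norm (\<phi> n x * x) \<le> l * x" for n
    proof (rule AE_I2)
      fix x assume "x \<in> space (g t)"
      then have x: "x > 0"
        by (simp add: space_eq)
      have "\<bar>cutoff n x\<bar> * \<bar>exp_riemann_sum l n x\<bar> \<le> 1 * l"
        using cutoff_bounds(3,4)[of x n] exp_riemann_sum_bounds(1)[OF l, of x n] x
        by (intro mult_mono) auto
      then show "norm (\<phi> n x * x) \<le> l * x"
        using x by (simp add: \<phi>_def abs_mult mult_right_mono)
    qed
  qed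
  show "bernstein (g t) l = (LINT s:{0..t}|lborel. - (bernstein (g s) l)\<^sup>2) + t * l"
    using lhs rhs unfolding eq by (rule LIMSEQ_unique)
qed

text \<open>A bootstrap: integrability of u^2 makes u continuous through the integral equation,
  continuity makes u differentiable, and the Riccati equation then determines it.\<close>

lemma flux_solution_bernstein:
  assumes t: "t \<ge> 0" and l: "l > 0"
  shows "bernstein (g t) l = sqrt l * tanh (sqrt l * t)"
proof -
  define u where "u = (\<lambda>s. bernstein (g s) l)"
  \<comment> \<open>A time horizon that is positive even for t = 0, as the integral equation
    requires.\<close>
  define T where "T = t + 1"
  have T: "T > 0" "t \<le> T"
    using t by (auto simp: T_def)
  have u0: "u 0 = 0"
    using g by (simp add: u_def bernstein_def flux_solution_def)
  have int: "(\<lambda>s. - (u s)\<^sup>2) integrable_on {0..T}"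
    using set_borel_integral_eq_integral(1)[OF flux_solution_bernstein_integral(1)[OF T(1) l]] by (simp add: u_def)
  have u_eq: "u s = integral {0..s} (\<lambda>s. - (u s)\<^sup>2) + s * l" if "s \<ge> 0" for s
  proof (cases "s = 0")
    case False
    with that have s: "s > 0"
      by simp
    show ?thesis
      using flux_solution_bernstein_integral[OF s l]
        set_borel_integral_eq_integral(2)[OF flux_solution_bernstein_integral(1)[OF s l]]
      by (simp add: u_def)
  qed (simp add: u0)
  have "continuous_on {0..T} (\<lambda>s. integral {0..s} (\<lambda>s. - (u s)\<^sup>2) + s * l)"
    by (intro continuous_intros indefinite_integral_continuous_1 int)
  then have "continuous_on {0..T} u"
    by (rule continuous_on_eq) (use u_eq in auto)
  then have cont: "continuous_on {0..T} (\<lambda>s. - (u s)\<^sup>2)"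
    by (intro continuous_intros)
  have u': "(u has_real_derivative (sqrt l)\<^sup>2 - (u s)\<^sup>2) (at s within {0..t})" if s: "s \<in> {0..t}" for s
  proof -
    have "((\<lambda>s. integral {0..s} (\<lambda>s. - (u s)\<^sup>2)) has_real_derivative - (u s)\<^sup>2) (at s within {0..T})"
      using s T by (intro integral_has_real_derivative cont) auto
    moreover have "((\<lambda>s. s * l) has_real_derivative l) (at s within {0..T})"
      by (auto intro!: derivative_eq_intros)
    ultimately have "((\<lambda>s. integral {0..s} (\<lambda>s. - (u s)\<^sup>2) + s * l) has_real_derivative - (u s)\<^sup>2 + l) (at s within {0..T})"
      by (rule DERIV_add)
    then have "(u has_real_derivative - (u s)\<^sup>2 + l) (at s within {0..T})"
      by (rule has_field_derivative_transform_within[of _ _ _ _ 1]) (use s T u_eq in auto)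
    then show ?thesis
      using l T by (auto intro: has_field_derivative_subset)
  qed
  have nonneg: "u s \<ge> 0" if "s \<in> {0..t}" for s
    using that l flux_solution_levy_measure[of s] unfolding u_def by (intro levy_measure.bernstein_nonneg) auto
  show ?thesis
    using riccati_unique[OF _ t u0 nonneg u'] l by (simp add: u_def)
qed

lemma flux_solution_unique:
  assumes "t \<ge> 0"
  shows "g t = explicit_solution t"
proof (rule levy_measure_eqI)
  show "bernstein (g t) (real k) = bernstein (explicit_solution t) (real k)" for k
    using assms by (cases "k = 0") (simp_all add: flux_solution_bernstein bernstein_explicit_solution)
qed (use assms in \<open>auto intro: flux_solution_levy_measure levy_measure_explicit_solution\<close>)

end

theorem theorem2p3:
  shows "stationary_flux_solution flux_profile \<and>
    (\<exists>f. flux_solution f \<and>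
         (\<forall>g. flux_solution g \<longrightarrow> (\<forall>t\<ge>0. g t = f t)) \<and>
         weak_star_tendsto {0<..} f flux_profile at_top)"
proof (intro conjI exI[of _ explicit_solution] allI impI)
  show "g t = explicit_solution t" if "flux_solution g" "t \<ge> 0" for g t
    using that by (rule flux_solution_unique)
qed (rule stationary_flux_profile flux_solution_explicit_solution explicit_solution_tendsto)+

end
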